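(* There is an absolute constant $C>0$ such that for every analytic map $\psi:\mathbb D\to\mathbb D$ for which the composition operator $C_\psi:\mathscr M\to\mathscr M$, $C_\psi f=f\circ\psi$, is bounded, one has \[C^{-1}\,\limsup_{|\alpha|\to1}\|(\varphi_\alpha\circ\psi)''\|_{1}\ \le\ \|C_\psi\|_e\ \le\ C\,\limsup_{|\alpha|\to1}\|(\varphi_\alpha\circ\psi)''\|_{1},\] where \[\limsup_{|\alpha|\to1}\|(\varphi_\alpha\circ\psi)''\|_{1}:=\lim_{s\to1^-}\ \sup_{\alpha\in\mathbb D,\ |\alpha|>s}\|(\varphi_\alpha\circ\psi)''\|_{1}.\]
   Context: $\mathbb D\subset\mathbb C$ is the open unit disk. For $\alpha\in\overline{\mathbb D}$, $\varphi_\alpha(z)=\dfrac{\alpha-z}{1-\overline\alpha z}$, $z\in\mathbb D$. The minimal M\"obius invariant space $\mathscr M$ is the set of all analytic functions $f$ on $\mathbb D$ for which there exist points $\alpha_n\in\overline{\mathbb D}$ and $\lambda=(\lambda(n))_{n\ge1}\in\ell^1$ (complex) with $f(z)=\sum_{n=1}^\infty\lambda(n)\varphi_{\alpha_n}(z)$; it is normed by $\|f\|_{\mathscr M}=\inf\|\lambda\|_{\ell^1}$, the infimum being over all such representations of $f$. For an analytic function $g$ on $\mathbb D$, $\|g\|_1=\iint_{\mathbb D}|g|\,dA$, where $dA$ is area measure normalized so that $A(\mathbb D)=1$. The essential norm of a bounded operator $C_\psi$ on $\mathscr M$ is $\|C_\psi\|_e=\inf\{\|C_\psi-K\|: K:\mathscr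 M\to\mathscr M \text{ compact linear operator}\}$, with $\|\cdot\|$ the operator norm on $(\mathscr M,\|\cdot\|_{\mathscr M})$. "Absolute constant" means a numerical constant independent of $\psi$. *)

theory Defs
  imports "HOL-Complex_Analysis.Complex_Analysis"
begin

abbreviation unit_disk :: "complex set" where
  "unit_disk \<equiv> ball 0 1"

definition phi :: "complex \<Rightarrow> complex \<Rightarrow> complex" where
  "phi \<alpha> z = (\<alpha> - z) / (1 - cnj \<alpha> * z)"

definition mobius_rep ::
  "(nat \<Rightarrow> complex) \<Rightarrow> (nat \<Rightarrow> complex) \<Rightarrow> (complex \<Rightarrow> complex) \<Rightarrow> bool" where
  "mobius_rep a l f \<longleftrightarrow>
     (\<forall>n. a n \<in> cball 0 1) \<and> summable (\<lambda>n. norm (l n)) \<and>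
     (\<forall>z\<in>unit_disk. (\<lambda>n. l n * phi (a n) z) sums f z)"

text \<open>A function on the disk is represented by its extension by zero to the whole plane,
  so that functions agreeing on the disk are equal.\<close>

definition min_space :: "(complex \<Rightarrow> complex) set" where
  "min_space = {f. f holomorphic_on unit_disk \<and> (\<exists>a l. mobius_rep a l f) \<and>
                   (\<forall>z. z \<notin> unit_disk \<longrightarrow> f z = 0)}"

lemma phi_denom_nonzero:
  assumes "norm \<alpha> \<le> 1" "norm z < 1"
  shows "1 - cnj \<alpha> * z \<noteq> 0"
proof
  assume "1 - cnj \<alpha> * z = 0"
  then have "norm (cnj \<alpha> * z) = 1" by simp
  moreover have "norm (cnj \<alpha> * z) < 1"
    using assms mult_left_le_one_le[of "norm z" "norm \<alpha>"] by (simp add: norm_mult)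
  ultimately show False by simp
qed

lemma norm_phi_le_1:
  assumes "norm \<alpha> \<le> 1" "norm z < 1"
  shows "norm (phi \<alpha> z) \<le> 1"
proof -
  have "(norm (1 - cnj \<alpha> * z))\<^sup>2 - (norm (\<alpha> - z))\<^sup>2 = (1 - (norm \<alpha>)\<^sup>2) * (1 - (norm z)\<^sup>2)"
    unfolding cmod_power2 by (simp add: power2_eq_square algebra_simps)
  moreover have "(1 - (norm \<alpha>)\<^sup>2) * (1 - (norm z)\<^sup>2) \<ge> 0"
    using assms by (intro mult_nonneg_nonneg) (auto simp: power_le_one)
  ultimately have "(norm (\<alpha> - z))\<^sup>2 \<le> (norm (1 - cnj \<alpha> * z))\<^sup>2" by linarith
  then have "norm (\<alpha> - z) \<le> norm (1 - cnj \<alpha> * z)" by (simp add: power2_le_iff_abs_le)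
  then show ?thesis
    using phi_denom_nonzero[OF assms] by (simp add: phi_def norm_divide)
qed

lemma mobius_rep_bound:
  assumes "mobius_rep a l f" "z \<in> unit_disk"
  shows "norm (f z) \<le> (\<Sum>n. norm (l n))"
proof -
  have s: "summable (\<lambda>n. norm (l n))" and f: "f z = (\<Sum>n. l n * phi (a n) z)"
    using assms by (auto simp: mobius_rep_def sums_iff)
  have le: "norm (l n * phi (a n) z) \<le> norm (l n)" for n
    using norm_phi_le_1[of "a n" z] assms
    by (auto simp: mobius_rep_def norm_mult intro: mult_left_le)
  show ?thesis
    unfolding f using s le by (rule norm_suminf_le[rotated])
qed

lemma mobius_rep_zero: "mobius_rep (\<lambda>_. 0) (\<lambda>_. 0) (\<lambda>_. 0)"
  by (simp add: mobius_rep_def)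

lemma sums_if_complex:
  fixes f g :: "nat \<Rightarrow> complex"
  assumes "f sums x" "g sums y"
  shows "(\<lambda>n. if even n then f (n div 2) else g ((n - 1) div 2)) sums (x + y)"
proof -
  have "(\<lambda>n. if even n then Re (f (n div 2)) else Re (g ((n - 1) div 2))) sums (Re y + Re x)"
    using assms by (intro sums_if) (auto simp: sums_complex_iff)
  moreover
  have "(\<lambda>n. if even n then Im (f (n div 2)) else Im (g ((n - 1) div 2))) sums (Im y + Im x)"
    using assms by (intro sums_if) (auto simp: sums_complex_iff)
  ultimately show ?thesis
    by (simp add: sums_complex_iff if_distrib add.commute)
qed

lemma mobius_rep_add:
  assumes "mobius_rep a l f" "mobius_rep b m g"
  shows "\<exists>c k. mobius_rep c k (\<lambda>z. f z + g z) \<and>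
           (\<Sum>n. norm (k n)) = (\<Sum>n. norm (l n)) + (\<Sum>n. norm (m n))"
proof -
  let ?c = "\<lambda>n. if even n then a (n div 2) else b ((n - 1) div 2)"
  let ?k = "\<lambda>n. if even n then l (n div 2) else m ((n - 1) div 2)"
  have "(\<lambda>n. if even n then norm (l (n div 2)) else norm (m ((n - 1) div 2)))
          sums ((\<Sum>n. norm (m n)) + (\<Sum>n. norm (l n)))"
    using assms by (intro sums_if) (auto simp: mobius_rep_def summable_sums)
  then have k: "(\<lambda>n. norm (?k n)) sums ((\<Sum>n. norm (m n)) + (\<Sum>n. norm (l n)))"
    by (simp add: if_distrib)
  have "(\<lambda>n. ?k n * phi (?c n) z) sums (f z + g z)" if "z \<in> unit_disk" for z
  proof -
    have "(\<lambda>n. if even n then l (n div 2) * phi (a (n div 2)) z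
                else m ((n - 1) div 2) * phi (b ((n - 1) div 2)) z) sums (f z + g z)"
      using assms that
      by (intro sums_if_complex[of "\<lambda>n. l n * phi (a n) z" _ "\<lambda>n. m n * phi (b n) z"])
         (auto simp: mobius_rep_def)
    moreover have "(\<lambda>n. ?k n * phi (?c n) z) =
        (\<lambda>n. if even n then l (n div 2) * phi (a (n div 2)) z
                else m ((n - 1) div 2) * phi (b ((n - 1) div 2)) z)"
      by auto
    ultimately show ?thesis by simp
  qed
  then have "mobius_rep ?c ?k (\<lambda>z. f z + g z)"
    using assms sums_summable[OF k] by (auto simp: mobius_rep_def)
  with sums_unique[OF k] show ?thesis
    by (intro exI[of _ ?c] exI[of _ ?k]) simp
qed

lemma mobius_rep_scale:
  assumes "mobius_rep a l f"
  shows "mobius_rep a (\<lambda>n. c * l n) (\<lambda>z. c * f z)"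
  using assms by (auto simp: mobius_rep_def norm_mult mult.assoc intro!: summable_mult sums_mult)

lemma mobius_rep_suminf_scale:
  assumes "mobius_rep a l f"
  shows "(\<Sum>n. norm (c * l n)) = norm c * (\<Sum>n. norm (l n))"
  using assms by (simp add: mobius_rep_def norm_mult suminf_mult)

lemma min_space_zero: "(\<lambda>_. 0) \<in> min_space"
  using mobius_rep_zero by (auto simp: min_space_def)

lemma min_space_add:
  assumes "f \<in> min_space" "g \<in> min_space"
  shows "(\<lambda>z. f z + g z) \<in> min_space"
proof -
  obtain a l b m where "mobius_rep a l f" "mobius_rep b m g"
    using assms by (auto simp: min_space_def)
  from mobius_rep_add[OF this] have "\<exists>c k. mobius_rep c k (\<lambda>z. f z + g z)" by blast
  then show ?thesis
    using assms by (auto simp: min_space_def intro!: holomorphic_intros)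
qed

lemma min_space_scale:
  assumes "f \<in> min_space"
  shows "(\<lambda>z. c * f z) \<in> min_space"
  using assms mobius_rep_scale by (fastforce simp: min_space_def intro!: holomorphic_intros)

typedef min_mobius = min_space
  morphisms eval_mm Abs_mm
  using min_space_zero by blast

lemma eval_mm_outside: "z \<notin> unit_disk \<Longrightarrow> eval_mm f z = 0"
  using eval_mm[of f] by (auto simp: min_space_def)

lemma eval_mm_rep: "\<exists>a l. mobius_rep a l (eval_mm f)"
  using eval_mm[of f] by (auto simp: min_space_def)

lemma min_mobius_eqI: "(\<And>z. eval_mm f z = eval_mm g z) \<Longrightarrow> f = g"
  by (simp add: eval_mm_inject[symmetric] fun_eq_iff)

definition scaleC_mm :: "complex \<Rightarrow> min_mobius \<Rightarrow> min_mobius" where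
  "scaleC_mm c f = Abs_mm (\<lambda>z. c * eval_mm f z)"

lemma eval_scaleC_mm [simp]: "eval_mm (scaleC_mm c f) z = c * eval_mm f z"
  by (simp add: scaleC_mm_def Abs_mm_inverse min_space_scale[OF eval_mm])

instantiation min_mobius :: real_normed_vector
begin

definition zero_min_mobius :: min_mobius where
  "zero_min_mobius = Abs_mm (\<lambda>_. 0)"

definition plus_min_mobius :: "min_mobius \<Rightarrow> min_mobius \<Rightarrow> min_mobius" where
  "plus_min_mobius f g = Abs_mm (\<lambda>z. eval_mm f z + eval_mm g z)"

definition uminus_min_mobius :: "min_mobius \<Rightarrow> min_mobius" where
  "uminus_min_mobius f = scaleC_mm (-1) f"

definition minus_min_mobius :: "min_mobius \<Rightarrow> min_mobius \<Rightarrow> min_mobius" where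
  "minus_min_mobius f g = f + (- g)"

definition scaleR_min_mobius :: "real \<Rightarrow> min_mobius \<Rightarrow> min_mobius" where
  "scaleR_min_mobius r f = scaleC_mm (of_real r) f"

definition norm_min_mobius :: "min_mobius \<Rightarrow> real" where
  "norm_min_mobius f = Inf {(\<Sum>n. norm (l n)) | a l. mobius_rep a l (eval_mm f)}"

definition sgn_min_mobius :: "min_mobius \<Rightarrow> min_mobius" where
  "sgn_min_mobius f = scaleR (inverse (norm f)) f"

definition dist_min_mobius :: "min_mobius \<Rightarrow> min_mobius \<Rightarrow> real" where
  "dist_min_mobius f g = norm (f - g)"

definition uniformity_min_mobius :: "(min_mobius \<times> min_mobius) filter" where
  "uniformity_min_mobius = (INF e\<in>{0 <..}. principal {(x, y). dist x y < e})"

definition open_min_mobius :: "min_mobius set \<Rightarrow> bool" where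
  "open_min_mobius S = (\<forall>x\<in>S. \<forall>\<^sub>F (x', y) in uniformity. x' = x \<longrightarrow> y \<in> S)"

lemma eval_zero_mm [simp]: "eval_mm 0 z = 0"
  by (simp add: zero_min_mobius_def Abs_mm_inverse min_space_zero)

lemma eval_plus_mm [simp]: "eval_mm (f + g) z = eval_mm f z + eval_mm g z"
  by (simp add: plus_min_mobius_def Abs_mm_inverse min_space_add eval_mm)

lemma eval_uminus_mm [simp]: "eval_mm (- f) z = - eval_mm f z"
  by (simp add: uminus_min_mobius_def)

lemma eval_minus_mm [simp]: "eval_mm (f - g) z = eval_mm f z - eval_mm g z"
  by (simp add: minus_min_mobius_def)

lemma eval_scaleR_mm [simp]: "eval_mm (r *\<^sub>R f) z = of_real r * eval_mm f z"
  by (simp add: scaleR_min_mobius_def)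

lemma norm_mm_le:
  assumes "mobius_rep a l (eval_mm f)"
  shows "norm f \<le> (\<Sum>n. norm (l n))"
  unfolding norm_min_mobius_def
  using assms
  by (intro cInf_lower) (auto simp: mobius_rep_def intro!: bdd_belowI[of _ 0] suminf_nonneg)

lemma norm_mm_ge:
  assumes "\<And>a l. mobius_rep a l (eval_mm f) \<Longrightarrow> b \<le> (\<Sum>n. norm (l n))"
  shows "b \<le> norm f"
  unfolding norm_min_mobius_def
  using assms eval_mm_rep[of f] by (intro cInf_greatest) auto

lemma norm_eval_mm_le: "norm (eval_mm f z) \<le> norm f"
proof (cases "z \<in> unit_disk")
  case True
  then show ?thesis by (intro norm_mm_ge) (rule mobius_rep_bound)
next
  case False
  then show ?thesis
    by (auto simp: eval_mm_outside mobius_rep_def intro!: norm_mm_ge suminf_nonneg)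
qed

lemma norm_scaleC_mm_le: "norm (scaleC_mm c f) \<le> norm c * norm f"
proof (cases "c = 0")
  case True
  have "mobius_rep (\<lambda>_. 0) (\<lambda>_. 0) (eval_mm (scaleC_mm c f))"
    using mobius_rep_zero by (simp add: True mobius_rep_def)
  from norm_mm_le[OF this] True show ?thesis by simp
next
  case False
  have "norm (scaleC_mm c f) / norm c \<le> norm f"
  proof (rule norm_mm_ge)
    fix a l assume rep: "mobius_rep a l (eval_mm f)"
    have "mobius_rep a (\<lambda>n. c * l n) (eval_mm (scaleC_mm c f))"
      using mobius_rep_scale[OF rep, of c] by (simp add: mobius_rep_def)
    from norm_mm_le[OF this] show "norm (scaleC_mm c f) / norm c \<le> (\<Sum>n. norm (l n))"
      using False by (simp add: mobius_rep_suminf_scale[OF rep] field_simps)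
  qed
  then show ?thesis using False by (simp add: field_simps)
qed

lemma norm_scaleC_mm: "norm (scaleC_mm c f) = norm c * norm f"
proof (cases "c = 0")
  case True
  have "norm (scaleC_mm c f) \<le> 0" using norm_scaleC_mm_le[of c f] True by simp
  moreover have "0 \<le> norm (scaleC_mm c f)"
    using norm_eval_mm_le[of "scaleC_mm c f" 0] norm_ge_zero order_trans by blast
  ultimately show ?thesis using True by simp
next
  case False
  have "scaleC_mm (inverse c) (scaleC_mm c f) = f"
    using False by (intro min_mobius_eqI) simp
  then have "norm f \<le> inverse (norm c) * norm (scaleC_mm c f)"
    using norm_scaleC_mm_le[of "inverse c" "scaleC_mm c f"] by (simp add: norm_inverse)
  then have "norm c * norm f \<le> norm (scaleC_mm c f)"
    using False by (simp add: field_simps)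
  with norm_scaleC_mm_le[of c f] show ?thesis by linarith
qed

instance
proof
  fix f g h :: min_mobius and r s :: real
  show "f + g + h = f + (g + h)" "f + g = g + f" "0 + f = f" "- f + f = 0" "f - g = f + - g"
    by (rule min_mobius_eqI; simp)+
  show "r *\<^sub>R (f + g) = r *\<^sub>R f + r *\<^sub>R g" "(r + s) *\<^sub>R f = r *\<^sub>R f + s *\<^sub>R f"
       "r *\<^sub>R s *\<^sub>R f = (r * s) *\<^sub>R f" "1 *\<^sub>R f = f"
    by (rule min_mobius_eqI; simp add: algebra_simps)+
  show "dist f g = norm (f - g)" by (rule dist_min_mobius_def)
  show "sgn f = inverse (norm f) *\<^sub>R f" by (rule sgn_min_mobius_def)
  show "(uniformity :: (min_mobius \<times> min_mobius) filter)
          = (INF e\<in>{0 <..}. principal {(x, y). dist x y < e})"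
    by (rule uniformity_min_mobius_def)
  show "open U = (\<forall>x\<in>U. \<forall>\<^sub>F (x', y) in uniformity. x' = x \<longrightarrow> y \<in> U)" for U :: "min_mobius set"
    by (rule open_min_mobius_def)
  show "norm (r *\<^sub>R f) = \<bar>r\<bar> * norm f"
    by (simp add: scaleR_min_mobius_def norm_scaleC_mm)
  show "norm f = 0 \<longleftrightarrow> f = 0"
  proof
    assume "norm f = 0"
    then have "eval_mm f z = 0" for z using norm_eval_mm_le[of f z] by simp
    then show "f = 0" by (intro min_mobius_eqI) simp
  next
    assume "f = 0"
    then have "f = scaleC_mm 0 f" by (intro min_mobius_eqI) simp
    then show "norm f = 0" using norm_scaleC_mm[of 0 f] by simp
  qed
  show "norm (f + g) \<le> norm f + norm g"
  proof -
    have "norm (f + g) - norm g \<le> norm f"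
    proof (rule norm_mm_ge)
      fix a l assume f: "mobius_rep a l (eval_mm f)"
      have "norm (f + g) - (\<Sum>n. norm (l n)) \<le> norm g"
      proof (rule norm_mm_ge)
        fix b m assume g: "mobius_rep b m (eval_mm g)"
        from mobius_rep_add[OF f g] obtain c k
          where "mobius_rep c k (\<lambda>z. eval_mm f z + eval_mm g z)"
            and k: "(\<Sum>n. norm (k n)) = (\<Sum>n. norm (l n)) + (\<Sum>n. norm (m n))" by blast
        then have "mobius_rep c k (eval_mm (f + g))" by (simp add: mobius_rep_def)
        from norm_mm_le[OF this] k
        show "norm (f + g) - (\<Sum>n. norm (l n)) \<le> (\<Sum>n. norm (m n))" by simp
      qed
      then show "norm (f + g) - norm g \<le> (\<Sum>n. norm (l n))" by simp
    qed
    then show ?thesis by simp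
  qed
qed

end

interpretation mm: vector_space scaleC_mm
  by standard (rule min_mobius_eqI; simp add: algebra_simps)+

definition comp_fun :: "(complex \<Rightarrow> complex) \<Rightarrow> min_mobius \<Rightarrow> complex \<Rightarrow> complex" where
  "comp_fun \<psi> f = (\<lambda>z. if z \<in> unit_disk then eval_mm f (\<psi> z) else 0)"

text \<open>Only meaningful when \<open>f \<circ> \<psi>\<close> lies in the space for every \<open>f\<close>, which is the first
  conjunct of the predicate \<open>bounded_comp_op\<close>.\<close>

definition comp_op :: "(complex \<Rightarrow> complex) \<Rightarrow> min_mobius \<Rightarrow> min_mobius" where
  "comp_op \<psi> f = Abs_mm (comp_fun \<psi> f)"

definition bounded_comp_op :: "(complex \<Rightarrow> complex) \<Rightarrow> bool" where
  "bounded_comp_op \<psi> \<longleftrightarrow> (\<forall>f. comp_fun \<psi> f \<in> min_space) \<and> bounded_linear (comp_op \<psi>)"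

lemma eval_comp_op:
  assumes "bounded_comp_op \<psi>" "z \<in> unit_disk"
  shows "eval_mm (comp_op \<psi> f) z = eval_mm f (\<psi> z)"
  using assms by (simp add: bounded_comp_op_def comp_op_def Abs_mm_inverse comp_fun_def)

definition compact_op :: "(min_mobius \<Rightarrow> min_mobius) \<Rightarrow> bool" where
  "compact_op K \<longleftrightarrow>
     Vector_Spaces.linear scaleC_mm scaleC_mm K \<and> compact (closure (K ` cball 0 1))"

definition essential_norm :: "(min_mobius \<Rightarrow> min_mobius) \<Rightarrow> real" where
  "essential_norm T = Inf {onorm (\<lambda>f. T f - K f) | K. compact_op K}"

text \<open>Area measure is divided by the area \<open>\<pi>\<close> of the disk. The value is allowed to be infinite.\<close>

definition disk_norm1 :: "(complex \<Rightarrow> complex) \<Rightarrow> ennreal" where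
  "disk_norm1 g = (\<integral>\<^sup>+z\<in>unit_disk. ennreal (norm (g z)) \<partial>lborel) / ennreal pi"

definition tail_sup :: "(complex \<Rightarrow> complex) \<Rightarrow> real \<Rightarrow> ennreal" where
  "tail_sup \<psi> s = (SUP \<alpha>\<in>{\<alpha>\<in>unit_disk. norm \<alpha> > s}. disk_norm1 ((deriv ^^ 2) (phi \<alpha> \<circ> \<psi>)))"

definition limsup_second_deriv :: "(complex \<Rightarrow> complex) \<Rightarrow> ennreal" where
  "limsup_second_deriv \<psi> = Lim (at_left 1) (tail_sup \<psi>)"

lemma tail_sup_tendsto: "(tail_sup \<psi> \<longlongrightarrow> limsup_second_deriv \<psi>) (at_left 1)"
proof -
  let ?L = "INF s\<in>{..<1}. tail_sup \<psi> s"
  have anti: "tail_sup \<psi> t \<le> tail_sup \<psi> s" if "s \<le> t" for s t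
    unfolding tail_sup_def using that by (intro SUP_subset_mono) auto
  have "(tail_sup \<psi> \<longlongrightarrow> ?L) (at_left 1)"
  proof (rule order_tendstoI)
    fix x assume "x < ?L"
    then show "eventually (\<lambda>s. x < tail_sup \<psi> s) (at_left 1)"
      by (intro eventually_at_leftI[of 0]) (auto intro: less_le_trans INF_lower)
  next
    fix x assume "?L < x"
    then obtain s where s: "s < 1" "tail_sup \<psi> s < x" by (auto simp: INF_less_iff)
    then show "eventually (\<lambda>s. tail_sup \<psi> s < x) (at_left 1)"
      using le_less_trans[OF anti s(2)] by (intro eventually_at_leftI[of s]) auto
  qed
  then show ?thesis
    unfolding limsup_second_deriv_def by (simp add: tendsto_Lim)
qed

end

theory Submission
  imports Defs
begin

text \<open>
  The key fact is that the norm of \<open>f\<close> in the space is comparable to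
  \<open>|f(0)| + |f'(0)| + \<parallel>f''\<parallel>\<^sub>1\<close>. One direction is the uniform bound of
  \<open>\<parallel>\<phi>\<^sub>\<alpha>''\<parallel>\<^sub>1\<close>. For the other one, the reproducing formula of the weighted Bergman
  kernel \<open>(1 - |w|\<^sup>2) / (1 - cnj w z)^3\<close> writes a dilation of \<open>f''\<close> as an integral of the functions
  \<open>\<phi>\<^sub>\<alpha>''\<close> over a compact set of \<open>\<alpha>\<close>; a finite sum approximates this integral, and iterating
  on the error, which is at most half as large, sums up to \<open>f\<close>.

  Upper bound: \<open>C\<^sub>\<psi>\<close> is compared with the compact operator \<open>C\<^sub>\<psi> T\<^sub>r\<close>, where
  \<open>T\<^sub>r f(z) = f(r z)\<close>. Up to constants, \<open>T\<^sub>r \<phi>\<^sub>\<alpha>\<close> is a multiple of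
  \<open>\<phi>\<^sub>r\<^sub>\<alpha>\<close> with factor at most one, so that for \<open>|\<alpha>|\<close> close to one both terms are bounded by
  the tail supremum, whereas for the other \<open>\<alpha>\<close> the difference \<open>\<phi>\<^sub>\<alpha> - T\<^sub>r \<phi>\<^sub>\<alpha>\<close> is small in norm.

  Lower bound: the functions \<open>\<phi>\<^sub>\<alpha>\<close> with \<open>|\<alpha>| \<rightarrow> 1\<close> need not be weakly null, so a compact
  \<open>K\<close> is only known to map a subsequence to a Cauchy sequence. Differences \<open>\<phi>\<^sub>\<alpha> - \<phi>\<^sub>\<beta>\<close> with fixed
  \<open>\<beta>\<close> are used instead: \<open>(\<phi>\<^sub>\<alpha> \<circ> \<psi>)''\<close> tends to zero pointwise, and Fatou's lemma bounds
  \<open>\<parallel>(\<phi>\<^sub>\<beta> \<circ> \<psi>)''\<parallel>\<^sub>1\<close> by \<open>lim inf \<parallel>((\<phi>\<^sub>\<alpha> - \<phi>\<^sub>\<beta>) \<circ> \<psi>)''\<parallel>\<^sub>1\<close>.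
\<close>


section \<open>Area integrals over the disk\<close>

text \<open>The norm is an infimum over representations, so bounding it from above requires a
  representation; the kernel supplies one because its exponent 3 is that of
  \<open>phi2 \<alpha>\<close>, the second derivative of \<open>phi \<alpha>\<close>. The dilation
  is needed because \<open>phi2 \<alpha> z\<close> is uniformly continuous in both variables up to
  |z| = 1 only while \<alpha> stays away from the circle.

  The final constant must not depend on \<psi>, yet values and first derivatives at 0 depend on
  \<psi>(0) and \<psi>'(0), and the operator norm of the composition operator enters for \<alpha>
  away from the circle. With s fixed, all of these are multiplied by quantities that vanish as r
  tends to 1, so that only the second derivatives survive.

  Constants: 128 bounds the L1 norm of \<open>phi2 \<alpha>\<close>, and 1586 is the factor of the
  second derivative in the norm estimate. The upper bound has 3172 = 2 * 1586, one summand each for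
  \<alpha> and r \<alpha>; the lower bound has 256 = 2 * 128, since a difference of two atoms has
  norm at most 2.\<close>

lemma borel_measurable_Complex: "(\<lambda>(x, y). Complex x y) \<in> borel_measurable (lborel \<Otimes>\<^sub>M lborel)"
proof -
  have "(\<lambda>p. complex_of_real (fst p) + \<i> * complex_of_real (snd p)) \<in> borel_measurable (lborel \<Otimes>\<^sub>M lborel)"
    by measurable
  then show ?thesis by (simp add: complex_eq_iff case_prod_unfold Complex_eq)
qed

text \<open>Lebesgue measure is determined by its values on boxes, and the preimage of a box under
  \<open>Complex\<close> is a product of two intervals. This opens area integrals to Fubini.\<close>

lemma lborel_complex_eq_distr:
  "(lborel :: complex measure) = distr (lborel \<Otimes>\<^sub>M lborel) borel (\<lambda>(x, y). Complex x y)"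
proof (rule lborel_eqI)
  fix l u :: complex
  assume "\<And>b. b \<in> Basis \<Longrightarrow> l \<bullet> b \<le> u \<bullet> b"
  from this[of 1] this[of \<i>] have le: "Re l \<le> Re u" "Im l \<le> Im u" by (auto simp: Basis_complex_def)
  have "(\<lambda>(x, y). Complex x y) -` box l u \<inter> space (lborel \<Otimes>\<^sub>M lborel) = {Re l<..<Re u} \<times> {Im l<..<Im u}"
    by (auto simp: box_def Basis_complex_def space_pair_measure)
  then have "emeasure (distr (lborel \<Otimes>\<^sub>M lborel) borel (\<lambda>(x, y). Complex x y)) (box l u)
      = emeasure (lborel \<Otimes>\<^sub>M lborel) ({Re l<..<Re u} \<times> {Im l<..<Im u})"
    by (subst emeasure_distr[OF borel_measurable_Complex]) auto
  also have "\<dots> = ennreal (Re u - Re l) * ennreal (Im u - Im l)"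
    using le by (subst lborel.emeasure_pair_measure_Times) auto
  also have "\<dots> = ennreal (\<Prod>b\<in>Basis. (u - l) \<bullet> b)"
    using le by (simp add: Basis_complex_def ennreal_mult)
  finally show "emeasure (distr (lborel \<Otimes>\<^sub>M lborel) borel (\<lambda>(x, y). Complex x y)) (box l u) = (\<Prod>b\<in>Basis. (u - l) \<bullet> b)" .
qed auto

lemma nn_integral_complex_iterated:
  assumes [measurable]: "f \<in> borel_measurable borel"
  shows "(\<integral>\<^sup>+z. f z \<partial>lborel) = (\<integral>\<^sup>+x. \<integral>\<^sup>+y. f (Complex x y) \<partial>lborel \<partial>lborel)"
    and "(\<integral>\<^sup>+z. f z \<partial>lborel) = (\<integral>\<^sup>+y. \<integral>\<^sup>+x. f (Complex x y) \<partial>lborel \<partial>lborel)"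
proof -
  note m [measurable] = borel_measurable_Complex
  have mf: "(\<lambda>(x, y). f (Complex x y)) \<in> borel_measurable (lborel \<Otimes>\<^sub>M lborel)"
    using measurable_comp[OF m assms] by (simp add: o_def case_prod_unfold)
  have e: "(\<integral>\<^sup>+z. f z \<partial>lborel) = (\<integral>\<^sup>+p. f (Complex (fst p) (snd p)) \<partial>(lborel \<Otimes>\<^sub>M lborel))"
    by (subst lborel_complex_eq_distr, subst nn_integral_distr) (auto simp: case_prod_unfold)
  show "(\<integral>\<^sup>+z. f z \<partial>lborel) = (\<integral>\<^sup>+x. \<integral>\<^sup>+y. f (Complex x y) \<partial>lborel \<partial>lborel)"
    unfolding e by (subst lborel.nn_integral_fst[symmetric]) (use mf in \<open>auto simp: case_prod_unfold\<close>)
  show "(\<integral>\<^sup>+z. f z \<partial>lborel) = (\<integral>\<^sup>+y. \<integral>\<^sup>+x. f (Complex x y) \<partial>lborel \<partial>lborel)"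
    unfolding e by (subst lborel_pair.nn_integral_snd[symmetric]) (use mf in \<open>auto simp: case_prod_unfold\<close>)
qed

lemma nn_integral_lborel_shift:
  fixes f :: "real \<Rightarrow> ennreal"
  assumes [measurable]: "f \<in> borel_measurable borel"
  shows "(\<integral>\<^sup>+x. f (x + a) \<partial>lborel) = (\<integral>\<^sup>+x. f x \<partial>lborel)"
  using nn_integral_real_affine[OF assms, of 1 a] by (simp add: add.commute)

text \<open>After Fubini, with the sheared coordinate integrated first, a shear is a translation of
  the inner variable.\<close>

lemma nn_integral_shear:
  fixes t :: real
  assumes [measurable]: "f \<in> borel_measurable borel"
  shows nn_integral_shear_Re: "(\<integral>\<^sup>+z. f (z + of_real (t * Im z)) \<partial>lborel) = (\<integral>\<^sup>+z. f z \<partial>lborel)"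
    and nn_integral_shear_Im: "(\<integral>\<^sup>+z. f (z + \<i> * of_real (t * Re z)) \<partial>lborel) = (\<integral>\<^sup>+z. f z \<partial>lborel)"
proof -
  have mC: "(\<lambda>x. f (Complex x y)) \<in> borel_measurable borel" "(\<lambda>y. f (Complex x y)) \<in> borel_measurable borel" for x y
    by (simp_all add: Complex_eq)
  have "(\<integral>\<^sup>+z. f (z + of_real (t * Im z)) \<partial>lborel) = (\<integral>\<^sup>+y. \<integral>\<^sup>+x. f (Complex (x + t * y) y) \<partial>lborel \<partial>lborel)"
    by (subst nn_integral_complex_iterated(2))
       (auto simp: Complex_eq complex_eq_iff algebra_simps intro!: nn_integral_cong arg_cong[where f=f])
  also have "\<dots> = (\<integral>\<^sup>+z. f z \<partial>lborel)"
    by (subst nn_integral_lborel_shift[OF mC(1)]) (simp add: nn_integral_complex_iterated(2))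
  finally show "(\<integral>\<^sup>+z. f (z + of_real (t * Im z)) \<partial>lborel) = (\<integral>\<^sup>+z. f z \<partial>lborel)" .
  have "(\<integral>\<^sup>+z. f (z + \<i> * of_real (t * Re z)) \<partial>lborel) = (\<integral>\<^sup>+x. \<integral>\<^sup>+y. f (Complex x (y + t * x)) \<partial>lborel \<partial>lborel)"
    by (subst nn_integral_complex_iterated(1))
       (auto simp: Complex_eq complex_eq_iff algebra_simps intro!: nn_integral_cong arg_cong[where f=f])
  also have "\<dots> = (\<integral>\<^sup>+z. f z \<partial>lborel)"
    by (subst nn_integral_lborel_shift[OF mC(2)]) (simp add: nn_integral_complex_iterated(1))
  finally show "(\<integral>\<^sup>+z. f (z + \<i> * of_real (t * Re z)) \<partial>lborel) = (\<integral>\<^sup>+z. f z \<partial>lborel)" .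
qed

text \<open>A rotation is a product of three shears.\<close>

lemma nn_integral_rotate:
  fixes \<theta> :: real
  assumes [measurable]: "f \<in> borel_measurable borel" and c: "cos (\<theta> / 2) \<noteq> 0"
  shows "(\<integral>\<^sup>+z. f (cis \<theta> * z) \<partial>lborel) = (\<integral>\<^sup>+z. f z \<partial>lborel)"
proof -
  \<comment> \<open>The outer two shears have parameter \<open>t\<close>, the middle one
    \<open>sin \<theta>\<close>. Assumption \<open>c\<close> keeps the tangent finite and excludes
    exactly the half turns.\<close>
  define t where "t = - tan (\<theta> / 2)"
  define S where "S = (\<lambda>t z. z + complex_of_real (t * Im z))"
  define S' where "S' = (\<lambda>t z. z + \<i> * complex_of_real (t * Re z))"
  have [measurable]: "S a \<in> borel_measurable borel" "S' a \<in> borel_measurable borel" for a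
    by (simp_all add: S_def S'_def)
  have sn: "sin \<theta> = 2 * sin (\<theta>/2) * cos (\<theta>/2)" and cs: "cos \<theta> = 1 - 2 * (sin (\<theta>/2))\<^sup>2"
    using sin_double[of "\<theta>/2"] cos_double_sin[of "\<theta>/2"] by simp_all
  \<comment> \<open>These two identities are what equating the entries of the rotation matrix with
    those of the product of shears requires.\<close>
  have st: "sin \<theta> * t = cos \<theta> - 1" "t * (1 + cos \<theta>) = - sin \<theta>"
    using c cos_squared_eq[of "\<theta>/2"] unfolding sn cs t_def tan_def
    by (simp add: field_simps power2_eq_square, simp add: field_simps power2_eq_square, algebra)
  have "cis \<theta> * z = S t (S' (sin \<theta>) (S t z))" for z
  proof -
    have "Re z * cos \<theta> - Im z * sin \<theta> = Re z + t * Im z + t * (Im z + sin \<theta> * (Re z + t * Im z))"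
      using st by algebra
    moreover have "Re z * sin \<theta> + Im z * cos \<theta> = Im z + sin \<theta> * (Re z + t * Im z)"
      using st by algebra
    ultimately show ?thesis
      by (simp add: complex_eq_iff S_def S'_def mult.commute)
  qed
  then have "(\<integral>\<^sup>+z. f (cis \<theta> * z) \<partial>lborel) = (\<integral>\<^sup>+z. f (S t (S' (sin \<theta>) (S t z))) \<partial>lborel)"
    by simp
  also have "\<dots> = (\<integral>\<^sup>+z. f (S t (S' (sin \<theta>) z)) \<partial>lborel)"
    using nn_integral_shear_Re[of "\<lambda>z. f (S t (S' (sin \<theta>) z))" t] by (simp add: S_def)
  also have "\<dots> = (\<integral>\<^sup>+z. f (S t z) \<partial>lborel)"
    using nn_integral_shear_Im[of "\<lambda>z. f (S t z)" "sin \<theta>"] by (simp add: S'_def)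
  also have "\<dots> = (\<integral>\<^sup>+z. f z \<partial>lborel)"
    using nn_integral_shear_Re[of f t] by (simp add: S_def)
  finally show ?thesis .
qed

lemma nn_integral_complex_affine:
  fixes r :: real and c :: complex
  assumes [measurable]: "f \<in> borel_measurable borel" and r: "r > 0"
  shows "(\<integral>\<^sup>+z. f (c + r *\<^sub>R z) \<partial>lborel) = ennreal (1 / r\<^sup>2) * (\<integral>\<^sup>+z. f z \<partial>lborel)"
proof -
  have "(\<integral>\<^sup>+z. f z \<partial>lborel) = ennreal (r\<^sup>2) * (\<integral>\<^sup>+z. f (c + r *\<^sub>R z) \<partial>lborel)"
    by (subst lborel_affine[of r c])
       (use r in \<open>auto simp: nn_integral_density nn_integral_distr nn_integral_cmult\<close>)
  then show ?thesis using r by (simp add: ennreal_mult[symmetric] mult.assoc[symmetric])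
qed

section \<open>Area measure on the disk and integrals of monomials\<close>

abbreviation disk_measure :: "complex measure" where
  "disk_measure \<equiv> restrict_space lborel unit_disk"

lemma finite_measure_disk: "finite_measure disk_measure"
  by (rule finite_measureI) (simp add: emeasure_restrict_space space_restrict_space emeasure_ball)

lemma measure_disk: "measure disk_measure (ball 0 1) = pi"
  by (simp add: measure_restrict_space content_ball unit_ball_vol_2)

lemma emeasure_disk: "emeasure disk_measure (ball 0 1) = ennreal pi"
  by (simp add: emeasure_restrict_space emeasure_ball unit_ball_vol_2)

lemma space_disk [simp]: "space disk_measure = ball 0 1"
  by (simp add: space_restrict_space)

lemma disk_norm1_eq: "disk_norm1 g = (\<integral>\<^sup>+z. ennreal (norm (g z)) \<partial>disk_measure) / ennreal pi"
  by (simp add: disk_norm1_def nn_integral_restrict_space)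

lemma borel_measurable_disk:
  "continuous_on unit_disk f \<Longrightarrow> f \<in> borel_measurable disk_measure"
  by (metis borel_measurable_continuous_on_restrict measurable_cong_sets sets_lborel sets_restrict_space_cong)

lemma borel_measurable_disk_holomorphic:
  "f holomorphic_on unit_disk \<Longrightarrow> f \<in> borel_measurable disk_measure"
  by (intro borel_measurable_disk holomorphic_on_imp_continuous_on)

lemma integrable_disk_bounded:
  fixes f :: "complex \<Rightarrow> complex"
  assumes "continuous_on unit_disk f" "\<And>z. z \<in> unit_disk \<Longrightarrow> norm (f z) \<le> B"
  shows "integrable disk_measure f"
  using finite_measure_disk assms
  by (intro finite_measure.integrable_const_bound[where B=B] borel_measurable_disk)
     (auto intro!: AE_I2)

lemma distr_disk_rotate:
  assumes c: "cos (\<theta> / 2) \<noteq> 0"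
  shows "distr disk_measure disk_measure (\<lambda>z. cis \<theta> * z) = disk_measure"
proof (rule measure_eqI)
  have m: "(\<lambda>z. cis \<theta> * z) \<in> measurable disk_measure disk_measure"
    by (intro measurable_restrict_space3) (auto simp: norm_mult)
  fix A assume "A \<in> sets (distr disk_measure disk_measure (\<lambda>z. cis \<theta> * z))"
  then have A: "A \<in> sets borel" "A \<subseteq> ball 0 1"
    by (auto simp: sets_restrict_space)
  have [measurable]: "A \<in> sets borel" by fact
  have "emeasure (distr disk_measure disk_measure (\<lambda>z. cis \<theta> * z)) A
     = emeasure lborel ((\<lambda>z. cis \<theta> * z) -` A)"
  proof -
    have "(\<lambda>z. cis \<theta> * z) -` A \<inter> ball 0 1 = (\<lambda>z. cis \<theta> * z) -` A"
      using A(2) by (auto simp: norm_mult subset_iff)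
    then show ?thesis
      using A by (subst emeasure_distr[OF m], simp add: sets_restrict_space, blast)
        (subst emeasure_restrict_space; force)
  qed
  also have "\<dots> = (\<integral>\<^sup>+z. indicator A (cis \<theta> * z) \<partial>lborel)"
  proof -
    have "(\<lambda>z. cis \<theta> * z) -` A \<in> sets borel"
      using measurable_sets[of "\<lambda>z. cis \<theta> * z" borel borel A] A by simp
    then have "emeasure lborel ((\<lambda>z. cis \<theta> * z) -` A) = (\<integral>\<^sup>+z. indicator ((\<lambda>z. cis \<theta> * z) -` A) z \<partial>lborel)"
      by simp
    also have "\<dots> = (\<integral>\<^sup>+z. indicator A (cis \<theta> * z) \<partial>lborel)"
      by (rule nn_integral_cong) (simp add: indicator_def)
    finally show ?thesis .
  qed
  also have "\<dots> = emeasure disk_measure A"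
    using A by (subst nn_integral_rotate[OF _ c]) (auto simp: emeasure_restrict_space)
  finally show "emeasure (distr disk_measure disk_measure (\<lambda>z. cis \<theta> * z)) A = emeasure disk_measure A" .
qed simp

lemma integral_disk_rotate:
  fixes f :: "complex \<Rightarrow> complex"
  assumes "f \<in> borel_measurable disk_measure" and c: "cos (\<theta> / 2) \<noteq> 0"
  shows "(LINT z|disk_measure. f (cis \<theta> * z)) = (LINT z|disk_measure. f z)"
proof -
  have m: "(\<lambda>z. cis \<theta> * z) \<in> measurable disk_measure disk_measure"
    by (intro measurable_restrict_space3) (auto simp: norm_mult)
  show ?thesis
    using integral_distr[OF m assms(1)] distr_disk_rotate[OF c] by simp
qed

text \<open>A rotation multiplies the integrand by a constant of modulus one. For a suitable angle
  this constant is \<i>, so the integral equals \<i> times itself.\<close>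

lemma integral_disk_monomial_neq:
  assumes "n \<noteq> m"
  shows "(LINT w|disk_measure. w ^ n * cnj w ^ m * complex_of_real (1 - (norm w)\<^sup>2) ^ q) = 0"
proof -
  let ?f = "\<lambda>w. w ^ n * cnj w ^ m * complex_of_real (1 - (norm w)\<^sup>2) ^ q"
  define k where "k = real n - real m"
  have k: "\<bar>k\<bar> \<ge> 1" using assms by (auto simp: k_def)
  \<comment> \<open>The constant -1 would need a half turn when \<open>\<bar>k\<bar> = 1\<close>,
    which \<open>integral_disk_rotate\<close> does not cover; the constant \<i> never needs more
    than a quarter turn.\<close>
  define \<theta> where "\<theta> = pi / (2 * k)"
  have "\<bar>\<theta> / 2\<bar> \<le> pi / 4" using k by (simp add: \<theta>_def abs_mult field_simps)
  then have "\<bar>\<theta> / 2\<bar> < pi / 2" using pi_gt_zero by linarith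
  then have "cos (\<theta> / 2) > 0" by (intro cos_gt_zero_pi) (auto simp: abs_less_iff)
  then have c: "cos (\<theta> / 2) \<noteq> 0" by simp
  have e: "?f (cis \<theta> * w) = \<i> * ?f w" for w
  proof -
    have "cis \<theta> ^ n * cnj (cis \<theta>) ^ m = cis (real n * \<theta> + real m * (-\<theta>))"
      by (simp only: cis_cnj Complex.DeMoivre cis_mult)
    also have "real n * \<theta> + real m * (-\<theta>) = pi / 2"
    proof -
      have "real n * \<theta> + real m * (-\<theta>) = k * \<theta>" by (simp add: k_def algebra_simps)
      then show ?thesis using k by (simp add: \<theta>_def)
    qed
    finally have "cis \<theta> ^ n * cnj (cis \<theta>) ^ m = \<i>" by simp
    then show ?thesis
      by (simp add: power_mult_distrib norm_mult mult_ac)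
  qed
  have "continuous_on unit_disk ?f" by (intro continuous_intros)
  then have "(LINT w|disk_measure. ?f w) = (LINT w|disk_measure. ?f (cis \<theta> * w))"
    by (intro integral_disk_rotate[OF borel_measurable_disk c, symmetric])
  also have "\<dots> = \<i> * (LINT w|disk_measure. ?f w)"
    unfolding e by (rule integral_mult_right_zero)
  finally have "(1 - \<i>) * (LINT w|disk_measure. ?f w) = 0" by (simp only: left_diff_distrib mult_1_left diff_self)
  then show ?thesis by (simp add: complex_eq_iff)
qed

text \<open>Found by scaling. Over the disc of radius s the integral is s^(2n+2) times its value J
  on the unit disk, so the annulus between s and 1 carries J (1 - s^(2n+2)). There the integrand
  lies between s^(2n) and 1 and the area is pi (1 - s^2). Dividing by 1 - s^2 and letting s tend to
  1 gives J (n + 1) = pi.\<close>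

lemma nn_integral_disk_norm_power:
  "(\<integral>\<^sup>+w. ennreal (norm w ^ (2 * n)) \<partial>disk_measure) = ennreal (pi / (real n + 1))"
proof -
  have [measurable]: "ball (0::complex) s \<in> sets borel" for s by simp
  define A where "A = (\<lambda>s. \<integral>\<^sup>+w. ennreal (norm (w::complex) ^ (2 * n)) * indicator (ball 0 s) w \<partial>lborel)"
  define R where "R = (\<lambda>s. \<integral>\<^sup>+w. ennreal (norm (w::complex) ^ (2 * n)) * indicator (ball 0 1 - ball 0 s) w \<partial>lborel)"
  define J where "J = enn2real (A 1)"
  have em: "emeasure lborel (ball (0::complex) s) = ennreal (pi * s\<^sup>2)" if "s \<ge> 0" for s
    using that by (simp add: emeasure_ball unit_ball_vol_2)
  have "A 1 \<le> (\<integral>\<^sup>+w. indicator (ball (0::complex) 1) w \<partial>lborel)"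
    unfolding A_def by (intro nn_integral_mono) (auto simp: indicator_def power_le_one)
  then have A1: "A 1 \<le> ennreal pi" using em[of 1] by simp
  then have AJ: "A 1 = ennreal J" unfolding J_def
    by (metis ennreal_enn2real ennreal_less_top order_le_less_trans)
  have J0: "J \<ge> 0" by (simp add: J_def)
  have scale: "A s = ennreal (s ^ (2 * n + 2)) * A 1" if s: "s > 0" for s
  proof -
    have "ennreal (s ^ (2 * n)) * A 1 = (\<integral>\<^sup>+w. ennreal (norm (0 + s *\<^sub>R w :: complex) ^ (2 * n)) * indicator (ball 0 s) (0 + s *\<^sub>R w) \<partial>lborel)"
      unfolding A_def using s
      by (subst nn_integral_cmult[symmetric])
         (auto simp: indicator_def power_mult_distrib ennreal_mult intro!: nn_integral_cong)
    also have "\<dots> = ennreal (1 / s\<^sup>2) * A s"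
    proof -
      have [measurable]: "ball (0::complex) s \<in> sets borel" by simp
      have m: "(\<lambda>w::complex. ennreal (norm w ^ (2 * n)) * indicator (ball 0 s) w) \<in> borel_measurable borel"
        by measurable
      show ?thesis unfolding A_def by (rule nn_integral_complex_affine[OF m s])
    qed
    finally have eq: "ennreal (s ^ (2 * n)) * A 1 = ennreal (1 / s\<^sup>2) * A s" .
    have "A s = ennreal (s\<^sup>2 * (1 / s\<^sup>2)) * A s" using s by simp
    also have "\<dots> = ennreal (s\<^sup>2) * (ennreal (s ^ (2 * n)) * A 1)"
      unfolding eq using s by (subst ennreal_mult) (auto simp: mult.assoc)
    also have "\<dots> = ennreal (s\<^sup>2 * s ^ (2 * n)) * A 1"
      using s by (subst ennreal_mult) (auto simp: mult.assoc)
    also have "s\<^sup>2 * s ^ (2 * n) = s ^ (2 * n + 2)" by (simp add: power_add power2_eq_square)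
    finally show ?thesis .
  qed
  have split: "A 1 = A s + R s" if "s \<le> 1" for s
    unfolding A_def R_def using that
    by (subst nn_integral_add[symmetric]) (auto simp: indicator_def intro!: nn_integral_cong)
  have emR: "emeasure lborel (ball 0 1 - ball (0::complex) s) = ennreal (pi * (1 - s\<^sup>2))" if "0 \<le> s" "s \<le> 1" for s
    using that em[of 1] em[of s] by (subst emeasure_Diff) (auto simp: ennreal_minus algebra_simps)
  have R: "R s \<le> ennreal (pi * (1 - s\<^sup>2))" "ennreal (s ^ (2 * n)) * ennreal (pi * (1 - s\<^sup>2)) \<le> R s"
    if s: "0 \<le> s" "s \<le> 1" for s
  proof -
    have "R s \<le> (\<integral>\<^sup>+w. indicator (ball (0::complex) 1 - ball 0 s) w \<partial>lborel)"
      unfolding R_def by (intro nn_integral_mono) (auto simp: indicator_def power_le_one)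
    then show "R s \<le> ennreal (pi * (1 - s\<^sup>2))" using emR[OF s] by simp
    have "(\<integral>\<^sup>+w. ennreal (s ^ (2 * n)) * indicator (ball (0::complex) 1 - ball 0 s) w \<partial>lborel) \<le> R s"
      unfolding R_def using s by (intro nn_integral_mono) (auto simp: indicator_def intro!: ennreal_leI power_mono)
    then show "ennreal (s ^ (2 * n)) * ennreal (pi * (1 - s\<^sup>2)) \<le> R s"
      using emR[OF s] by (subst (asm) nn_integral_cmult) auto
  qed
  have key: "s ^ (2 * n) * pi \<le> J * (\<Sum>i\<le>n. (s\<^sup>2) ^ i)" "J * (\<Sum>i\<le>n. (s\<^sup>2) ^ i) \<le> pi"
    if s: "0 < s" "s < 1" for s
  proof -
    have s2: "s\<^sup>2 < 1" using s by (simp add: power_less_one_iff)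
    define r where "r = enn2real (R s)"
    have r: "R s = ennreal r" "r \<ge> 0"
      using R(1)[of s] s unfolding r_def
      by (auto intro!: ennreal_enn2real[symmetric] elim: le_less_trans)
    have "ennreal J = ennreal (s ^ (2 * n + 2)) * ennreal J + ennreal r"
      using split[of s] scale[of s] s r AJ by simp
    also have "\<dots> = ennreal (s ^ (2 * n + 2) * J + r)" using s J0 r by (simp add: ennreal_mult ennreal_plus)
    finally have "J = s ^ (2 * n + 2) * J + r" using s J0 r by (subst (asm) ennreal_inj) auto
    moreover have "s ^ (2 * n + 2) = (s\<^sup>2) ^ Suc n"
      using power_mult[of s 2 "Suc n"] by (simp only: mult_Suc_right add.commute)
    ultimately have "r = J * (1 - (s\<^sup>2) ^ Suc n)" by (simp only: right_diff_distrib) (simp add: mult.commute)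
    then have re: "r = J * (\<Sum>i\<le>n. (s\<^sup>2) ^ i) * (1 - s\<^sup>2)"
      by (simp add: one_diff_power_eq[of _ "Suc n"] lessThan_Suc_atMost mult_ac del: power_Suc)
    have "ennreal r \<le> ennreal (pi * (1 - s\<^sup>2))" "ennreal (s ^ (2 * n) * (pi * (1 - s\<^sup>2))) \<le> ennreal r"
      using R[of s] s s2 r by (simp_all add: ennreal_mult)
    then have "r \<le> pi * (1 - s\<^sup>2)" "s ^ (2 * n) * (pi * (1 - s\<^sup>2)) \<le> r"
      using s2 r by (simp_all add: ennreal_le_iff)
    then show "s ^ (2 * n) * pi \<le> J * (\<Sum>i\<le>n. (s\<^sup>2) ^ i)" "J * (\<Sum>i\<le>n. (s\<^sup>2) ^ i) \<le> pi"
      using s2 unfolding re by (simp_all add: mult.assoc[symmetric])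
  qed
  have lim: "((\<lambda>s. J * (\<Sum>i\<le>n. (s\<^sup>2) ^ i)) \<longlongrightarrow> J * (\<Sum>i\<le>n. (1\<^sup>2) ^ i)) (at_left (1::real))"
    "((\<lambda>s. s ^ (2 * n) * pi) \<longlongrightarrow> 1 ^ (2 * n) * pi) (at_left (1::real))"
    by (intro tendsto_intros)+
  have ev: "\<forall>\<^sub>F s in at_left (1::real). 0 < s \<and> s < 1"
    by (intro eventually_at_leftI[of 0]) auto
  have "J * (\<Sum>i\<le>n. (1\<^sup>2) ^ i) \<le> pi"
    by (rule tendsto_upperbound[OF lim(1)]) (use ev key in \<open>auto elim!: eventually_mono\<close>)
  moreover have "1 ^ (2 * n) * pi \<le> J * (\<Sum>i\<le>n. (1\<^sup>2) ^ i)"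
    by (rule tendsto_le[OF _ lim]) (use ev key in \<open>auto elim!: eventually_mono\<close>)
  ultimately have "J = pi / (real n + 1)" by (simp add: field_simps)
  then have "A 1 = ennreal (pi / (real n + 1))" using AJ by simp
  then show ?thesis by (simp add: A_def nn_integral_restrict_space)
qed

lemma integral_disk_norm_power:
  "(LINT w|disk_measure. norm w ^ (2 * n)) = pi / (real n + 1)"
  by (subst integral_eq_nn_integral)
     (auto simp: nn_integral_disk_norm_power intro!: borel_measurable_disk continuous_intros)

lemma integrable_disk_real_bounded:
  fixes f :: "complex \<Rightarrow> real"
  assumes "continuous_on unit_disk f" "\<And>z. z \<in> unit_disk \<Longrightarrow> norm (f z) \<le> B"
  shows "integrable disk_measure f"
  using finite_measure_disk assms
  by (intro finite_measure.integrable_const_bound[where B=B])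
     (auto intro!: AE_I2 borel_measurable_disk)

lemma integral_disk_monomial_eq:
  "(LINT w|disk_measure. w ^ n * cnj w ^ n * complex_of_real (1 - (norm w)\<^sup>2))
     = complex_of_real (pi / ((real n + 1) * (real n + 2)))"
proof -
  have i: "integrable disk_measure (\<lambda>w. norm w ^ (2 * k))" for k
    by (rule integrable_disk_real_bounded[where B=1]) (auto intro!: continuous_intros power_le_one)
  have "w ^ n * cnj w ^ n * complex_of_real (1 - (norm w)\<^sup>2)
      = complex_of_real (norm w ^ (2 * n) - norm w ^ (2 * Suc n))" for w
  proof -
    have "w ^ n * cnj w ^ n = complex_of_real (norm w ^ (2 * n))"
      by (simp add: power_mult_distrib[symmetric] complex_norm_square[symmetric] power_mult)
    moreover have "norm w ^ (2 * Suc n) = norm w ^ (2 * n) * (norm w)\<^sup>2"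
      by (simp add: power_add power2_eq_square)
    ultimately show ?thesis by (simp only: of_real_diff of_real_mult of_real_1 right_diff_distrib mult_1_right)
  qed
  then have "(LINT w|disk_measure. w ^ n * cnj w ^ n * complex_of_real (1 - (norm w)\<^sup>2))
     = complex_of_real (LINT w|disk_measure. norm w ^ (2 * n) - norm w ^ (2 * Suc n))"
    by (simp only: integral_complex_of_real)
  also have "(LINT w|disk_measure. norm w ^ (2 * n) - norm w ^ (2 * Suc n)) = pi / (real n + 1) - pi / (real n + 2)"
    by (subst Bochner_Integration.integral_diff[OF i i], subst (1 2) integral_disk_norm_power) simp
  also have "\<dots> = pi / ((real n + 1) * (real n + 2))"
    by (simp add: field_simps)
  finally show ?thesis .
qed

lemma sums_integral_disk:
  fixes f :: "nat \<Rightarrow> complex \<Rightarrow> complex"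
  assumes c: "\<And>n. continuous_on unit_disk (f n)"
    and b: "\<And>n w. w \<in> unit_disk \<Longrightarrow> norm (f n w) \<le> M n" and M: "summable M"
  shows "(\<lambda>n. LINT w|disk_measure. f n w) sums (LINT w|disk_measure. (\<Sum>n. f n w))"
proof (intro sums_integral AE_I2)
  show fi: "integrable disk_measure (f n)" for n
    using b c by (intro integrable_disk_bounded[where B="M n"])
  have fin: "norm (LINT w|disk_measure. norm (f n w)) \<le> M n * pi" for n
  proof -
    have "(LINT w|disk_measure. norm (f n w)) \<le> (LINT w|disk_measure. M n)"
      using b finite_measure_disk by (intro integral_mono integrable_norm fi finite_measure.integrable_const) auto
    then show ?thesis by (simp add: measure_disk mult.commute)
  qed
  show "summable (\<lambda>n. LINT w|disk_measure. norm (f n w))"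
    by (rule summable_comparison_test'[OF summable_mult2[OF M, of pi], of 0]) (use fin in auto)
  fix w assume "w \<in> space disk_measure"
  then show "summable (\<lambda>n. norm (f n w))"
    using b by (intro summable_comparison_test'[OF M, of 0]) auto
qed

text \<open>Integrating termwise, rotation invariance removes every degree but \<open>m\<close>. The
  exponent \<open>q\<close> is 0 for the area mean value property and 1 for the reproducing
  formula.\<close>

lemma integral_disk_power_series:
  fixes a :: "nat \<Rightarrow> complex"
  assumes a: "summable (\<lambda>n. norm (a n))" and g: "\<And>w. w \<in> unit_disk \<Longrightarrow> (\<lambda>n. a n * w ^ n) sums g w"
  shows "(LINT w|disk_measure. g w * (cnj w ^ m * complex_of_real (1 - (norm w)\<^sup>2) ^ q))
    = a m * (LINT w|disk_measure. w ^ m * cnj w ^ m * complex_of_real (1 - (norm w)\<^sup>2) ^ q)"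
proof -
  define h where "h = (\<lambda>w. cnj w ^ m * complex_of_real (1 - (norm w)\<^sup>2) ^ q)"
  have hc: "continuous_on S h" for S unfolding h_def by (intro continuous_intros)
  have hb: "norm (h w) \<le> 1" if "w \<in> unit_disk" for w
    using that unfolding h_def norm_mult norm_power complex_mod_cnj norm_of_real
    by (intro mult_le_one power_le_one) (auto simp: power_le_one abs_le_iff)
  let ?f = "\<lambda>n w. a n * w ^ n * h w"
  have fb: "norm (?f n w) \<le> norm (a n)" if "w \<in> unit_disk" for n w
  proof -
    have "norm (w ^ n) * norm (h w) \<le> 1 * 1"
      using that hb[OF that] by (intro mult_mono) (auto simp: norm_power power_le_one)
    then show ?thesis by (simp add: norm_mult mult.assoc mult_left_le)
  qed
  have s: "(\<lambda>n. LINT w|disk_measure. ?f n w) sums (LINT w|disk_measure. (\<Sum>n. ?f n w))"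
    using fb a by (intro sums_integral_disk[where M="\<lambda>n. norm (a n)"] continuous_intros hc)
  have "(LINT w|disk_measure. (\<Sum>n. ?f n w)) = (LINT w|disk_measure. g w * h w)"
    using g by (intro Bochner_Integration.integral_cong) (auto intro!: sums_unique[symmetric] sums_mult2)
  moreover have "(LINT w|disk_measure. ?f n w) = (if n = m then a m * (LINT w|disk_measure. w ^ m * h w) else 0)" for n
    using integral_disk_monomial_neq[of n m q] by (auto simp: h_def mult.assoc)
  then have "(\<lambda>n. LINT w|disk_measure. ?f n w) sums (a m * (LINT w|disk_measure. w ^ m * h w))"
    using sums_single[of m "\<lambda>_. a m * (LINT w|disk_measure. w ^ m * h w)"] by simp
  ultimately show ?thesis using s sums_unique2 by (fastforce simp: h_def mult.assoc)
qed

text \<open>The series converges at a point of modulus strictly between 1 and \<open>R\<close>,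
  hence absolutely at 1. The summable coefficients then dominate every termwise integration over the
  disk.\<close>

lemma holomorphic_power_series_summable:
  assumes g: "g holomorphic_on ball 0 R" and R: "R > 1"
  obtains a where "summable (\<lambda>n. norm (a n))" "\<And>w. w \<in> unit_disk \<Longrightarrow> (\<lambda>n. a n * w ^ n) sums g w" "a 0 = g 0"
proof
  define a where "a = (\<lambda>n. (deriv ^^ n) g 0 / fact n)"
  have s: "(\<lambda>n. a n * w ^ n) sums g w" if "w \<in> ball 0 R" for w
    using holomorphic_power_series[OF g that] by (simp add: a_def)
  show "(\<lambda>n. a n * w ^ n) sums g w" if "w \<in> unit_disk" for w
    using s that R by auto
  have "summable (\<lambda>n. norm (a n * 1 ^ n))"
  proof (rule powser_insidea)
    show "summable (\<lambda>n. a n * complex_of_real ((1 + R) / 2) ^ n)"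
    proof (intro sums_summable[OF s])
      have "norm (complex_of_real ((1 + R) / 2)) < R" unfolding norm_of_real using R by simp
      then show "complex_of_real ((1 + R) / 2) \<in> ball 0 R" by simp
    qed
    show "norm (1::complex) < norm (complex_of_real ((1 + R) / 2))" unfolding norm_of_real using R by simp
  qed
  then show "summable (\<lambda>n. norm (a n))" by simp
  show "a 0 = g 0" by (simp add: a_def)
qed

section \<open>Area means, singular kernels and the reproducing formula\<close>

lemma borel_measurable_norm_indicator_disk:
  fixes g :: "complex \<Rightarrow> complex"
  assumes "g holomorphic_on unit_disk"
  shows "(\<lambda>z. ennreal (norm (g z)) * indicator unit_disk z) \<in> borel_measurable borel"
proof -
  have "(\<lambda>z. ennreal (norm (g z))) \<in> borel_measurable (restrict_space lborel unit_disk)"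
    using borel_measurable_disk_holomorphic[OF assms] by measurable
  then show ?thesis by (subst (asm) borel_measurable_restrict_space_iff_ennreal) auto
qed

lemma nn_integral_disk_affine_le:
  fixes g :: "complex \<Rightarrow> complex"
  assumes g: "g holomorphic_on unit_disk" and r: "0 < r" "norm c + r \<le> 1"
  shows "(\<integral>\<^sup>+w. ennreal (norm (g (c + r *\<^sub>R w))) \<partial>disk_measure)
     \<le> ennreal (1 / r\<^sup>2) * (\<integral>\<^sup>+w. ennreal (norm (g w)) \<partial>disk_measure)"
proof -
  have "c + r *\<^sub>R w \<in> unit_disk" if "w \<in> unit_disk" for w
  proof -
    have "norm (c + r *\<^sub>R w) \<le> norm c + r * norm w"
      using norm_triangle_ineq[of c "r *\<^sub>R w"] r by simp
    also have "\<dots> < norm c + r * 1" using that r by (intro add_strict_left_mono mult_strict_left_mono) auto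
    finally show ?thesis using r by simp
  qed
  then have "(\<integral>\<^sup>+w. ennreal (norm (g (c + r *\<^sub>R w))) \<partial>disk_measure)
    \<le> (\<integral>\<^sup>+w. ennreal (norm (g (c + r *\<^sub>R w))) * indicator unit_disk (c + r *\<^sub>R w) \<partial>lborel)"
    by (subst nn_integral_restrict_space) (auto intro!: nn_integral_mono simp: indicator_def)
  also have "\<dots> = ennreal (1 / r\<^sup>2) * (\<integral>\<^sup>+w. ennreal (norm (g w)) * indicator unit_disk w \<partial>lborel)"
    by (rule nn_integral_complex_affine[OF borel_measurable_norm_indicator_disk[OF g] r(1)])
  finally show ?thesis by (simp add: nn_integral_restrict_space)
qed

text \<open>The value at \<open>z\<close> is the mean over a disc about \<open>z\<close>. Taking
  half the distance to the circle as radius makes the rescaled function holomorphic on a disc of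
  radius 2, as \<open>holomorphic_power_series_summable\<close> demands; the half is also the origin
  of the 4.\<close>

lemma area_mean_value_bound:
  assumes g: "g holomorphic_on unit_disk" and z: "z \<in> unit_disk"
  shows "ennreal (norm (g z) * (1 - norm z)\<^sup>2 / 4) \<le> disk_norm1 g"
proof -
  define r where "r = (1 - norm z) / 2"
  have r: "r > 0" "norm z + r \<le> 1" using z by (auto simp: r_def field_simps)
  define G where "G = (\<lambda>w. g (z + r *\<^sub>R w))"
  have in_disk: "z + r *\<^sub>R w \<in> unit_disk" if "w \<in> ball 0 2" for w
  proof -
    have "norm (z + r *\<^sub>R w) \<le> norm z + r * norm w"
      using norm_triangle_ineq[of z "r *\<^sub>R w"] r by simp
    also have "\<dots> < norm z + r * 2" using that r by (intro add_strict_left_mono mult_strict_left_mono) auto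
    finally show ?thesis unfolding r_def by (simp add: field_simps)
  qed
  have G: "G holomorphic_on ball 0 2"
    unfolding G_def scaleR_conv_of_real using in_disk
    by (intro holomorphic_on_compose_gen[OF _ g, unfolded o_def] holomorphic_intros)
       (auto simp: scaleR_conv_of_real)
  from holomorphic_power_series_summable[OF G]
  obtain a where a: "summable (\<lambda>n. norm (a n))" "\<And>w. w \<in> unit_disk \<Longrightarrow> (\<lambda>n. a n * w ^ n) sums G w" "a 0 = G 0"
    by auto
  have "(LINT w|disk_measure. G w) = G 0 * pi"
    using integral_disk_power_series[OF a(1,2), of 0 0] a(3) by (simp add: measure_disk scaleR_conv_of_real)
  then have eq: "norm (g z) * pi = norm (LINT w|disk_measure. G w)"
    by (simp add: G_def norm_mult)
  have "integrable disk_measure G"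
  proof (rule integrable_disk_bounded)
    show "continuous_on unit_disk G"
      using holomorphic_on_imp_continuous_on[OF G] by (rule continuous_on_subset) auto
    show "norm (G w) \<le> (\<Sum>n. norm (a n))" if "w \<in> unit_disk" for w
    proof -
      have "norm (a n * w ^ n) \<le> norm (a n)" for n
        using that by (simp add: norm_mult norm_power power_le_one mult_left_le)
      then have "norm (\<Sum>n. a n * w ^ n) \<le> (\<Sum>n. norm (a n))" by (intro norm_suminf_le a)
      then show ?thesis using a(2)[OF that] by (simp add: sums_iff)
    qed
  qed
  then have "ennreal (norm (LINT w|disk_measure. G w)) \<le> (\<integral>\<^sup>+w. ennreal (norm (G w)) \<partial>disk_measure)"
    by (rule integral_norm_bound_ennreal)
  then have "ennreal (norm (g z) * pi) \<le> (\<integral>\<^sup>+w. ennreal (norm (G w)) \<partial>disk_measure)"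
    unfolding eq .
  also have "\<dots> \<le> ennreal (1 / r\<^sup>2) * (\<integral>\<^sup>+w. ennreal (norm (g w)) \<partial>disk_measure)"
    unfolding G_def by (rule nn_integral_disk_affine_le[OF g r])
  finally have "ennreal (r\<^sup>2 / pi) * ennreal (norm (g z) * pi)
     \<le> ennreal (r\<^sup>2 / pi) * (ennreal (1 / r\<^sup>2) * (\<integral>\<^sup>+w. ennreal (norm (g w)) \<partial>disk_measure))"
    by (rule mult_left_mono) simp
  also have "\<dots> = ennreal (r\<^sup>2 / pi * (1 / r\<^sup>2)) * (\<integral>\<^sup>+w. ennreal (norm (g w)) \<partial>disk_measure)"
    by (subst ennreal_mult) (auto simp: mult.assoc)
  also have "r\<^sup>2 / pi * (1 / r\<^sup>2) = inverse pi" using r by (simp add: field_simps)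
  also have "ennreal (inverse pi) * (\<integral>\<^sup>+w. ennreal (norm (g w)) \<partial>disk_measure) = disk_norm1 g"
    by (simp add: disk_norm1_eq divide_ennreal_def inverse_ennreal mult.commute)
  also have "ennreal (r\<^sup>2 / pi) * ennreal (norm (g z) * pi) = ennreal (r\<^sup>2 / pi * (norm (g z) * pi))"
    by (subst ennreal_mult) auto
  also have "r\<^sup>2 / pi * (norm (g z) * pi) = norm (g z) * (1 - norm z)\<^sup>2 / 4"
    by (simp add: r_def power_divide)
  finally show ?thesis .
qed

lemma dyadic_shell:
  fixes u \<delta> :: real
  assumes "0 < \<delta>" "\<delta> \<le> u"
  obtains k :: nat where "2 ^ k * \<delta> \<le> u" "u < 2 ^ (k + 1) * \<delta>"
proof -
  obtain N :: nat where "u / \<delta> < 2 ^ N" using real_arch_pow[of 2] by auto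
  then have "u < 2 ^ N * \<delta>" using assms by (simp add: field_simps)
  also have "\<dots> \<le> 2 ^ (N + 1) * \<delta>" using assms by simp
  finally have ex: "u < 2 ^ (N + 1) * \<delta>" .
  define k where "k = (LEAST n. u < 2 ^ (n + 1) * \<delta>)"
  have "u < 2 ^ (k + 1) * \<delta>" unfolding k_def by (rule LeastI[of "\<lambda>n. u < 2 ^ (n + 1) * \<delta>", OF ex])
  moreover have "2 ^ k * \<delta> \<le> u"
  proof (cases k)
    case (Suc j)
    then have "\<not> u < 2 ^ (j + 1) * \<delta>" unfolding k_def by (intro not_less_Least) simp
    then show ?thesis using Suc by simp
  qed (use assms in simp)
  ultimately show thesis using that by blast
qed

text \<open>The integrand is dominated by the sum of the heights \<open>c k\<close> on the discs of
  radius \<open>\<rho> k\<close>. Full discs in place of annuli cost only a constant when the sums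
  are geometric. The alternative \<open>f z = 0\<close> admits the value \<open>1 / 0 = 0\<close> at
  a singularity.\<close>

lemma nn_integral_shells:
  fixes e :: complex
  assumes "\<And>k. c k \<ge> 0" "\<And>k. \<rho> k \<ge> 0" and S: "(\<lambda>k. c k * (pi * (\<rho> k)\<^sup>2)) sums s"
  and f: "\<And>z. z \<in> unit_disk \<Longrightarrow> f z = 0 \<or> (\<exists>k. f z \<le> c k \<and> dist e z < \<rho> k)"
  shows "(\<integral>\<^sup>+z. ennreal (f z) \<partial>disk_measure) \<le> ennreal s"
proof -
  let ?h = "\<lambda>k z. ennreal (c k) * indicator (ball e (\<rho> k)) z"
  have [measurable]: "ball e (\<rho> k) \<in> sets borel" for k by simp
  have "(\<integral>\<^sup>+z. ennreal (f z) \<partial>disk_measure) \<le> (\<integral>\<^sup>+z. (\<Sum>k. ?h k z) \<partial>lborel)"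
  proof (subst nn_integral_restrict_space, simp, rule nn_integral_mono)
    fix z
    show "ennreal (f z) * indicator unit_disk z \<le> (\<Sum>k. ?h k z)"
    proof (cases "z \<in> unit_disk \<and> f z \<noteq> 0")
      case True
      then obtain k where k: "f z \<le> c k" "dist e z < \<rho> k" using f by blast
      have "ennreal (f z) * indicator unit_disk z \<le> ?h k z" using k True by (auto simp: indicator_def intro: ennreal_leI)
      also have "\<dots> \<le> (\<Sum>k. ?h k z)"
      proof -
        define F where "F = (\<lambda>k. ?h k z)"
        have "F k \<le> suminf F" using sum_le_suminf[of F "{k}"] by simp
        then show ?thesis unfolding F_def .
      qed
      finally show ?thesis .
    qed (auto simp: indicator_def)
  qed
  also have "\<dots> = (\<Sum>k. \<integral>\<^sup>+z. ?h k z \<partial>lborel)" by (rule nn_integral_suminf) measurable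
  also have "\<dots> = (\<Sum>k. ennreal (c k * (pi * (\<rho> k)\<^sup>2)))"
    using assms(1,2) by (simp add: nn_integral_cmult emeasure_ball unit_ball_vol_2 ennreal_mult)
  also have "\<dots> = ennreal s"
    using assms by (subst suminf_ennreal2) (auto simp: sums_iff)
  finally show ?thesis .
qed

lemma norm_denom_ge:
  assumes "norm \<alpha> < 1" "norm z < 1"
  shows "1 - norm \<alpha> \<le> norm (1 - cnj \<alpha> * z)"
proof -
  have "norm (cnj \<alpha> * z) \<le> norm \<alpha>" using assms by (simp add: norm_mult mult_left_le)
  then show ?thesis using norm_triangle_ineq2[of 1 "cnj \<alpha> * z"] by simp
qed

text \<open>Let u = |1 - cnj \<alpha> z| and let \<open>e\<close> be the boundary point in the
  direction of \<alpha>. Then u is at least \<open>\<delta>\<close> and at least |e - z| / 2. Where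
  u is between 2^k \<delta> and twice that, the kernel is at most (2^k \<delta>)^(-3) and z lies
  within 4 * 2^k \<delta> of \<open>e\<close>. The k-th disc therefore contributes 16 pi / (2^k
  \<delta>), and the sum is 32 pi / \<delta>.\<close>

lemma nn_integral_kernel_le:
  assumes \<alpha>: "norm \<alpha> < 1"
  shows "(\<integral>\<^sup>+z. ennreal (1 / norm (1 - cnj \<alpha> * z) ^ 3) \<partial>disk_measure) \<le> ennreal (32 * pi / (1 - norm \<alpha>))"
proof -
  define \<delta> where "\<delta> = 1 - norm \<alpha>"
  have \<delta>: "\<delta> > 0" using \<alpha> by (simp add: \<delta>_def)
  define e where "e = (if \<alpha> = 0 then 1 else sgn \<alpha>)"
  have e: "norm e = 1" "\<alpha> = norm \<alpha> * e" by (auto simp: e_def norm_sgn) (simp add: sgn_div_norm scaleR_conv_of_real)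
  show ?thesis
  proof (rule nn_integral_shells[where e = e and c="\<lambda>k. 1 / (2 ^ k * \<delta>) ^ 3" and \<rho>="\<lambda>k. 2 ^ k * (4 * \<delta>)"])
    have "(\<lambda>k. 16 * pi / \<delta> * (1 / 2) ^ k) sums (16 * pi / \<delta> * (1 / (1 - 1 / 2)))"
      by (intro sums_mult geometric_sums) simp
    moreover have "1 / (2 ^ k * \<delta>) ^ 3 * (pi * (2 ^ k * (4 * \<delta>))\<^sup>2) = 16 * pi / \<delta> * (1 / 2) ^ k" for k
      using \<delta> by (simp add: field_simps power2_eq_square power3_eq_cube)
    ultimately show "(\<lambda>k. 1 / (2 ^ k * \<delta>) ^ 3 * (pi * (2 ^ k * (4 * \<delta>))\<^sup>2)) sums (32 * pi / (1 - norm \<alpha>))"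
      by (simp add: \<delta>_def)
    fix z assume z: "z \<in> unit_disk"
    let ?u = "norm (1 - cnj \<alpha> * z)"
    have u: "\<delta> \<le> ?u" using norm_denom_ge[of \<alpha> z] \<alpha> z by (simp add: \<delta>_def)
    have "norm (e - z) = norm (cnj e) * norm (e - z)" using e by simp
    also have "\<dots> = norm (1 - cnj e * z)"
      unfolding norm_mult[symmetric] using e(1) by (simp add: algebra_simps complex_norm_square[symmetric] mult.commute)
    also have "1 - cnj e * z = (1 - cnj \<alpha> * z) - of_real \<delta> * (cnj e * z)"
      by (subst e(2)) (simp add: \<delta>_def algebra_simps)
    also have "norm \<dots> \<le> ?u + \<delta> * norm z"
      using norm_triangle_ineq4[of "1 - cnj \<alpha> * z" "of_real \<delta> * (cnj e * z)"] e \<delta> by (simp add: norm_mult)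
    also have "\<delta> * norm z \<le> \<delta>" using z \<delta> by (simp add: mult_left_le)
    finally have "norm (e - z) \<le> ?u + \<delta>" by simp
    then have ez: "dist e z \<le> 2 * ?u" using u by (simp add: dist_norm)
    obtain k where k: "2 ^ k * \<delta> \<le> ?u" "?u < 2 ^ (k + 1) * \<delta>" using dyadic_shell[OF \<delta> u] by blast
    have "1 / ?u ^ 3 \<le> 1 / (2 ^ k * \<delta>) ^ 3" using k \<delta> u by (intro divide_left_mono power_mono mult_pos_pos) auto
    then show "1 / ?u ^ 3 = 0 \<or> (\<exists>k. 1 / ?u ^ 3 \<le> 1 / (2 ^ k * \<delta>) ^ 3 \<and> dist e z < 2 ^ k * (4 * \<delta>))"
      using ez k by (intro disjI2 exI[of _ k]) auto
  qed (use \<delta> in auto)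
qed

text \<open>The singularity is integrable in the plane: at distance about 2^(-k) the height doubles
  with k while the area is divided by four.\<close>

lemma nn_integral_inverse_norm_le:
  "(\<integral>\<^sup>+z. ennreal (1 / norm z) \<partial>disk_measure) \<le> ennreal (4 * pi)"
proof (rule nn_integral_shells[where e = 0 and c="\<lambda>k. 2 * 2 ^ k" and \<rho>="\<lambda>k. 1 / 2 ^ k"])
  have "(\<lambda>k. 2 * pi * (1 / 2) ^ k) sums (2 * pi * (1 / (1 - 1 / 2)))"
    by (intro sums_mult geometric_sums) simp
  moreover have "(\<lambda>k. 2 * 2 ^ k * (pi * (1 / 2 ^ k)\<^sup>2)) = (\<lambda>k::nat. 2 * pi * (1 / 2) ^ k)"
    by (simp add: field_simps power2_eq_square)
  ultimately show "(\<lambda>k. 2 * 2 ^ k * (pi * (1 / 2 ^ k)\<^sup>2)) sums (4 * pi)" by (simp only:) simp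
  fix z assume z: "z \<in> unit_disk"
  show "1 / norm z = 0 \<or> (\<exists>k. 1 / norm z \<le> 2 * 2 ^ k \<and> dist 0 z < 1 / 2 ^ k)"
  proof (cases "z = 0")
    case False
    \<comment> \<open>The strict inequality must be the one on the power 2^k, because it says that
      \<open>z\<close> is in the open ball; \<open>dyadic_shell\<close> is strict at the other
      end.\<close>
    obtain k where k: "1 / norm z \<le> 2 * 2 ^ k" "2 ^ k < 1 / norm z"
    proof -
      define P where "P = (\<lambda>n::nat. 1 / norm z \<le> 2 ^ (n + 1))"
      obtain N :: nat where "1 / norm z < 2 ^ N" using real_arch_pow[of 2 "1 / norm z"] by auto
      then have ex: "P N" unfolding P_def by (simp add: less_imp_le order_trans[of _ "2 ^ N"])
      define k where "k = (LEAST n. P n)"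
      have "P k" unfolding k_def by (rule LeastI[of P, OF ex])
      moreover have "2 ^ k < 1 / norm z"
      proof (cases k)
        case 0 then show ?thesis using z False by (simp add: field_simps)
      next
        case (Suc j)
        then have "\<not> P j" unfolding k_def by (intro not_less_Least) simp
        then show ?thesis using Suc by (simp add: P_def)
      qed
      ultimately show thesis using that by (simp add: P_def)
    qed
    then show ?thesis using False by (intro disjI2 exI[of _ k]) (auto simp: field_simps)
  qed simp
qed auto

text \<open>The Cauchy product of the series of 1 / (1 - x)^2 and 1 / (1 - x); the coefficients are
  the triangular numbers (n + 1) (n + 2) / 2.\<close>

lemma inverse_cube_sums:
  fixes x :: "'a :: {real_normed_field, banach}"
  assumes x: "norm x < 1"
  shows "(\<lambda>n. of_nat (\<Sum>i\<le>n. Suc i) * x ^ n) sums (1 / (1 - x) ^ 3)"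
proof -
  have "(\<lambda>n. \<Sum>i\<le>n. (of_nat (Suc i) * x ^ i) * x ^ (n - i)) sums ((\<Sum>n. of_nat (Suc n) * x ^ n) * (\<Sum>n. x ^ n))"
  proof (rule Cauchy_product_sums)
    have "summable (\<lambda>n. of_nat (Suc n) * norm x ^ n)"
      using geometric_deriv_sums[of "norm x"] x by (auto simp: sums_iff)
    then show "summable (\<lambda>n. norm (of_nat (Suc n) * x ^ n))" by (simp only: norm_mult norm_power norm_of_nat)
    show "summable (\<lambda>n. norm (x ^ n))" using x by (simp add: norm_power summable_geometric)
  qed
  moreover have "(\<Sum>i\<le>n. (of_nat (Suc i) * x ^ i) * x ^ (n - i)) = of_nat (\<Sum>i\<le>n. Suc i) * x ^ n" for n
    unfolding of_nat_sum sum_distrib_right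
    by (intro sum.cong refl) (simp add: mult.assoc flip: power_add)
  ultimately show ?thesis
    using geometric_deriv_sums[OF x] geometric_sums[OF x]
    by (simp add: sums_iff power3_eq_cube power2_eq_square)
qed

text \<open>Expanding the kernel in powers of cnj w \<zeta>, the n-th triangular coefficient cancels
  the weighted moment pi / ((n + 1) (n + 2)) up to the factor pi / 2, which is the same for all n.
  What remains is the Taylor series of \<open>g\<close> at \<zeta>.\<close>

lemma reproducing_formula:
  fixes g :: "complex \<Rightarrow> complex"
  assumes g: "g holomorphic_on ball 0 R" "R > 1" and \<zeta>: "norm \<zeta> < 1"
  shows "(LINT w|disk_measure. g w * complex_of_real (1 - (norm w)\<^sup>2) / (1 - cnj w * \<zeta>) ^ 3) = pi / 2 * g \<zeta>"
proof -
  from holomorphic_power_series_summable[OF g]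
  obtain a where a: "summable (\<lambda>n. norm (a n))" "\<And>w. w \<in> unit_disk \<Longrightarrow> (\<lambda>n. a n * w ^ n) sums g w"
    by metis
  define A where "A = (\<Sum>n. norm (a n))"
  have gb: "norm (g w) \<le> A" if "w \<in> unit_disk" for w
  proof -
    have "norm (a n * w ^ n) \<le> norm (a n)" for n
      using that by (simp add: norm_mult norm_power power_le_one mult_left_le)
    then have "norm (\<Sum>n. a n * w ^ n) \<le> (\<Sum>n. norm (a n))" by (intro norm_suminf_le a)
    then show ?thesis using a(2)[OF that] by (simp add: sums_iff A_def)
  qed
  have A0: "A \<ge> 0" using gb[of 0] by (simp add: order_trans[OF norm_ge_zero])
  define c where "c = (\<lambda>n. \<Sum>i\<le>n. Suc i)"
  have c: "2 * c n = (n + 1) * (n + 2)" for n by (induction n) (auto simp: c_def)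
  let ?f = "\<lambda>n w. of_nat (c n) * \<zeta> ^ n * (g w * (cnj w ^ n * complex_of_real (1 - (norm w)\<^sup>2) ^ 1))"
  have S: "(\<lambda>n. LINT w|disk_measure. ?f n w) sums (LINT w|disk_measure. (\<Sum>n. ?f n w))"
  proof (rule sums_integral_disk)
    have "summable (\<lambda>n. of_nat (c n) * norm \<zeta> ^ n)"
      using inverse_cube_sums[of "norm \<zeta>"] \<zeta> by (auto simp: sums_iff c_def)
    then show "summable (\<lambda>n. of_nat (c n) * norm \<zeta> ^ n * A)" by (rule summable_mult2)
    have "continuous_on unit_disk g"
      using g by (intro holomorphic_on_imp_continuous_on) (auto intro: holomorphic_on_subset)
    then show "continuous_on unit_disk (?f n)" for n
      by (intro continuous_intros)
    fix n and w :: complex assume w: "w \<in> unit_disk"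
    have "norm (cnj w ^ n) * norm (complex_of_real (1 - (norm w)\<^sup>2) ^ 1) \<le> 1 * 1"
      using w by (intro mult_mono) (auto simp: norm_power power_le_one abs_le_iff norm_of_real simp del: of_real_diff of_real_power)
    then have "norm (g w) * norm (cnj w ^ n * complex_of_real (1 - (norm w)\<^sup>2) ^ 1) \<le> A * 1"
      using gb[OF w] A0 by (intro mult_mono) (auto simp: norm_mult)
    then show "norm (?f n w) \<le> of_nat (c n) * norm \<zeta> ^ n * A"
      unfolding norm_mult[of "of_nat (c n) * \<zeta> ^ n"] norm_mult[of "g w"] norm_mult[of "of_nat (c n)"]
      by (intro mult_mono) (auto simp: norm_power)
  qed
  have e: "(LINT w|disk_measure. (\<Sum>n. ?f n w)) =
    (LINT w|disk_measure. g w * complex_of_real (1 - (norm w)\<^sup>2) / (1 - cnj w * \<zeta>) ^ 3)"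
  proof (rule Bochner_Integration.integral_cong[OF refl])
    fix w assume w: "w \<in> space disk_measure"
    have "norm w * norm \<zeta> < 1" using w \<zeta> mult_strict_mono'[of "norm w" 1 "norm \<zeta>" 1] by simp
    then have "norm (cnj w * \<zeta>) < 1" by (simp add: norm_mult)
    from sums_mult2[OF inverse_cube_sums[OF this], of "g w * complex_of_real (1 - (norm w)\<^sup>2)"]
    show "(\<Sum>n. ?f n w) = g w * complex_of_real (1 - (norm w)\<^sup>2) / (1 - cnj w * \<zeta>) ^ 3"
      by (simp add: sums_iff c_def power_mult_distrib mult_ac del: of_nat_sum)
  qed
  have t: "(LINT w|disk_measure. ?f n w) = pi / 2 * (a n * \<zeta> ^ n)" for n
  proof -
    have "of_nat (c n) * (pi / ((real n + 1) * (real n + 2))) = pi / 2"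
    proof -
      have "real (2 * c n) = (real n + 1) * (real n + 2)" unfolding c by (simp add: algebra_simps)
      then have "of_nat (c n) * (pi / ((real n + 1) * (real n + 2))) = of_nat (c n) * (pi / (2 * real (c n)))" by simp
      moreover have "c n > 0" using c[of n] by (cases "c n") auto
      ultimately show ?thesis by simp
    qed
    then have k: "of_nat (c n) * complex_of_real (pi / ((real n + 1) * (real n + 2))) = complex_of_real (pi / 2)"
      by (metis of_real_mult of_real_of_nat_eq)
    have "(LINT w|disk_measure. ?f n w) = of_nat (c n) * \<zeta> ^ n * (a n * complex_of_real (pi / ((real n + 1) * (real n + 2))))"
      using integral_disk_power_series[OF a, of n 1] integral_disk_monomial_eq[of n]
      by (simp only: integral_mult_right_zero power_one_right mult.assoc)
    also have "\<dots> = (of_nat (c n) * complex_of_real (pi / ((real n + 1) * (real n + 2)))) * (a n * \<zeta> ^ n)"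
      by (simp only: mult_ac)
    finally show ?thesis unfolding k by simp
  qed
  have "(\<lambda>n. pi / 2 * (a n * \<zeta> ^ n)) sums (pi / 2 * g \<zeta>)"
    using a(2)[of \<zeta>] \<zeta> by (intro sums_mult) auto
  from sums_unique2[OF S[unfolded e t] this] show ?thesis .
qed



section \<open>The minimal Moebius invariant space\<close>

lemma eval_mm_holomorphic: "eval_mm f holomorphic_on unit_disk"
  using eval_mm[of f] by (simp add: min_space_def)

lemma disk_norm1_cong:
  "(\<And>z. z \<in> unit_disk \<Longrightarrow> f z = g z) \<Longrightarrow> disk_norm1 f = disk_norm1 g"
  unfolding disk_norm1_eq
  by (rule arg_cong[where f="\<lambda>x. x / ennreal pi"], rule nn_integral_cong) simp

lemma disk_norm1_mono:
  "(\<And>z. z \<in> unit_disk \<Longrightarrow> norm (f z) \<le> norm (g z)) \<Longrightarrow> disk_norm1 f \<le> disk_norm1 g"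
  unfolding disk_norm1_eq
  by (rule divide_right_mono_ennreal, rule nn_integral_mono) (auto intro: ennreal_leI)

lemma disk_norm1_le_iff:
  assumes "t \<ge> 0"
  shows "disk_norm1 f \<le> ennreal t \<longleftrightarrow> (\<integral>\<^sup>+z. ennreal (norm (f z)) \<partial>disk_measure) \<le> ennreal (pi * t)"
proof -
  let ?I = "\<integral>\<^sup>+z. ennreal (norm (f z)) \<partial>disk_measure"
  have d: "disk_norm1 f = ennreal (1 / pi) * ?I"
    by (simp add: disk_norm1_eq divide_ennreal_def inverse_ennreal mult.commute inverse_eq_divide)
  show ?thesis
  proof
    assume "disk_norm1 f \<le> ennreal t"
    then have "ennreal pi * (ennreal (1 / pi) * ?I) \<le> ennreal pi * ennreal t"
      unfolding d by (rule mult_left_mono) simp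
    then show "?I \<le> ennreal (pi * t)"
      by (simp add: mult.assoc[symmetric] ennreal_mult[symmetric] assms)
  next
    assume "?I \<le> ennreal (pi * t)"
    then have "ennreal (1 / pi) * ?I \<le> ennreal (1 / pi) * ennreal (pi * t)"
      by (rule mult_left_mono) simp
    then show "disk_norm1 f \<le> ennreal t"
      unfolding d by (simp add: ennreal_mult[symmetric] assms)
  qed
qed

lemma borel_measurable_ennreal_norm:
  fixes f :: "'a \<Rightarrow> complex"
  shows "f \<in> borel_measurable M \<Longrightarrow> (\<lambda>z. ennreal (norm (f z))) \<in> borel_measurable M"
  by measurable

lemma disk_norm1_triangle:
  assumes "f \<in> borel_measurable disk_measure" "g \<in> borel_measurable disk_measure"
  shows "disk_norm1 (\<lambda>z. f z + g z) \<le> disk_norm1 f + disk_norm1 g"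
proof -
  have "(\<integral>\<^sup>+z. ennreal (norm (f z + g z)) \<partial>disk_measure)
     \<le> (\<integral>\<^sup>+z. ennreal (norm (f z)) + ennreal (norm (g z)) \<partial>disk_measure)"
    by (intro nn_integral_mono) (simp flip: ennreal_plus add: norm_triangle_ineq)
  also have "\<dots> = (\<integral>\<^sup>+z. ennreal (norm (f z)) \<partial>disk_measure) + (\<integral>\<^sup>+z. ennreal (norm (g z)) \<partial>disk_measure)"
    by (intro nn_integral_add borel_measurable_ennreal_norm assms)
  finally show ?thesis
    unfolding disk_norm1_eq by (simp flip: add_divide_distrib_ennreal add: divide_right_mono_ennreal)
qed

lemma disk_norm1_bounded:
  assumes "\<And>z. z \<in> unit_disk \<Longrightarrow> norm (f z) \<le> B" "B \<ge> 0"
  shows "disk_norm1 f \<le> ennreal B"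
proof -
  have "(\<integral>\<^sup>+z. ennreal (norm (f z)) \<partial>disk_measure) \<le> (\<integral>\<^sup>+z. ennreal B \<partial>disk_measure)"
    using assms by (intro nn_integral_mono) (auto intro: ennreal_leI)
  also have "\<dots> = ennreal (pi * B)"
    using assms by (simp add: emeasure_disk ennreal_mult mult.commute)
  finally show ?thesis using assms by (simp add: disk_norm1_le_iff)
qed

text \<open>The derivative of \<open>phi \<alpha>\<close> in closed form; \<open>phi2\<close> below
  is the second derivative. Both vanish for |\<alpha>| = 1, in accordance with
  \<open>phi \<alpha>\<close> being constant then.\<close>

definition phi1 :: "complex \<Rightarrow> complex \<Rightarrow> complex" where
  "phi1 \<alpha> z = - complex_of_real (1 - (norm \<alpha>)\<^sup>2) / (1 - cnj \<alpha> * z)\<^sup>2"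

definition phi2 :: "complex \<Rightarrow> complex \<Rightarrow> complex" where
  "phi2 \<alpha> z = - 2 * cnj \<alpha> * complex_of_real (1 - (norm \<alpha>)\<^sup>2) / (1 - cnj \<alpha> * z) ^ 3"

lemma phi_DERIV:
  assumes "norm \<alpha> \<le> 1" "norm z < 1"
  shows "(phi \<alpha> has_field_derivative phi1 \<alpha> z) (at z)"
proof -
  have nz: "1 - cnj \<alpha> * z \<noteq> 0" by (rule phi_denom_nonzero[OF assms])
  have n: "complex_of_real (1 - (norm \<alpha>)\<^sup>2) = 1 - \<alpha> * cnj \<alpha>" by (simp only: of_real_diff of_real_1 complex_norm_square)
  have "(phi \<alpha> has_field_derivative
     ((0 - 1) * (1 - cnj \<alpha> * z) - (\<alpha> - z) * (0 - cnj \<alpha> * 1)) / ((1 - cnj \<alpha> * z) * (1 - cnj \<alpha> * z))) (at z)"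
    unfolding phi_def[abs_def] by (rule derivative_eq_intros refl nz)+ (simp add: algebra_simps)
  moreover have "((0 - 1) * (1 - cnj \<alpha> * z) - (\<alpha> - z) * (0 - cnj \<alpha> * 1)) / ((1 - cnj \<alpha> * z) * (1 - cnj \<alpha> * z)) = phi1 \<alpha> z"
    unfolding phi1_def n by (simp add: power2_eq_square algebra_simps)
  ultimately show ?thesis by simp
qed

lemma phi1_DERIV:
  assumes "norm \<alpha> \<le> 1" "norm z < 1"
  shows "(phi1 \<alpha> has_field_derivative phi2 \<alpha> z) (at z)"
proof -
  have nz: "1 - cnj \<alpha> * z \<noteq> 0" by (rule phi_denom_nonzero[OF assms])
  define c where "c = complex_of_real (1 - (norm \<alpha>)\<^sup>2)"
  define d where "d = 1 - cnj \<alpha> * z"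
  have "(phi1 \<alpha> has_field_derivative (0 * (1 - cnj \<alpha> * z)\<^sup>2 - (- c) * (2 * (1 - cnj \<alpha> * z) * (0 - cnj \<alpha>)))
      / ((1 - cnj \<alpha> * z)\<^sup>2 * (1 - cnj \<alpha> * z)\<^sup>2)) (at z)"
    unfolding phi1_def[abs_def] c_def[symmetric]
    by (rule derivative_eq_intros refl | use nz in simp)+
  also have "(0 * (1 - cnj \<alpha> * z)\<^sup>2 - (- c) * (2 * (1 - cnj \<alpha> * z) * (0 - cnj \<alpha>)))
      / ((1 - cnj \<alpha> * z)\<^sup>2 * (1 - cnj \<alpha> * z)\<^sup>2) = phi2 \<alpha> z"
    using nz unfolding phi2_def c_def[symmetric] d_def[symmetric]
    by (simp add: field_simps power2_eq_square power3_eq_cube)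
  finally show ?thesis .
qed

lemma deriv2_eqI:
  assumes "\<And>z. z \<in> S \<Longrightarrow> (f has_field_derivative f1 z) (at z)"
    and "\<And>z. z \<in> S \<Longrightarrow> (f1 has_field_derivative f2 z) (at z)" and "open S" "z \<in> S"
  shows "(deriv ^^ 2) f z = f2 z"
proof -
  have "deriv f w = f1 w" if "w \<in> S" for w by (rule DERIV_imp_deriv) (rule assms(1)[OF that])
  then have "eventually (\<lambda>w. deriv f w = f1 w) (nhds z)"
    using assms by (auto simp: eventually_nhds)
  then have "deriv (deriv f) z = deriv f1 z" by (rule deriv_cong_ev) simp
  also have "\<dots> = f2 z" by (rule DERIV_imp_deriv) (rule assms(2)[OF assms(4)])
  finally show ?thesis by (simp add: numeral_2_eq_2)
qed

lemma phi_holomorphic: "norm \<alpha> \<le> 1 \<Longrightarrow> phi \<alpha> holomorphic_on unit_disk"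
  unfolding holomorphic_on_def field_differentiable_def
proof (intro ballI exI)
  fix z assume "norm \<alpha> \<le> 1" "z \<in> unit_disk"
  then show "(phi \<alpha> has_field_derivative phi1 \<alpha> z) (at z within unit_disk)"
    by (simp add: has_field_derivative_at_within[OF phi_DERIV])
qed

text \<open>Boundary parameters are the source of the constant functions in the space, which are
  needed to correct values at 0.\<close>

lemma phi_unimodular: "norm \<alpha> = 1 \<Longrightarrow> norm z < 1 \<Longrightarrow> phi \<alpha> z = \<alpha>"
proof -
  assume \<alpha>: "norm \<alpha> = 1" and z: "norm z < 1"
  have "\<alpha> * cnj \<alpha> = 1" using \<alpha> complex_norm_square[of \<alpha>] by simp
  then have "\<alpha> - z = \<alpha> * (1 - cnj \<alpha> * z)" by (simp add: right_diff_distrib mult.assoc[symmetric])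
  then show ?thesis using phi_denom_nonzero[of \<alpha> z] \<alpha> z unfolding phi_def by (metis nonzero_mult_div_cancel_right order_refl)
qed

text \<open>The numerator is at most 4 (1 - |\<alpha>|), which offsets the growth of the kernel
  integral 32 pi / (1 - |\<alpha>|); the product, divided by pi, is 128.\<close>

lemma disk_norm1_phi2:
  assumes "norm \<alpha> \<le> 1"
  shows "disk_norm1 (phi2 \<alpha>) \<le> ennreal 128"
proof (cases "norm \<alpha> < 1")
  case True
  define c where "c = 2 * norm \<alpha> * (1 - (norm \<alpha>)\<^sup>2)"
  have c0: "c \<ge> 0" using True by (simp add: c_def power_le_one)
  have "1 - (norm \<alpha>)\<^sup>2 = (1 - norm \<alpha>) * (1 + norm \<alpha>)" by (simp add: power2_eq_square algebra_simps)
  also have "\<dots> \<le> (1 - norm \<alpha>) * 2" using True by (intro mult_left_mono) auto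
  finally have "c \<le> 2 * 1 * ((1 - norm \<alpha>) * 2)"
    unfolding c_def using True by (intro mult_mono) (auto simp: power_le_one)
  then have c: "c \<le> 4 * (1 - norm \<alpha>)" by simp
  have "norm (phi2 \<alpha> z) = c * (1 / norm (1 - cnj \<alpha> * z) ^ 3)" for z
  proof -
    have "norm (complex_of_real (1 - (norm \<alpha>)\<^sup>2)) = 1 - (norm \<alpha>)\<^sup>2"
      using True unfolding norm_of_real by (simp add: power_le_one)
    then show ?thesis by (simp only: phi2_def norm_divide norm_mult norm_power norm_minus_cancel c_def) simp
  qed
  then have "ennreal (norm (phi2 \<alpha> z)) = ennreal c * ennreal (1 / norm (1 - cnj \<alpha> * z) ^ 3)" for z
    using c0 by (simp only: ennreal_mult zero_le_divide_1_iff zero_le_power norm_ge_zero)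
  then have "(\<integral>\<^sup>+z. ennreal (norm (phi2 \<alpha> z)) \<partial>disk_measure)
     = (\<integral>\<^sup>+z. ennreal c * ennreal (1 / norm (1 - cnj \<alpha> * z) ^ 3) \<partial>disk_measure)" by simp
  also have "\<dots> = ennreal c * (\<integral>\<^sup>+z. ennreal (1 / norm (1 - cnj \<alpha> * z) ^ 3) \<partial>disk_measure)"
  proof (intro nn_integral_cmult measurable_compose[OF _ measurable_ennreal] borel_measurable_disk continuous_intros)
    show "\<forall>z\<in>unit_disk. norm (1 - cnj \<alpha> * z) ^ 3 \<noteq> 0"
      using phi_denom_nonzero[OF assms] by auto
  qed
  also have "\<dots> \<le> ennreal c * ennreal (32 * pi / (1 - norm \<alpha>))"
    by (intro mult_left_mono nn_integral_kernel_le True) simp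
  also have "\<dots> = ennreal (c * (32 * pi / (1 - norm \<alpha>)))" using c0 True by (intro ennreal_mult[symmetric]) auto
  also have "\<dots> \<le> ennreal (pi * 128)"
  proof (rule ennreal_leI)
    have "c * (32 * pi / (1 - norm \<alpha>)) \<le> 4 * (1 - norm \<alpha>) * (32 * pi / (1 - norm \<alpha>))"
      using c True by (intro mult_right_mono) auto
    also have "\<dots> = pi * 128" using True by (simp add: field_simps)
    finally show "c * (32 * pi / (1 - norm \<alpha>)) \<le> pi * 128" .
  qed
  finally show ?thesis by (intro iffD2[OF disk_norm1_le_iff]) auto
next
  case False
  then have "norm \<alpha> = 1" using assms by simp
  then have "phi2 \<alpha> z = 0" for z by (simp add: phi2_def)
  then show ?thesis by (intro disk_norm1_bounded) auto
qed

text \<open>Every \<open>phi \<alpha>\<close> is bounded by 1, so the representing series converges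
  uniformly on the disk by the Weierstrass test and may be differentiated termwise.\<close>

lemma mobius_rep_deriv2:
  assumes rep: "mobius_rep a l f" and z: "z \<in> unit_disk"
  shows "(\<lambda>n. l n * phi2 (a n) z) sums (deriv ^^ 2) f z"
proof -
  have a: "norm (a n) \<le> 1" for n using rep by (auto simp: mobius_rep_def)
  have le: "norm (l n * phi (a n) w) \<le> norm (l n)" if "w \<in> unit_disk" for n w
    using norm_phi_le_1[of "a n" w] a that by (auto simp: norm_mult intro: mult_left_le)
  have "uniform_limit unit_disk (\<lambda>n w. \<Sum>i<n. l i * phi (a i) w) (\<lambda>w. \<Sum>i. l i * phi (a i) w) sequentially"
    using rep le by (intro Weierstrass_m_test[where M="\<lambda>n. norm (l n)"]) (auto simp: mobius_rep_def)
  then have u: "uniform_limit unit_disk (\<lambda>n w. \<Sum>i<n. l i * phi (a i) w) f sequentially"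
    by (rule uniform_limit_cong'[THEN iffD1, rotated 2]) (use rep in \<open>auto simp: mobius_rep_def sums_iff\<close>)
  have "(\<lambda>n. (deriv ^^ 2) (\<lambda>w. \<Sum>i<n. l i * phi (a i) w) z) \<longlonglongrightarrow> (deriv ^^ 2) f z"
    by (rule higher_deriv_complex_uniform_limit[OF u])
       (use z a in \<open>auto intro!: always_eventually holomorphic_intros phi_holomorphic\<close>)
  moreover have "(deriv ^^ 2) (\<lambda>w. \<Sum>i<n. l i * phi (a i) w) z = (\<Sum>i<n. l i * phi2 (a i) z)" for n
    by (rule deriv2_eqI[where S=unit_disk and ?f1.0="\<lambda>w. \<Sum>i<n. l i * phi1 (a i) w"])
       (use z a in \<open>auto intro!: derivative_eq_intros phi_DERIV phi1_DERIV simp: mult.commute\<close>)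
  ultimately show ?thesis by (simp add: sums_def)
qed

lemma mobius_rep_disk_norm1:
  assumes rep: "mobius_rep a l f"
  shows "disk_norm1 ((deriv ^^ 2) f) \<le> ennreal (128 * (\<Sum>n. norm (l n)))"
proof -
  have a: "norm (a n) \<le> 1" for n using rep by (auto simp: mobius_rep_def)
  have s: "summable (\<lambda>n. norm (l n))" using rep by (auto simp: mobius_rep_def)
  have [measurable]: "phi2 (a n) \<in> borel_measurable disk_measure" for n
    unfolding phi2_def[abs_def] using phi_denom_nonzero[OF a[of n]]
    by (intro borel_measurable_disk continuous_intros) auto
  have "ennreal (norm ((deriv ^^ 2) f z)) \<le> (\<Sum>n. ennreal (norm (l n)) * ennreal (norm (phi2 (a n) z)))" if "z \<in> unit_disk" for z
  proof (cases "summable (\<lambda>n. norm (l n * phi2 (a n) z))")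
    case True
    have "norm ((deriv ^^ 2) f z) \<le> (\<Sum>n. norm (l n * phi2 (a n) z))"
      using mobius_rep_deriv2[OF rep that] summable_norm[OF True] by (simp add: sums_iff)
    then have "ennreal (norm ((deriv ^^ 2) f z)) \<le> ennreal (\<Sum>n. norm (l n * phi2 (a n) z))" by (rule ennreal_leI)
    also have "\<dots> = (\<Sum>n. ennreal (norm (l n * phi2 (a n) z)))"
      using True by (intro suminf_ennreal2[symmetric]) auto
    finally show ?thesis by (simp add: norm_mult ennreal_mult)
  next
    \<comment> \<open>Without absolute convergence the sum of norms is infinite in
      \<open>ennreal\<close>, and the bound is trivial.\<close>
    case False
    then have "(\<Sum>n. ennreal (norm (l n * phi2 (a n) z))) = top"
      using summable_suminf_not_top[of "\<lambda>n. norm (l n * phi2 (a n) z)"] by fastforce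
    then show ?thesis by (simp add: norm_mult ennreal_mult)
  qed
  then have "(\<integral>\<^sup>+z. ennreal (norm ((deriv ^^ 2) f z)) \<partial>disk_measure)
     \<le> (\<integral>\<^sup>+z. (\<Sum>n. ennreal (norm (l n)) * ennreal (norm (phi2 (a n) z))) \<partial>disk_measure)"
    by (intro nn_integral_mono) auto
  also have "\<dots> = (\<Sum>n. ennreal (norm (l n)) * (\<integral>\<^sup>+z. ennreal (norm (phi2 (a n) z)) \<partial>disk_measure))"
    by (subst nn_integral_suminf) (simp_all add: nn_integral_cmult)
  also have "\<dots> \<le> (\<Sum>n. ennreal (norm (l n)) * ennreal (pi * 128))"
  proof (intro suminf_le mult_left_mono)
    show "(\<integral>\<^sup>+z. ennreal (norm (phi2 (a n) z)) \<partial>disk_measure) \<le> ennreal (pi * 128)" for n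
      by (rule iffD1[OF disk_norm1_le_iff disk_norm1_phi2[OF a]]) simp
  qed auto
  also have "\<dots> = ennreal (pi * (128 * (\<Sum>n. norm (l n))))"
  proof -
    have "(\<Sum>n. ennreal (norm (l n)) * ennreal (pi * 128)) = (\<Sum>n. ennreal (norm (l n) * (pi * 128)))"
      by (simp add: ennreal_mult)
    also have "\<dots> = ennreal (\<Sum>n. norm (l n) * (pi * 128))"
      using s by (intro suminf_ennreal2 summable_mult2) auto
    also have "(\<Sum>n. norm (l n) * (pi * 128)) = (\<Sum>n. norm (l n)) * (pi * 128)"
      by (rule suminf_mult2[OF s, symmetric])
    finally show ?thesis by (simp only: mult_ac)
  qed
  finally show ?thesis using s by (subst disk_norm1_le_iff) (auto intro: suminf_nonneg)
qed

lemma disk_norm1_deriv2_le_norm: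
  "disk_norm1 ((deriv ^^ 2) (eval_mm f)) \<le> ennreal (128 * norm f)"
proof -
  let ?N = "disk_norm1 ((deriv ^^ 2) (eval_mm f))"
  obtain a l where "mobius_rep a l (eval_mm f)" using eval_mm_rep by blast
  \<comment> \<open>Finiteness is secured first: \<open>enn2real\<close> sends infinity to 0, so
    without it the real estimate below could not be carried back.\<close>
  from mobius_rep_disk_norm1[OF this] have fin: "?N < top" by (simp add: order_le_less_trans[OF _ ennreal_less_top])
  have "enn2real ?N / 128 \<le> norm f"
  proof (rule norm_mm_ge)
    fix a l assume rep: "mobius_rep a l (eval_mm f)"
    then have "(\<Sum>n. norm (l n)) \<ge> 0" by (auto simp: mobius_rep_def intro: suminf_nonneg)
    then have "enn2real ?N \<le> 128 * (\<Sum>n. norm (l n))"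
      using mobius_rep_disk_norm1[OF rep] by (intro enn2real_leI) auto
    then show "enn2real ?N / 128 \<le> (\<Sum>n. norm (l n))" by simp
  qed
  then have "ennreal (enn2real ?N) \<le> ennreal (128 * norm f)" by (intro ennreal_leI) simp
  then show ?thesis using fin by simp
qed

section \<open>Series of elements, and operators tested on atoms\<close>

lemma mobius_rep_suminf:
  assumes rep: "\<And>k. mobius_rep (a k) (l k) (f k)" and le: "\<And>k. (\<Sum>n. norm (l k n)) \<le> M k"
    and M: "summable M" and g: "\<And>z. z \<in> unit_disk \<Longrightarrow> (\<lambda>k. f k z) sums g z"
  obtains b m where "mobius_rep b m g" "(\<Sum>n. norm (m n)) \<le> suminf M"
proof -
  \<comment> \<open>The double family of atoms is listed in a single sequence along
    \<open>prod_decode\<close>. Summability of all coefficients on the product bounds the total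
    weight and also justifies summing the atoms in this order.\<close>
  define b where "b = (\<lambda>i. a (fst (prod_decode i)) (snd (prod_decode i)))"
  define m where "m = (\<lambda>i. l (fst (prod_decode i)) (snd (prod_decode i)))"
  have bij: "bij_betw prod_decode UNIV (UNIV :: (nat \<times> nat) set)" by (rule bij_prod_decode)
  have sl: "summable (\<lambda>n. norm (l k n))" for k using rep by (auto simp: mobius_rep_def)
  have an: "norm (a k n) \<le> 1" for k n using rep by (auto simp: mobius_rep_def)
  define L where "L = (\<lambda>k. \<Sum>n. norm (l k n))"
  have L0: "L k \<ge> 0" for k unfolding L_def by (intro suminf_nonneg sl) auto
  have sL: "summable L"
    by (rule summable_comparison_test'[OF M, of 0]) (use L0 le in \<open>auto simp: L_def\<close>)
  have h1: "((\<lambda>n. norm (l k n)) has_sum L k) UNIV" for k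
    unfolding L_def by (intro sums_nonneg_imp_has_sum summable_sums sl) auto
  have h2: "(L has_sum suminf L) UNIV"
    by (intro sums_nonneg_imp_has_sum summable_sums sL L0)
  have son: "(\<lambda>p. norm (l (fst p) (snd p))) summable_on UNIV \<times> UNIV"
    by (rule summable_on_SigmaI[where g=L]) (use h1 h2 in \<open>auto simp: summable_on_def\<close>)
  have "((\<lambda>p. norm (l (fst p) (snd p))) has_sum suminf L) (UNIV \<times> UNIV)"
    by (rule has_sum_SigmaI[where g=L]) (use h1 h2 son in auto)
  then have "((\<lambda>i. norm (m i)) has_sum suminf L) UNIV"
    using has_sum_reindex_bij_betw[OF bij, of "\<lambda>p. norm (l (fst p) (snd p))" "suminf L"] by (simp add: m_def)
  then have nm: "(\<lambda>i. norm (m i)) sums suminf L" by (rule has_sum_imp_sums)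
  have "(\<lambda>i. m i * phi (b i) z) sums g z" if z: "z \<in> unit_disk" for z
  proof -
    let ?t = "\<lambda>p. l (fst p) (snd p) * phi (a (fst p) (snd p)) z"
    have le: "norm (l k n * phi (a k n) z) \<le> norm (l k n)" for k n
      using norm_phi_le_1[of "a k n" z] an z by (auto simp: norm_mult intro: mult_left_le)
    have st: "?t summable_on UNIV \<times> UNIV"
      by (rule abs_summable_summable, rule Infinite_Sum.abs_summable_on_comparison_test[OF son]) (use le in auto)
    have t1: "((\<lambda>n. l k n * phi (a k n) z) has_sum f k z) UNIV" for k
      using rep z le by (intro norm_summable_imp_has_sum summable_comparison_test'[OF sl[of k], of 0])
        (auto simp: mobius_rep_def)
    have fk: "norm (f k z) \<le> M k" for k
      using mobius_rep_bound[OF rep z] \<open>\<And>k. (\<Sum>n. norm (l k n)) \<le> M k\<close> by (rule order_trans)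
    have t2: "((\<lambda>k. f k z) has_sum g z) UNIV"
      using g[OF z] fk by (intro norm_summable_imp_has_sum summable_comparison_test'[OF M, of 0]) auto
    have "(?t has_sum g z) (UNIV \<times> UNIV)"
      by (rule has_sum_SigmaI[where g="\<lambda>k. f k z"]) (use t1 t2 st in auto)
    then have "((\<lambda>i. m i * phi (b i) z) has_sum g z) UNIV"
      using has_sum_reindex_bij_betw[OF bij, of ?t "g z"] by (simp add: m_def b_def)
    then show ?thesis by (rule has_sum_imp_sums)
  qed
  then have "mobius_rep b m g"
    unfolding mobius_rep_def using an sums_summable[OF nm] by (auto simp: b_def)
  moreover have "suminf L \<le> suminf M" using le by (intro suminf_le sL M) (auto simp: L_def)
  ultimately show thesis using that sums_unique[OF nm] by simp
qed

lemma min_mobiusI: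
  assumes "mobius_rep a l f" "f holomorphic_on unit_disk"
  obtains F where "\<And>z. z \<in> unit_disk \<Longrightarrow> eval_mm F z = f z" "norm F \<le> (\<Sum>n. norm (l n))"
proof -
  define g where "g = (\<lambda>z. if z \<in> unit_disk then f z else 0)"
  have rep: "mobius_rep a l g" using assms by (auto simp: mobius_rep_def g_def)
  have "g holomorphic_on unit_disk"
    using assms(2) by (rule holomorphic_transform) (simp add: g_def)
  then have "g \<in> min_space" using rep by (auto simp: min_space_def g_def)
  then have e: "eval_mm (Abs_mm g) = g" by (rule Abs_mm_inverse)
  show thesis
    by (rule that[of "Abs_mm g"]) (use norm_mm_le[of a l "Abs_mm g"] rep e in \<open>auto simp: g_def\<close>)
qed

text \<open>The bounds on \<open>norm (F k)\<close> are strict because the infimum defining the norm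
  need not be attained: strictness yields a representation of weight below
  \<open>M k\<close>.\<close>

lemma mm_suminf:
  assumes F: "\<And>k. norm (F k) < M k" and M: "summable M"
    and f: "f holomorphic_on unit_disk" "\<And>z. z \<in> unit_disk \<Longrightarrow> (\<lambda>k. eval_mm (F k) z) sums f z"
  obtains G where "\<And>z. z \<in> unit_disk \<Longrightarrow> eval_mm G z = f z" "norm G \<le> suminf M"
proof -
  have "\<exists>a l. mobius_rep a l (eval_mm (F k)) \<and> (\<Sum>n. norm (l n)) < M k" for k
    using F[of k] norm_mm_ge[of "F k" "M k"] by force
  then obtain a l where al: "\<And>k. mobius_rep (a k) (l k) (eval_mm (F k))" "\<And>k. (\<Sum>n. norm (l k n)) < M k"
    by metis
  obtain b m where bm: "mobius_rep b m f" "(\<Sum>n. norm (m n)) \<le> suminf M"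
    using mobius_rep_suminf[OF al(1) less_imp_le[OF al(2)] M f(2)] by blast
  obtain G where "\<And>z. z \<in> unit_disk \<Longrightarrow> eval_mm G z = f z" "norm G \<le> (\<Sum>n. norm (m n))"
    using min_mobiusI[OF bm(1) f(1)] by blast
  with bm(2) show thesis by (intro that[of G]) auto
qed

definition mobius_mm :: "complex \<Rightarrow> min_mobius" where
  "mobius_mm \<alpha> = Abs_mm (\<lambda>z. if z \<in> unit_disk then phi \<alpha> z else 0)"

lemma mobius_mm:
  assumes "norm \<alpha> \<le> 1"
  shows eval_mobius_mm: "z \<in> unit_disk \<Longrightarrow> eval_mm (mobius_mm \<alpha>) z = phi \<alpha> z"
    and norm_mobius_mm_le: "norm (mobius_mm \<alpha>) \<le> 1"
proof -
  let ?g = "\<lambda>z. if z \<in> unit_disk then phi \<alpha> z else 0"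
  let ?l = "\<lambda>n::nat. if n = 0 then 1 else 0 :: complex"
  have rep: "mobius_rep (\<lambda>_. \<alpha>) ?l ?g"
    using assms sums_single[of 0 "\<lambda>_. phi \<alpha> _"]
    by (auto simp: mobius_rep_def if_distrib[of norm] if_distrib[of "\<lambda>x. x * _"] cong: if_cong intro!: summable_single)
  have "?g holomorphic_on unit_disk"
    using phi_holomorphic[OF assms] by (rule holomorphic_transform) simp
  then have "?g \<in> min_space" using rep by (auto simp: min_space_def)
  then have e: "eval_mm (mobius_mm \<alpha>) = ?g" unfolding mobius_mm_def by (rule Abs_mm_inverse)
  show "z \<in> unit_disk \<Longrightarrow> eval_mm (mobius_mm \<alpha>) z = phi \<alpha> z" by (simp add: e)
  have "(\<lambda>n. norm (?l n)) sums 1" using sums_single[of 0 "\<lambda>_. 1::real"] by (simp add: if_distrib[of norm] cong: if_cong)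
  then show "norm (mobius_mm \<alpha>) \<le> 1"
    using norm_mm_le[of "\<lambda>_. \<alpha>" ?l "mobius_mm \<alpha>"] rep e by (simp add: sums_iff)
qed

text \<open>The remainder after n terms is represented by the shifted sequences, whose weight is a
  tail of a convergent series. Thus the pointwise series converges in norm.\<close>

lemma mobius_rep_tendsto_mm:
  assumes rep: "mobius_rep a l (eval_mm F)"
  shows "(\<lambda>n. scaleC_mm (l n) (mobius_mm (a n))) sums F"
proof -
  have a: "norm (a n) \<le> 1" for n using rep by (auto simp: mobius_rep_def)
  have s: "summable (\<lambda>n. norm (l n))" using rep by (auto simp: mobius_rep_def)
  have ev: "eval_mm (\<Sum>i<n. scaleC_mm (l i) (mobius_mm (a i))) z = (\<Sum>i<n. l i * phi (a i) z)"
    if "z \<in> unit_disk" for n z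
    using that a by (induction n) (auto simp: eval_mobius_mm)
  have "norm (F - (\<Sum>i<n. scaleC_mm (l i) (mobius_mm (a i)))) \<le> (\<Sum>i. norm (l (i + n)))" for n
  proof (rule norm_mm_le)
    show "mobius_rep (\<lambda>i. a (i + n)) (\<lambda>i. l (i + n)) (eval_mm (F - (\<Sum>i<n. scaleC_mm (l i) (mobius_mm (a i)))))"
      using rep s ev unfolding mobius_rep_def
      by (auto simp: summable_iff_shift[of "\<lambda>n. norm (l n)"] intro!: sums_split_initial_segment)
  qed
  then have "\<forall>n. norm ((\<Sum>i<n. scaleC_mm (l i) (mobius_mm (a i))) - F) \<le> (\<Sum>i. norm (l (i + n)))"
    by (simp only: norm_minus_commute[of _ F]) simp
  from Lim_null_comparison[OF always_eventually[OF this] suminf_exist_split2[OF s]]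
  have "(\<lambda>n. \<Sum>i<n. scaleC_mm (l i) (mobius_mm (a i))) \<longlonglongrightarrow> F" by (rule LIM_zero_cancel)
  then show ?thesis by (simp add: sums_def)
qed

text \<open>By norm convergence \<open>L\<close> may be applied to a representation term by term,
  which bounds the image by \<open>B\<close> times the weight; then the infimum is taken. Since
  \<open>bounded_linear\<close> means real linearity and the coefficients are complex,
  \<open>hom\<close> is a separate assumption.\<close>

lemma bounded_linear_mm_bound:
  assumes L: "bounded_linear L" and hom: "\<And>c f. L (scaleC_mm c f) = scaleC_mm c (L f)"
    and B: "\<And>\<alpha>. norm \<alpha> \<le> 1 \<Longrightarrow> norm (L (mobius_mm \<alpha>)) \<le> B"
  shows "norm (L F) \<le> B * norm F"
proof -
  have key: "norm (L F) \<le> B * (\<Sum>n. norm (l n))" if rep: "mobius_rep a l (eval_mm F)" for a l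
  proof -
    have a: "norm (a n) \<le> 1" for n using rep by (auto simp: mobius_rep_def)
    have s: "summable (\<lambda>n. norm (l n))" using rep by (auto simp: mobius_rep_def)
    have "(\<lambda>n. L (scaleC_mm (l n) (mobius_mm (a n)))) sums L F"
      by (rule bounded_linear.sums[OF L mobius_rep_tendsto_mm[OF rep]])
    then have LF: "(\<lambda>n. scaleC_mm (l n) (L (mobius_mm (a n)))) sums L F" by (simp add: hom)
    have le: "norm (scaleC_mm (l n) (L (mobius_mm (a n)))) \<le> norm (l n) * B" for n
      unfolding norm_scaleC_mm using B[OF a] by (intro mult_left_mono) auto
    have "(\<lambda>n. norm (\<Sum>i<n. scaleC_mm (l i) (L (mobius_mm (a i))))) \<longlonglongrightarrow> norm (L F)"
      using LF unfolding sums_def by (rule tendsto_norm)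
    moreover have "norm (\<Sum>i<n. scaleC_mm (l i) (L (mobius_mm (a i)))) \<le> (\<Sum>i. norm (l i) * B)" for n
    proof -
      have "B \<ge> 0" using B[of 0] norm_ge_zero by (rule order_trans[rotated]) simp
      then have "(\<Sum>i<n. norm (l i) * B) \<le> (\<Sum>i. norm (l i) * B)"
        using s by (intro sum_le_suminf summable_mult2) auto
      moreover have "norm (\<Sum>i<n. scaleC_mm (l i) (L (mobius_mm (a i)))) \<le> (\<Sum>i<n. norm (l i) * B)"
        using le by (intro sum_norm_le)
      ultimately show ?thesis by linarith
    qed
    ultimately have "norm (L F) \<le> (\<Sum>i. norm (l i) * B)"
      by (intro LIMSEQ_le_const2) auto
    then show ?thesis using suminf_mult2[OF s, of B] by (simp add: mult.commute)
  qed
  have "B \<ge> 0" using B[of 0] norm_ge_zero by (rule order_trans[rotated]) simp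
  show ?thesis
  proof (cases "B = 0")
    case True
    then show ?thesis using key eval_mm_rep[of F] by fastforce
  next
    case False
    then have "norm (L F) / B \<le> norm F"
      using \<open>B \<ge> 0\<close> key by (intro norm_mm_ge) (simp add: divide_le_eq mult.commute)
    then show ?thesis using False \<open>B \<ge> 0\<close> by (simp add: field_simps)
  qed
qed



section \<open>The norm is controlled by the second derivative\<close>

text \<open>For turning an integral over parameters in \<open>K\<close> into a finite sum:
  \<open>s\<close> moves each parameter to a nearby point of a finite net. Built along the net as a
  nested case distinction over balls, it is Borel.\<close>

lemma finite_quantization:
  fixes K :: "complex set"
  assumes "compact K" "\<delta> > 0"
  obtains V s where "finite V" "V \<subseteq> K" "s \<in> borel_measurable borel"
    "\<And>w. w \<in> K \<Longrightarrow> s w \<in> V \<and> dist (s w) w < \<delta>"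
proof -
  obtain V where V: "finite V" "V \<subseteq> K" "K \<subseteq> (\<Union>v\<in>V. ball v \<delta>)"
    using compactE_image[OF assms(1), of K "\<lambda>v. ball v \<delta>"] assms(2) by (auto, metis centre_in_ball subsetI UN_I)
  have "\<exists>s\<in>borel_measurable borel. \<forall>w\<in>(\<Union>v\<in>V. ball v \<delta>). s w \<in> V \<and> dist (s w) w < \<delta>"
    using V(1)
  proof induction
    case (insert v V)
    then obtain s where s: "s \<in> borel_measurable borel" "\<And>w. w \<in> (\<Union>v\<in>V. ball v \<delta>) \<Longrightarrow> s w \<in> V \<and> dist (s w) w < \<delta>"
      by blast
    have "(\<lambda>w. if w \<in> ball v \<delta> then v else s w) \<in> borel_measurable borel"
      by (rule measurable_If_set) (use s in auto)
    then show ?case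
    proof (rule bexI[rotated], intro ballI)
      fix w assume "w \<in> (\<Union>v\<in>insert v V. ball v \<delta>)"
      then show "(if w \<in> ball v \<delta> then v else s w) \<in> insert v V \<and> dist (if w \<in> ball v \<delta> then v else s w) w < \<delta>"
        using s(2)[of w] by (cases "w \<in> ball v \<delta>") auto
    qed
  qed (auto intro!: exI[of _ "\<lambda>_. 0"])
  then show thesis using that V by blast
qed

lemma AE_disk_nonzero: "AE w in disk_measure. w \<noteq> 0"
  by (subst AE_restrict_space_iff) (auto intro: AE_mp[OF AE_lborel_singleton[of 0]])

text \<open>The reproducing formula for w \<mapsto> g(\<rho> w), evaluated at \<rho> z. This
  function is holomorphic beyond the closed disk, and the kernel at \<rho> z has the denominator of
  \<open>phi2\<close> with parameter \<rho> w, which stays in the disc of radius \<rho>. The lower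
  bound on \<rho> only serves to make 1 / \<rho>^2 at most 4.\<close>

lemma mobius_integral_representation:
  assumes g: "g holomorphic_on unit_disk" "disk_norm1 g \<le> ennreal t" and t: "t \<ge> 0"
    and \<rho>: "1 / 2 \<le> \<rho>" "\<rho> < 1"
  obtains H where "integrable disk_measure H" "(LINT w|disk_measure. norm (H w)) \<le> 264 * t"
    "\<And>z::complex. z \<in> unit_disk \<Longrightarrow> (LINT w|disk_measure. H w * phi2 (complex_of_real \<rho> * w) z) = complex_of_real (\<rho> ^ 4) * g (complex_of_real (\<rho>\<^sup>2) * z)"
proof -
  define G where "G = (\<lambda>w. g (complex_of_real \<rho> * w))"
  have G: "G holomorphic_on ball 0 (1 / \<rho>)"
    unfolding G_def using \<rho>
    by (intro holomorphic_on_compose_gen[OF _ g(1), unfolded o_def] holomorphic_intros)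
       (auto simp: norm_mult field_simps)
  have sub: "unit_disk \<subseteq> ball 0 (1 / \<rho>)"
  proof
    fix w :: complex assume "w \<in> unit_disk"
    then have "norm w < 1" by simp
    also have "1 \<le> 1 / \<rho>" using \<rho> by (simp add: field_simps)
    finally show "w \<in> ball 0 (1 / \<rho>)" by simp
  qed
  have GD: "G holomorphic_on unit_disk" by (rule holomorphic_on_subset[OF G sub])
  have "(\<integral>\<^sup>+w. ennreal (norm (G w)) \<partial>disk_measure)
     \<le> ennreal (1 / \<rho>\<^sup>2) * (\<integral>\<^sup>+w. ennreal (norm (g w)) \<partial>disk_measure)"
    using nn_integral_disk_affine_le[OF g(1), of \<rho> 0] \<rho> by (simp add: G_def scaleR_conv_of_real)
  also have "\<dots> \<le> ennreal 4 * ennreal (pi * t)"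
  proof (intro mult_mono ennreal_leI)
    have "(1/2)\<^sup>2 \<le> \<rho>\<^sup>2" using \<rho> by (intro power_mono) auto
    then show "1 / \<rho>\<^sup>2 \<le> 4" using \<rho> by (simp add: field_simps)
    show "(\<integral>\<^sup>+w. ennreal (norm (g w)) \<partial>disk_measure) \<le> ennreal (pi * t)"
      by (rule iffD1[OF disk_norm1_le_iff[OF t] g(2)])
  qed auto
  also have "\<dots> = ennreal (pi * (4 * t))"
    using t by (subst ennreal_mult[symmetric]) (auto simp: mult_ac)
  finally have GI: "(\<integral>\<^sup>+w. ennreal (norm (G w)) \<partial>disk_measure) \<le> ennreal (pi * (4 * t))" .
  then have GN: "disk_norm1 G \<le> ennreal (4 * t)" using t by (intro iffD2[OF disk_norm1_le_iff]) auto
  \<comment> \<open>Near the origin the mean value bound gives |G| \<le> 64 t, from the norm 4 t,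
    the factor 4 and (1 - |w|)^2 \<ge> 1/4, and leaves the integrable 1 / |w|. Away from it 1 / |w|
    is at most 2.\<close>
  have Gw: "norm (G w) / norm w \<le> 64 * t * (1 / norm w) + 2 * norm (G w)" if w: "w \<in> unit_disk" for w
  proof (cases "norm w \<le> 1 / 2")
    case True
    have "ennreal (norm (G w) * (1 - norm w)\<^sup>2 / 4) \<le> ennreal (4 * t)"
      using area_mean_value_bound[OF GD w] GN by (rule order_trans)
    then have "norm (G w) * (1 - norm w)\<^sup>2 / 4 \<le> 4 * t" using t by (subst (asm) ennreal_le_iff) auto
    moreover have "(1/2)\<^sup>2 \<le> (1 - norm w)\<^sup>2" using True by (intro power_mono) auto
    then have "norm (G w) * (1 / 4) \<le> norm (G w) * (1 - norm w)\<^sup>2" by (intro mult_left_mono) (auto simp: power2_eq_square)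
    ultimately have "norm (G w) \<le> 64 * t" by simp
    then have "norm (G w) / norm w \<le> 64 * t / norm w" by (intro divide_right_mono) auto
    then show ?thesis by (simp add: add_increasing2)
  next
    case False
    then have "1 / norm w \<le> 1 / (1 / 2)" by (intro divide_left_mono) auto
    then have "norm (G w) * (1 / norm w) \<le> norm (G w) * 2" by (intro mult_left_mono) auto
    moreover have "64 * t * (1 / norm w) \<ge> 0" using t by simp
    ultimately show ?thesis by simp
  qed
  define q where "q = (\<lambda>w::complex. (1 - (norm w)\<^sup>2) / (1 - \<rho>\<^sup>2 * (norm w)\<^sup>2))"
  have den: "1 - \<rho>\<^sup>2 * (norm w)\<^sup>2 > 0" if "w \<in> unit_disk" for w :: complex
  proof -
    have "\<rho> * norm w < 1 * 1" using \<rho> that by (intro mult_strict_mono) auto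
    then have "(\<rho> * norm w)\<^sup>2 < 1\<^sup>2" using \<rho> by (intro power_strict_mono) auto
    then show ?thesis by (simp add: power_mult_distrib)
  qed
  have q: "0 \<le> q w" "q w \<le> 1" if "w \<in> unit_disk" for w
  proof -
    have "(norm w)\<^sup>2 \<le> 1" using that by (simp add: power_le_one)
    moreover have "\<rho>\<^sup>2 \<le> 1" using \<rho> by (simp add: power_le_one)
    then have "\<rho>\<^sup>2 * (norm w)\<^sup>2 \<le> (norm w)\<^sup>2" by (intro mult_left_le_one_le) auto
    ultimately show "0 \<le> q w" "q w \<le> 1" using den[OF that] by (auto simp: q_def)
  qed
  text \<open>Dividing the reproducing kernel by \<open>\<phi>\<^sub>\<rho>\<^sub>w''\<close> leaves a factor \<open>1 / cnj w\<close>, which is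
    integrable; its junk value at \<open>w = 0\<close> is irrelevant.\<close>
  define H where "H = (\<lambda>w. - complex_of_real (\<rho> ^ 3 / pi) * G w * complex_of_real (q w) / cnj w)"
  have Hm: "H \<in> borel_measurable disk_measure"
    unfolding H_def
  proof (intro borel_measurable_divide borel_measurable_disk continuous_intros)
    show "continuous_on unit_disk G" by (rule holomorphic_on_imp_continuous_on[OF GD])
    show "continuous_on unit_disk q" unfolding q_def using den by (intro continuous_intros) fastforce
  qed
  have Hb: "norm (H w) \<le> 1 / pi * (64 * t * (1 / norm w) + 2 * norm (G w))" if w: "w \<in> unit_disk" for w
  proof -
    have r3: "0 \<le> \<rho> ^ 3" "\<rho> ^ 3 \<le> 1" using \<rho> by (auto simp: power_le_one)
    have "norm (H w) = (\<rho> ^ 3 * q w) * (1 / pi * (norm (G w) / norm w))"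
      using \<rho> q[OF w] by (simp add: H_def norm_mult norm_divide norm_power)
    also have "\<dots> \<le> 1 * (1 / pi * (norm (G w) / norm w))"
      using r3 q[OF w] by (intro mult_right_mono mult_le_one) auto
    also have "\<dots> \<le> 1 / pi * (64 * t * (1 / norm w) + 2 * norm (G w))"
      unfolding mult_1 using Gw[OF w] by (intro mult_left_mono) auto
    finally show ?thesis .
  qed
  have "(\<integral>\<^sup>+w. ennreal (norm (H w)) \<partial>disk_measure)
     \<le> (\<integral>\<^sup>+w. ennreal (64 * t / pi) * ennreal (1 / norm w) + ennreal (2 / pi) * ennreal (norm (G w)) \<partial>disk_measure)"
  proof (rule nn_integral_mono)
    fix w assume "w \<in> space disk_measure"
    then have "ennreal (norm (H w)) \<le> ennreal (64 * t / pi * (1 / norm w) + 2 / pi * norm (G w))"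
      using Hb[of w] by (intro ennreal_leI) (simp add: field_simps)
    also have "\<dots> = ennreal (64 * t / pi) * ennreal (1 / norm w) + ennreal (2 / pi) * ennreal (norm (G w))"
      using t by (subst ennreal_plus) (auto simp: ennreal_mult[symmetric])
    finally show "ennreal (norm (H w)) \<le> \<dots>" .
  qed
  also have "\<dots> = ennreal (64 * t / pi) * (\<integral>\<^sup>+w. ennreal (1 / norm w) \<partial>disk_measure)
     + ennreal (2 / pi) * (\<integral>\<^sup>+w. ennreal (norm (G w)) \<partial>disk_measure)"
  proof -
    have m1: "(\<lambda>w::complex. ennreal (1 / norm w)) \<in> borel_measurable disk_measure"
      by (intro measurable_compose[OF _ measurable_ennreal] borel_measurable_divide borel_measurable_disk continuous_intros)
    have m2: "(\<lambda>w. ennreal (norm (G w))) \<in> borel_measurable disk_measure"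
      by (intro borel_measurable_ennreal_norm borel_measurable_disk_holomorphic GD)
    show ?thesis by (subst nn_integral_add) (use m1 m2 in \<open>auto simp: nn_integral_cmult intro: borel_measurable_times_ennreal\<close>)
  qed
  \<comment> \<open>The two contributions are 64 * 4 and 2 * 4 times t, whence 264.\<close>
  also have "\<dots> \<le> ennreal (64 * t / pi) * ennreal (4 * pi) + ennreal (2 / pi) * ennreal (pi * (4 * t))"
    by (intro add_mono mult_left_mono nn_integral_inverse_norm_le GI) auto
  also have "\<dots> = ennreal (64 * t / pi * (4 * pi) + 2 / pi * (pi * (4 * t)))"
    using t by (subst ennreal_plus) (auto simp: ennreal_mult[symmetric])
  also have "64 * t / pi * (4 * pi) + 2 / pi * (pi * (4 * t)) = 264 * t" by simp
  finally have HI: "(\<integral>\<^sup>+w. ennreal (norm (H w)) \<partial>disk_measure) \<le> ennreal (264 * t)" .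
  have Hint: "integrable disk_measure H"
    using Hm HI by (simp add: integrable_iff_bounded order_le_less_trans[OF _ ennreal_less_top])
  have "ennreal (LINT w|disk_measure. norm (H w)) = (\<integral>\<^sup>+w. ennreal (norm (H w)) \<partial>disk_measure)"
    using Hint by (intro nn_integral_eq_integral[symmetric] integrable_norm) auto
  then have "(LINT w|disk_measure. norm (H w)) \<le> 264 * t"
    using HI t by (metis ennreal_le_iff mult_nonneg_nonneg zero_le_numeral)
  moreover have "(LINT w|disk_measure. H w * phi2 (complex_of_real \<rho> * w) z) = complex_of_real (\<rho> ^ 4) * g (complex_of_real (\<rho>\<^sup>2) * z)"
    if z: "z \<in> unit_disk" for z :: complex
  proof -
    have \<zeta>: "norm (complex_of_real \<rho> * z) < 1"
      using z \<rho> mult_strict_mono'[of \<rho> 1 "norm z" 1] by (simp add: norm_mult)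
    define A where "A = (\<lambda>w. complex_of_real (2 * \<rho> ^ 4 / pi) * (G w * complex_of_real (1 - (norm w)\<^sup>2) / (1 - cnj w * (complex_of_real \<rho> * z)) ^ 3))"
    have pw: "H w * phi2 (complex_of_real \<rho> * w) z = A w" if "w \<in> unit_disk" "w \<noteq> 0" for w
    proof -
      have d: "complex_of_real (1 - \<rho>\<^sup>2 * (norm w)\<^sup>2) \<noteq> 0" using den[OF that(1)] unfolding of_real_eq_0_iff by linarith
      have cw: "cnj w \<noteq> 0" using that by simp
      have n: "(norm (complex_of_real \<rho> * w))\<^sup>2 = \<rho>\<^sup>2 * (norm w)\<^sup>2" using \<rho> by (simp add: norm_mult power_mult_distrib)
      define D where "D = complex_of_real (1 - \<rho>\<^sup>2 * (norm w)\<^sup>2)"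
      define N where "N = complex_of_real (1 - (norm w)\<^sup>2)"
      define E where "E = 1 - cnj w * (complex_of_real \<rho> * z)"
      have "phi2 (complex_of_real \<rho> * w) z = - 2 * (complex_of_real \<rho> * cnj w) * D / E ^ 3"
        unfolding phi2_def n D_def E_def by (simp add: mult_ac)
      moreover have "H w = - (complex_of_real \<rho> ^ 3 / complex_of_real pi) * G w * (N / D) / cnj w"
        by (simp add: H_def q_def N_def D_def)
      moreover have "A w = 2 * complex_of_real \<rho> ^ 4 / complex_of_real pi * (G w * N / E ^ 3)"
        by (simp add: A_def N_def E_def)
      ultimately show ?thesis using d[folded D_def] cw by (simp add: power4_eq_xxxx power3_eq_cube)
    qed
    have rho_z: "continuous_on unit_disk (\<lambda>w. phi2 (complex_of_real \<rho> * w) z)"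
    proof -
      have "1 - cnj (complex_of_real \<rho> * w) * z \<noteq> 0" if "w \<in> unit_disk" for w
        using z that \<rho> mult_le_one[of \<rho> "norm w"] by (intro phi_denom_nonzero) (auto simp: norm_mult)
      then show ?thesis unfolding phi2_def by (intro continuous_intros) auto
    qed
    have "continuous_on unit_disk A"
    proof -
      have "1 - cnj w * (complex_of_real \<rho> * z) \<noteq> 0" if "w \<in> unit_disk" for w
        using \<zeta> that by (intro phi_denom_nonzero) auto
      then show ?thesis unfolding A_def
        by (intro continuous_intros holomorphic_on_imp_continuous_on[OF GD]) auto
    qed
    then have "(LINT w|disk_measure. H w * phi2 (complex_of_real \<rho> * w) z) = (LINT w|disk_measure. A w)"
    proof (intro integral_cong_AE borel_measurable_times Hm borel_measurable_disk[OF rho_z] borel_measurable_disk[of A])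
      show "AE w in disk_measure. H w * phi2 (complex_of_real \<rho> * w) z = A w"
        using AE_disk_nonzero AE_space by eventually_elim (use pw in auto)
    qed
    also have "\<dots> = complex_of_real (2 * \<rho> ^ 4 / pi) * (pi / 2 * G (complex_of_real \<rho> * z))"
      unfolding A_def integral_mult_right_zero using \<rho> \<zeta> by (subst reproducing_formula[OF G]) auto
    also have "\<dots> = complex_of_real (\<rho> ^ 4) * g (complex_of_real (\<rho>\<^sup>2) * z)"
      by (simp add: G_def power2_eq_square mult.assoc)
    finally show ?thesis .
  qed
  ultimately show thesis using that Hint by blast
qed

text \<open>By Scheffe's lemma pointwise convergence implies L1 convergence once the norms do not
  exceed that of the limit. The factor \<rho>^4 is the Jacobian of dilation by \<rho>^2 and makes
  this comparison hold.\<close>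

lemma dilation_L1_approx:
  assumes g: "g holomorphic_on unit_disk" "disk_norm1 g \<le> ennreal t" and t: "t > 0"
  obtains \<rho> where "1 / 2 \<le> \<rho>" "\<rho> < 1"
    "disk_norm1 (\<lambda>z. complex_of_real (\<rho> ^ 4) * g (complex_of_real (\<rho>\<^sup>2) * z) - g z) \<le> ennreal (t / 4)"
proof -
  \<comment> \<open>The shifted index makes the sequence start at 1/2, so all its members are
    admissible.\<close>
  define \<rho> where "\<rho> = (\<lambda>n. 1 - inverse (real (Suc (n + 1))))"
  have \<rho>: "1 / 2 \<le> \<rho> n" "\<rho> n < 1" for n by (auto simp: \<rho>_def field_simps)
  have lim: "\<rho> \<longlonglongrightarrow> 1 - 0" unfolding \<rho>_def
    by (intro tendsto_diff tendsto_const LIMSEQ_ignore_initial_segment[OF LIMSEQ_inverse_real_of_nat])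
  define F where "F = (\<lambda>n z. complex_of_real (\<rho> n ^ 4) * g (complex_of_real ((\<rho> n)\<^sup>2) * z))"
  have r2: "(\<rho> n)\<^sup>2 < 1" "(\<rho> n)\<^sup>2 > 0" for n
    using \<rho>[of n] by (auto simp: power_less_one_iff intro: zero_less_power)
  have inD: "complex_of_real ((\<rho> n)\<^sup>2) * z \<in> unit_disk" if "z \<in> unit_disk" for n z
    using that r2[of n] mult_strict_mono'[of "(\<rho> n)\<^sup>2" 1 "norm z" 1] \<rho>[of n]
    by (simp add: norm_mult norm_power abs_of_pos del: of_real_power)
  have Fh: "F n holomorphic_on unit_disk" for n
    unfolding F_def using inD
    by (intro holomorphic_intros holomorphic_on_compose_gen[OF _ g(1), unfolded o_def]) auto
  have gI: "(\<integral>\<^sup>+z. ennreal (norm (g z)) \<partial>disk_measure) \<le> ennreal (pi * t)"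
    using t by (intro iffD1[OF disk_norm1_le_iff g(2)]) auto
  have "(\<lambda>n. \<integral>\<^sup>+z. norm (F n z - g z) \<partial>disk_measure) \<longlonglongrightarrow> 0"
  proof (rule Scheffe_lemma2)
    show "F n \<in> borel_measurable disk_measure" for n by (rule borel_measurable_disk_holomorphic[OF Fh])
    show "integrable disk_measure g"
      using gI borel_measurable_disk_holomorphic[OF g(1)]
      by (simp add: integrable_iff_bounded order_le_less_trans[OF _ ennreal_less_top])
    show "AE z in disk_measure. (\<lambda>n. F n z) \<longlonglongrightarrow> g z"
    proof (rule AE_I2)
      fix z assume z: "z \<in> space disk_measure"
      have "(\<lambda>n. complex_of_real ((\<rho> n)\<^sup>2) * z) \<longlonglongrightarrow> complex_of_real ((1 - 0)\<^sup>2) * z"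
        by (intro tendsto_intros lim)
      then have "(\<lambda>n. g (complex_of_real ((\<rho> n)\<^sup>2) * z)) \<longlonglongrightarrow> g (complex_of_real ((1 - 0)\<^sup>2) * z)"
        using z inD holomorphic_on_imp_continuous_on[OF g(1)]
        by (intro continuous_on_tendsto_compose[of unit_disk g]) (auto simp del: of_real_power)
      then have "(\<lambda>n. F n z) \<longlonglongrightarrow> complex_of_real ((1 - 0) ^ 4) * g (complex_of_real ((1 - 0)\<^sup>2) * z)"
        unfolding F_def by (intro tendsto_mult tendsto_of_real tendsto_power lim)
      then show "(\<lambda>n. F n z) \<longlonglongrightarrow> g z" by simp
    qed
    show "(\<integral>\<^sup>+z. norm (F n z) \<partial>disk_measure) \<le> (\<integral>\<^sup>+z. norm (g z) \<partial>disk_measure)" for n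
    proof -
      have e: "norm (F n z) = \<rho> n ^ 4 * norm (g (0 + (\<rho> n)\<^sup>2 *\<^sub>R z))" for z
        using \<rho>[of n] by (simp add: F_def norm_mult norm_power scaleR_conv_of_real)
      have c: "continuous_on unit_disk (\<lambda>z. g (0 + (\<rho> n)\<^sup>2 *\<^sub>R z))"
        using inD by (intro continuous_on_compose2[OF holomorphic_on_imp_continuous_on[OF g(1)]] continuous_intros)
          (auto simp: scaleR_conv_of_real)
      have m: "(\<lambda>z. ennreal (norm (g (0 + (\<rho> n)\<^sup>2 *\<^sub>R z)))) \<in> borel_measurable disk_measure"
        by (rule borel_measurable_ennreal_norm[OF borel_measurable_disk[OF c]])
      have "(\<integral>\<^sup>+z. norm (F n z) \<partial>disk_measure) = ennreal (\<rho> n ^ 4) * (\<integral>\<^sup>+z. norm (g (0 + (\<rho> n)\<^sup>2 *\<^sub>R z)) \<partial>disk_measure)"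
        unfolding e by (subst nn_integral_cmult[OF m, symmetric]) (simp add: ennreal_mult)
      also have "\<dots> \<le> ennreal (\<rho> n ^ 4) * (ennreal (1 / ((\<rho> n)\<^sup>2)\<^sup>2) * (\<integral>\<^sup>+z. norm (g z) \<partial>disk_measure))"
        using r2[of n] by (intro mult_left_mono nn_integral_disk_affine_le g) auto
      also have "\<dots> = ennreal (\<rho> n ^ 4 * (1 / ((\<rho> n)\<^sup>2)\<^sup>2)) * (\<integral>\<^sup>+z. norm (g z) \<partial>disk_measure)"
        by (subst ennreal_mult) (auto simp: mult.assoc)
      also have "\<rho> n ^ 4 * (1 / ((\<rho> n)\<^sup>2)\<^sup>2) = 1" using \<rho>[of n] by simp
      finally show ?thesis by simp
    qed
  qed
  then have "eventually (\<lambda>n. (\<integral>\<^sup>+z. norm (F n z - g z) \<partial>disk_measure) < ennreal (pi * (t / 4))) sequentially"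
    by (rule order_tendstoD) (use t in auto)
  then obtain n where "(\<integral>\<^sup>+z. norm (F n z - g z) \<partial>disk_measure) < ennreal (pi * (t / 4))"
    by (meson eventually_happens sequentially_bot)
  then have "disk_norm1 (\<lambda>z. F n z - g z) \<le> ennreal (t / 4)"
    using t by (intro iffD2[OF disk_norm1_le_iff]) auto
  then show thesis using that[of "\<rho> n"] \<rho>[of n] by (simp add: F_def)
qed

text \<open>The counterpart of \<open>phi_denom_nonzero\<close> with \<open>z\<close> allowed on the
  circle and the parameter kept inside; conjugation exchanges the roles. It permits a compactness
  argument on the closed disk.\<close>

lemma denom_nonzero:
  assumes "norm \<alpha> < 1" "norm z \<le> 1"
  shows "1 - cnj \<alpha> * z \<noteq> 0"
  using phi_denom_nonzero[of "cnj z" "cnj \<alpha>"] assms by (simp add: mult.commute)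

lemma phi2_uniformly_continuous:
  assumes "\<rho> < 1" "\<epsilon> > 0"
  obtains \<delta> where "\<delta> > 0" "\<And>\<alpha> \<beta> z w. norm \<alpha> \<le> \<rho> \<Longrightarrow> norm \<beta> \<le> \<rho> \<Longrightarrow> norm z \<le> 1 \<Longrightarrow> norm w \<le> 1 \<Longrightarrow>
    dist (\<alpha>, z) (\<beta>, w) < \<delta> \<Longrightarrow> norm (phi2 \<alpha> z - phi2 \<beta> w) < \<epsilon>"
proof -
  let ?K = "cball 0 \<rho> \<times> cball 0 1 :: (complex \<times> complex) set"
  have "continuous_on ?K (\<lambda>p. phi2 (fst p) (snd p))"
    unfolding phi2_def
  proof (intro continuous_intros ballI)
    fix p :: "complex \<times> complex" assume "p \<in> ?K"
    then have "1 - cnj (fst p) * snd p \<noteq> 0" using assms by (intro denom_nonzero) auto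
    then show "(1 - cnj (fst p) * snd p) ^ 3 \<noteq> 0" by simp
  qed
  then have uc: "uniformly_continuous_on ?K (\<lambda>p. phi2 (fst p) (snd p))"
    by (rule compact_uniformly_continuous) (auto intro: compact_Times)
  obtain \<delta> where \<delta>: "\<delta> > 0" "\<And>p q. p \<in> ?K \<Longrightarrow> q \<in> ?K \<Longrightarrow> dist q p < \<delta> \<Longrightarrow>
      dist (phi2 (fst q) (snd q)) (phi2 (fst p) (snd p)) < \<epsilon>"
    using uniformly_continuous_onE[OF uc assms(2)] by blast
  show thesis
  proof (rule that[OF \<delta>(1)])
    fix \<alpha> \<beta> z w :: complex
    assume "norm \<alpha> \<le> \<rho>" "norm \<beta> \<le> \<rho>" "norm z \<le> 1" "norm w \<le> 1" "dist (\<alpha>, z) (\<beta>, w) < \<delta>"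
    then show "norm (phi2 \<alpha> z - phi2 \<beta> w) < \<epsilon>" using \<delta>(2)[of "(\<beta>, w)" "(\<alpha>, z)"] by (simp add: dist_norm)
  qed
qed

lemma eval_mm_sum: "eval_mm (\<Sum>v\<in>V. f v) z = (\<Sum>v\<in>V. eval_mm (f v) z)"
  by (induction V rule: infinite_finite_induct) auto

lemma eval_mobius_0_1:
  assumes "z \<in> unit_disk"
  shows "eval_mm (mobius_mm 0) z = - z" "eval_mm (mobius_mm 1) z = 1"
  using assms phi_unimodular[of 1 z] by (simp_all add: eval_mobius_mm phi_def)

lemma has_field_derivative_disk_transform:
  assumes "(f has_field_derivative d) (at z)" "z \<in> unit_disk" "\<And>w. w \<in> unit_disk \<Longrightarrow> g w = f w"
  shows "(g has_field_derivative d) (at z)"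
  by (rule has_field_derivative_transform_within_open[OF assms(1), of unit_disk]) (use assms in auto)

text \<open>The allowed error t / 2 is shared equally by the dilation, in L1, and the quantization
  of the parameters, uniformly in \<open>z\<close>. Removing value and derivative of
  \<open>S\<close> at 0 leaves those of \<open>f\<close> unchanged, so the step can be repeated. The
  atoms, the constant and the linear term cost 264 t each, in total 792 t.\<close>

lemma mobius_approximation_step:
  assumes f: "f holomorphic_on unit_disk" "disk_norm1 ((deriv ^^ 2) f) \<le> ennreal t" and t: "t > 0"
  obtains S where "norm S \<le> 792 * t" "eval_mm S 0 = 0" "deriv (eval_mm S) 0 = 0"
    "disk_norm1 ((deriv ^^ 2) (\<lambda>z. f z - eval_mm S z)) \<le> ennreal (t / 2)"
proof -
  define g where "g = (deriv ^^ 2) f"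
  have g: "g holomorphic_on unit_disk" "disk_norm1 g \<le> ennreal t"
    using f by (auto simp: g_def intro: holomorphic_higher_deriv)
  obtain \<rho> where \<rho>: "1 / 2 \<le> \<rho>" "\<rho> < 1"
    and F: "disk_norm1 (\<lambda>z. complex_of_real (\<rho> ^ 4) * g (complex_of_real (\<rho>\<^sup>2) * z) - g z) \<le> ennreal (t / 4)"
    using dilation_L1_approx[OF g t] by blast
  obtain H where H: "integrable disk_measure H" "(LINT w|disk_measure. norm (H w)) \<le> 264 * t"
    "\<And>z::complex. z \<in> unit_disk \<Longrightarrow> (LINT w|disk_measure. H w * phi2 (complex_of_real \<rho> * w) z) = complex_of_real (\<rho> ^ 4) * g (complex_of_real (\<rho>\<^sup>2) * z)"
    using mobius_integral_representation[OF g less_imp_le[OF t] \<rho>] by blast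
  \<comment> \<open>The oscillation of \<open>phi2\<close> is weighted by the L1 integral of
    \<open>H\<close>, at most 264 t; this choice makes the product t / 4.\<close>
  define \<epsilon> where "\<epsilon> = 1 / (4 * 264 :: real)"
  obtain \<delta> where \<delta>: "\<delta> > 0" "\<And>\<alpha> \<beta> z w. norm \<alpha> \<le> \<rho> \<Longrightarrow> norm \<beta> \<le> \<rho> \<Longrightarrow> norm z \<le> 1 \<Longrightarrow> norm w \<le> 1 \<Longrightarrow>
    dist (\<alpha>, z) (\<beta>, w) < \<delta> \<Longrightarrow> norm (phi2 \<alpha> z - phi2 \<beta> w) < \<epsilon>"
    using phi2_uniformly_continuous[OF \<rho>(2), of \<epsilon>] by (auto simp: \<epsilon>_def)
  obtain V :: "complex set" and s where V: "finite V" "V \<subseteq> cball 0 \<rho>" and s: "s \<in> borel_measurable borel"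
    "\<And>w. w \<in> cball 0 \<rho> \<Longrightarrow> s w \<in> V \<and> dist (s w) w < \<delta>"
    using finite_quantization[OF compact_cball \<delta>(1)] by blast
  define \<sigma> where "\<sigma> = (\<lambda>w. s (complex_of_real \<rho> * w))"
  have \<sigma>V: "\<sigma> w \<in> V" "dist (\<sigma> w) (complex_of_real \<rho> * w) < \<delta>" "norm (complex_of_real \<rho> * w) \<le> \<rho>" if "w \<in> unit_disk" for w
  proof -
    show "norm (complex_of_real \<rho> * w) \<le> \<rho>" using that \<rho> by (simp add: norm_mult mult_left_le)
    then show "\<sigma> w \<in> V" "dist (\<sigma> w) (complex_of_real \<rho> * w) < \<delta>" using s(2)[of "complex_of_real \<rho> * w"] by (auto simp: \<sigma>_def)
  qed
  have V1: "norm v \<le> 1" if "v \<in> V" for v using V that \<rho> by (force dest: subsetD)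
  have \<sigma>m: "\<sigma> \<in> borel_measurable disk_measure"
  proof -
    have "(\<lambda>w. complex_of_real \<rho> * w) \<in> borel_measurable disk_measure"
      by (intro borel_measurable_disk continuous_intros)
    then show ?thesis unfolding \<sigma>_def by (rule measurable_compose) (rule s(1))
  qed
  define I where "I = (\<lambda>v w. indicator {v} (\<sigma> w) :: real)"
  have Im: "I v \<in> borel_measurable disk_measure" for v
    unfolding I_def by (rule measurable_compose[OF \<sigma>m]) measurable
  have HI: "integrable disk_measure (\<lambda>w. I v w *\<^sub>R H w)" for v
    by (rule Bochner_Integration.integrable_bound[OF H(1)])
       (use Im H(1) in \<open>auto simp: I_def indicator_def intro!: borel_measurable_scaleR\<close>)
  have sumI: "(\<Sum>v\<in>V. I v w *\<^sub>R k v) = k (\<sigma> w)" if "w \<in> unit_disk" for w and k :: "complex \<Rightarrow> 'b::real_vector"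
  proof -
    have "(\<Sum>v\<in>V. I v w *\<^sub>R k v) = (\<Sum>v\<in>V. if v = \<sigma> w then k v else 0)"
      by (intro sum.cong) (auto simp: I_def)
    then show ?thesis using V(1) \<sigma>V[OF that] by (simp add: sum.delta)
  qed
  \<comment> \<open>The coefficient of the net point \<open>v\<close> is the integral of
    \<open>H\<close> over the cell of those w that are moved to \<open>v\<close>.\<close>
  define c where "c = (\<lambda>v. LINT w|disk_measure. I v w *\<^sub>R H w)"
  have c_sum: "(\<Sum>v\<in>V. norm (c v)) \<le> 264 * t"
  proof -
    have "(\<Sum>v\<in>V. norm (c v)) \<le> (\<Sum>v\<in>V. LINT w|disk_measure. norm (I v w *\<^sub>R H w))"
      unfolding c_def by (intro sum_mono integral_norm_bound)
    also have "\<dots> = (LINT w|disk_measure. (\<Sum>v\<in>V. norm (I v w *\<^sub>R H w)))"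
      by (intro Bochner_Integration.integral_sum[symmetric] integrable_norm HI)
    also have "\<dots> = (LINT w|disk_measure. norm (H w))"
    proof (intro Bochner_Integration.integral_cong refl)
      fix w assume "w \<in> space disk_measure"
      then show "(\<Sum>v\<in>V. norm (I v w *\<^sub>R H w)) = norm (H w)"
        using sumI[of w "\<lambda>_. norm (H w)"] by (simp add: I_def)
    qed
    finally show ?thesis using H(2) by simp
  qed
  define S0 where "S0 = (\<Sum>v\<in>V. scaleC_mm (c v) (mobius_mm v))"
  have S0: "eval_mm S0 z = (\<Sum>v\<in>V. c v * phi v z)" if "z \<in> unit_disk" for z
    using that V1 by (simp add: S0_def eval_mm_sum eval_mobius_mm)
  have nS0: "norm S0 \<le> 264 * t"
  proof -
    have "norm S0 \<le> (\<Sum>v\<in>V. norm (c v) * 1)"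
      unfolding S0_def using V1 by (intro sum_norm_le) (auto simp: norm_scaleC_mm norm_mobius_mm_le mult_left_le)
    then show ?thesis using c_sum by simp
  qed
  define p where "p = (\<Sum>v\<in>V. c v * phi1 v 0)"
  have np: "norm p \<le> 264 * t"
  proof -
    have "norm p \<le> (\<Sum>v\<in>V. norm (c v) * 1)"
      unfolding p_def
    proof (rule sum_norm_le)
      fix v assume "v \<in> V"
      then have "(norm v)\<^sup>2 \<le> 1" using V1 by (simp add: power_le_one)
      then have "norm (phi1 v 0) \<le> 1" unfolding phi1_def by (simp del: of_real_diff add: norm_of_real)
      then show "norm (c v * phi1 v 0) \<le> norm (c v) * 1" unfolding norm_mult by (intro mult_left_mono) auto
    qed
    then show ?thesis using c_sum by simp
  qed
  \<comment> \<open>Parameter 1 gives the constant 1, and parameter 0 gives -z, hence the positive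
    sign of \<open>p\<close>. Neither affects the second derivative.\<close>
  define S where "S = S0 + scaleC_mm (- eval_mm S0 0) (mobius_mm 1) + scaleC_mm p (mobius_mm 0)"
  have S: "eval_mm S z = (\<Sum>v\<in>V. c v * phi v z) - eval_mm S0 0 - p * z" if "z \<in> unit_disk" for z
    using that by (simp add: S_def eval_mobius_0_1 S0)
  have d1: "(eval_mm S has_field_derivative (\<Sum>v\<in>V. c v * phi1 v z) - p) (at z)" if z: "z \<in> unit_disk" for z
  proof (rule has_field_derivative_disk_transform[OF _ z S])
    have "((\<lambda>z. \<Sum>v\<in>V. c v * phi v z) has_field_derivative (\<Sum>v\<in>V. c v * phi1 v z)) (at z)"
      using z V1 by (intro DERIV_sum DERIV_cmult phi_DERIV) auto
    then have "((\<lambda>z. (\<Sum>v\<in>V. c v * phi v z) - eval_mm S0 0 - p * z) has_field_derivative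
        (\<Sum>v\<in>V. c v * phi1 v z) - 0 - p * 1) (at z)"
      by (intro DERIV_diff DERIV_const DERIV_cmult DERIV_ident)
    then show "((\<lambda>z. (\<Sum>v\<in>V. c v * phi v z) - eval_mm S0 0 - p * z) has_field_derivative
        (\<Sum>v\<in>V. c v * phi1 v z) - p) (at z)" by simp
  qed
  have d2: "((\<lambda>z. (\<Sum>v\<in>V. c v * phi1 v z) - p) has_field_derivative (\<Sum>v\<in>V. c v * phi2 v z)) (at z)"
    if z: "z \<in> unit_disk" for z
  proof -
    have "((\<lambda>z. (\<Sum>v\<in>V. c v * phi1 v z) - p) has_field_derivative (\<Sum>v\<in>V. c v * phi2 v z) - 0) (at z)"
      using z V1 by (intro DERIV_diff DERIV_const DERIV_sum DERIV_cmult phi1_DERIV) auto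
    then show ?thesis by simp
  qed
  have S2: "(deriv ^^ 2) (eval_mm S) z = (\<Sum>v\<in>V. c v * phi2 v z)" if "z \<in> unit_disk" for z
    by (rule deriv2_eqI[OF d1 d2 open_ball that])
  have err: "norm (complex_of_real (\<rho> ^ 4) * g (complex_of_real (\<rho>\<^sup>2) * z) - (\<Sum>v\<in>V. c v * phi2 v z)) \<le> t / 4" if z: "z \<in> unit_disk" for z
  proof -
    have phi2m: "(\<lambda>w. phi2 (complex_of_real \<rho> * w) z) \<in> borel_measurable disk_measure"
    proof (rule borel_measurable_disk)
      have "1 - cnj (complex_of_real \<rho> * w) * z \<noteq> 0" if "w \<in> unit_disk" for w
        using z \<sigma>V(3)[OF that] \<rho> by (intro phi_denom_nonzero) auto
      then show "continuous_on unit_disk (\<lambda>w. phi2 (complex_of_real \<rho> * w) z)"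
        unfolding phi2_def by (intro continuous_intros) auto
    qed
    have i2: "integrable disk_measure (\<lambda>w. \<Sum>v\<in>V. I v w *\<^sub>R H w * phi2 v z)"
      by (intro Bochner_Integration.integrable_sum integrable_mult_left HI)
    have e2: "(\<Sum>v\<in>V. I v w *\<^sub>R H w * phi2 v z) = H w * phi2 (\<sigma> w) z" if "w \<in> unit_disk" for w
      using sumI[OF that, of "\<lambda>v. H w * phi2 v z"] by (simp add: mult.assoc)
    have phi2_bd: "norm (phi2 (complex_of_real \<rho> * w) z - phi2 (\<sigma> w) z) \<le> \<epsilon>" if "w \<in> unit_disk" for w
      using \<delta>(2)[of "complex_of_real \<rho> * w" "\<sigma> w" z z] \<sigma>V[OF that] V(2) z by (force simp: dist_Pair_Pair dist_commute)
    have i1: "integrable disk_measure (\<lambda>w. H w * (phi2 (complex_of_real \<rho> * w) z - (\<Sum>v\<in>V. I v w *\<^sub>R phi2 v z)))"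
    proof (rule Bochner_Integration.integrable_bound[OF integrable_mult_right[OF H(1), of "complex_of_real \<epsilon>"]])
      show "(\<lambda>w. H w * (phi2 (complex_of_real \<rho> * w) z - (\<Sum>v\<in>V. I v w *\<^sub>R phi2 v z))) \<in> borel_measurable disk_measure"
        by (intro borel_measurable_times borel_measurable_diff phi2m borel_measurable_sum borel_measurable_scaleR Im
             borel_measurable_const borel_measurable_integrable[OF H(1)])
      show "AE w in disk_measure. norm (H w * (phi2 (complex_of_real \<rho> * w) z - (\<Sum>v\<in>V. I v w *\<^sub>R phi2 v z))) \<le> norm (complex_of_real \<epsilon> * H w)"
      proof (rule AE_I2)
        fix w assume "w \<in> space disk_measure"
        then have w: "w \<in> unit_disk" by simp
        have "norm (H w) * norm (phi2 (complex_of_real \<rho> * w) z - phi2 (\<sigma> w) z) \<le> norm (H w) * \<epsilon>"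
          using phi2_bd[OF w] by (intro mult_left_mono) auto
        then show "norm (H w * (phi2 (complex_of_real \<rho> * w) z - (\<Sum>v\<in>V. I v w *\<^sub>R phi2 v z))) \<le> norm (complex_of_real \<epsilon> * H w)"
          by (simp add: norm_mult sumI[OF w] \<epsilon>_def)
      qed
    qed
    have "(\<Sum>v\<in>V. c v * phi2 v z) = (LINT w|disk_measure. (\<Sum>v\<in>V. I v w *\<^sub>R H w * phi2 v z))"
      unfolding c_def
      by (subst Bochner_Integration.integral_sum) (simp_all only: integral_mult_left_zero integrable_mult_left HI)
    also have "\<dots> = (LINT w|disk_measure. H w * phi2 (complex_of_real \<rho> * w) z - H w * (phi2 (complex_of_real \<rho> * w) z - (\<Sum>v\<in>V. I v w *\<^sub>R phi2 v z)))"
      by (intro Bochner_Integration.integral_cong refl) (simp add: e2 sumI algebra_simps)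
    finally have eq: "(\<Sum>v\<in>V. c v * phi2 v z) = \<dots>" .
    have i3: "integrable disk_measure (\<lambda>w. H w * phi2 (complex_of_real \<rho> * w) z)"
    proof -
      have "integrable disk_measure (\<lambda>w. (\<Sum>v\<in>V. I v w *\<^sub>R H w * phi2 v z) + H w * (phi2 (complex_of_real \<rho> * w) z - (\<Sum>v\<in>V. I v w *\<^sub>R phi2 v z)))"
        by (rule Bochner_Integration.integrable_add[OF i2 i1])
      then show ?thesis
        by (rule iffD1[OF Bochner_Integration.integrable_cong[OF refl], rotated]) (simp add: e2 sumI algebra_simps)
    qed
    have "complex_of_real (\<rho> ^ 4) * g (complex_of_real (\<rho>\<^sup>2) * z) - (\<Sum>v\<in>V. c v * phi2 v z)
       = (LINT w|disk_measure. H w * (phi2 (complex_of_real \<rho> * w) z - (\<Sum>v\<in>V. I v w *\<^sub>R phi2 v z)))"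
      unfolding eq Bochner_Integration.integral_diff[OF i3 i1] H(3)[OF z] by simp
    also have "norm \<dots> \<le> (LINT w|disk_measure. norm (H w * (phi2 (complex_of_real \<rho> * w) z - (\<Sum>v\<in>V. I v w *\<^sub>R phi2 v z))))"
      by (rule integral_norm_bound)
    also have "\<dots> \<le> (LINT w|disk_measure. \<epsilon> * norm (H w))"
    proof (intro integral_mono integrable_norm i1 integrable_mult_right H(1))
      fix w assume "w \<in> space disk_measure"
      then have w: "w \<in> unit_disk" by simp
      have "norm (H w) * norm (phi2 (complex_of_real \<rho> * w) z - phi2 (\<sigma> w) z) \<le> norm (H w) * \<epsilon>"
        using phi2_bd[OF w] by (intro mult_left_mono) auto
      then show "norm (H w * (phi2 (complex_of_real \<rho> * w) z - (\<Sum>v\<in>V. I v w *\<^sub>R phi2 v z))) \<le> \<epsilon> * norm (H w)"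
        by (simp add: norm_mult sumI[OF w] mult.commute)
    qed
    also have "\<dots> = \<epsilon> * (LINT w|disk_measure. norm (H w))" by simp
    also have "\<dots> \<le> \<epsilon> * (264 * t)" using H(2) by (intro mult_left_mono) (auto simp: \<epsilon>_def)
    finally show ?thesis by (simp add: \<epsilon>_def)
  qed
  show thesis
  proof (rule that[of S])
    have "norm S \<le> norm S0 + norm (eval_mm S0 0) * 1 + norm p * 1"
      unfolding S_def
      by (intro norm_triangle_mono order_refl) (auto simp: norm_scaleC_mm norm_mobius_mm_le intro!: mult_left_le)
    also have "\<dots> \<le> 264 * t + 264 * t * 1 + 264 * t * 1"
      using nS0 np norm_eval_mm_le[of S0 0] by simp
    finally show "norm S \<le> 792 * t" by simp
    show "eval_mm S 0 = 0" using S[of 0] S0[of 0] by simp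
    show "deriv (eval_mm S) 0 = 0" using DERIV_imp_deriv[OF d1[of 0]] by (simp add: p_def)
    let ?F = "\<lambda>z. complex_of_real (\<rho> ^ 4) * g (complex_of_real (\<rho>\<^sup>2) * z)"
    have Fm: "?F holomorphic_on unit_disk"
    proof -
      have "complex_of_real (\<rho>\<^sup>2) * z \<in> unit_disk" if "z \<in> unit_disk" for z
      proof -
        have "\<rho>\<^sup>2 \<le> 1" using \<rho> by (simp add: power_le_one)
        then have "\<rho>\<^sup>2 * norm z \<le> norm z" by (intro mult_left_le_one_le) auto
        then show ?thesis using that by (simp add: norm_mult norm_power)
      qed
      then show ?thesis by (intro holomorphic_intros holomorphic_on_compose_gen[OF _ g(1), unfolded o_def]) auto
    qed
    have Sm: "(deriv ^^ 2) (eval_mm S) holomorphic_on unit_disk"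
      by (intro holomorphic_higher_deriv eval_mm_holomorphic) auto
    have "disk_norm1 ((deriv ^^ 2) (\<lambda>z. f z - eval_mm S z))
       = disk_norm1 (\<lambda>z. (g z - ?F z) + (?F z - (deriv ^^ 2) (eval_mm S) z))"
      using f by (intro disk_norm1_cong) (simp add: g_def higher_deriv_diff[OF f(1) eval_mm_holomorphic])
    also have "\<dots> \<le> disk_norm1 (\<lambda>z. g z - ?F z) + disk_norm1 (\<lambda>z. ?F z - (deriv ^^ 2) (eval_mm S) z)"
      by (intro disk_norm1_triangle borel_measurable_disk_holomorphic holomorphic_intros g Fm Sm)
    also have "\<dots> \<le> ennreal (t / 4) + ennreal (t / 4)"
    proof (rule add_mono)
      have "disk_norm1 (\<lambda>z. g z - ?F z) = disk_norm1 (\<lambda>z. ?F z - g z)"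
        by (simp add: disk_norm1_def norm_minus_commute)
      then show "disk_norm1 (\<lambda>z. g z - ?F z) \<le> ennreal (t / 4)" using F by simp
      show "disk_norm1 (\<lambda>z. ?F z - (deriv ^^ 2) (eval_mm S) z) \<le> ennreal (t / 4)"
        using t err by (intro disk_norm1_bounded) (auto simp: S2)
    qed
    also have "\<dots> = ennreal (t / 2)" using t by (simp flip: ennreal_plus)
    finally show "disk_norm1 ((deriv ^^ 2) (\<lambda>z. f z - eval_mm S z)) \<le> ennreal (t / 2)" .
  qed
qed

text \<open>The mean value bound controls f'' on the disc of radius |z|; two integrations from 0,
  over lengths below 1, carry the bound to \<open>f\<close>. It makes the errors of the iteration
  tend to 0 pointwise.\<close>

lemma holomorphic_bound_from_deriv2:
  assumes f: "f holomorphic_on unit_disk" "f 0 = 0" "deriv f 0 = 0"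
    and N: "disk_norm1 ((deriv ^^ 2) f) \<le> ennreal t" "t \<ge> 0" and z: "z \<in> unit_disk"
  shows "norm (f z) \<le> 4 * t / (1 - norm z)\<^sup>2"
proof -
  define B where "B = 4 * t / (1 - norm z)\<^sup>2"
  have B0: "B \<ge> 0" using N by (simp add: B_def)
  have sub: "cball 0 (norm z) \<subseteq> unit_disk" using z by auto
  have f': "deriv f holomorphic_on unit_disk" "(deriv ^^ 2) f holomorphic_on unit_disk"
    using f by (auto intro: holomorphic_deriv holomorphic_higher_deriv)
  have D: "(f has_field_derivative deriv f w) (at w)" "(deriv f has_field_derivative (deriv ^^ 2) f w) (at w)"
    if "w \<in> unit_disk" for w
    using holomorphic_derivI[OF f(1) open_ball that] holomorphic_derivI[OF f'(1) open_ball that]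
    by (simp_all add: numeral_2_eq_2)
  have b2: "norm ((deriv ^^ 2) f w) \<le> B" if w: "w \<in> cball 0 (norm z)" for w
  proof -
    have wD: "w \<in> unit_disk" using sub w by blast
    have "ennreal (norm ((deriv ^^ 2) f w) * (1 - norm w)\<^sup>2 / 4) \<le> ennreal t"
      using area_mean_value_bound[OF f'(2) wD] N(1) by (rule order_trans)
    then have "norm ((deriv ^^ 2) f w) * (1 - norm w)\<^sup>2 \<le> 4 * t" using N(2) by (subst (asm) ennreal_le_iff) auto
    moreover have "(1 - norm z)\<^sup>2 \<le> (1 - norm w)\<^sup>2" using w z by (intro power_mono) auto
    then have "norm ((deriv ^^ 2) f w) * (1 - norm z)\<^sup>2 \<le> norm ((deriv ^^ 2) f w) * (1 - norm w)\<^sup>2"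
      by (intro mult_left_mono) auto
    moreover have "(1 - norm z)\<^sup>2 > 0" using z by simp
    ultimately show ?thesis by (simp add: B_def pos_le_divide_eq)
  qed
  have Dw: "(f has_field_derivative deriv f w) (at w within cball 0 (norm z))"
      "(deriv f has_field_derivative (deriv ^^ 2) f w) (at w within cball 0 (norm z))"
    if "w \<in> cball 0 (norm z)" for w
    by (rule has_field_derivative_at_within, rule D, use that sub in blast)+
  have b1: "norm (deriv f w) \<le> B" if w: "w \<in> cball 0 (norm z)" for w
  proof -
    have "norm (deriv f w - deriv f 0) \<le> B * norm (w - 0)"
      by (rule field_differentiable_bound[OF convex_cball Dw(2) b2 w]) auto
    also have "\<dots> \<le> B" using w z B0 by (simp add: mult_left_le)
    finally show ?thesis using f by simp
  qed
  have "norm (f z - f 0) \<le> B * norm (z - 0)"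
    by (rule field_differentiable_bound[OF convex_cball Dw(1) b1]) auto
  also have "\<dots> \<le> B" using z B0 by (simp add: mult_left_le)
  finally show ?thesis using f by (simp add: B_def)
qed

text \<open>The errors \<open>h k\<close> have second derivatives of norm at most t / 2^k, so the
  corrections have geometrically decreasing norms, and their pointwise sum is \<open>f\<close>
  because the errors vanish pointwise.\<close>

lemma min_space_norm_estimate0:
  assumes f: "f holomorphic_on unit_disk" "f 0 = 0" "deriv f 0 = 0"
    and N: "disk_norm1 ((deriv ^^ 2) f) \<le> ennreal t" and t: "t > 0"
  obtains F where "\<And>z. z \<in> unit_disk \<Longrightarrow> eval_mm F z = f z" "norm F \<le> 1586 * t"
proof -
  define P where "P = (\<lambda>k h. h holomorphic_on unit_disk \<and> h 0 = 0 \<and> deriv h 0 = 0 \<and>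
     disk_norm1 ((deriv ^^ 2) h) \<le> ennreal (t / 2 ^ k))"
  define Q where "Q = (\<lambda>k h h'. \<exists>S. norm S \<le> 792 * (t / 2 ^ k) \<and> (h' = (\<lambda>z. h z - eval_mm S z)))"
  have "\<exists>h'. P (Suc k) h' \<and> Q k h h'" if "P k h" for k h
  proof -
    have h: "h holomorphic_on unit_disk" "h 0 = 0" "deriv h 0 = 0"
     "disk_norm1 ((deriv ^^ 2) h) \<le> ennreal (t / 2 ^ k)" using that by (auto simp: P_def)
    have "t / 2 ^ k > 0" using t by simp
    from mobius_approximation_step[OF h(1,4) this] obtain S where S: "norm S \<le> 792 * (t / 2 ^ k)"
      "eval_mm S 0 = 0" "deriv (eval_mm S) 0 = 0"
      "disk_norm1 ((deriv ^^ 2) (\<lambda>z. h z - eval_mm S z)) \<le> ennreal (t / 2 ^ k / 2)" by blast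
    have "deriv (\<lambda>z. h z - eval_mm S z) 0 = 0"
      using h S holomorphic_on_imp_differentiable_at[OF h(1) open_ball, of 0]
        holomorphic_on_imp_differentiable_at[OF eval_mm_holomorphic open_ball, of 0 S]
      by simp
    then show ?thesis
      using h S by (intro exI[of _ "\<lambda>z. h z - eval_mm S z"] conjI)
        (auto simp: P_def Q_def mult.commute intro!: holomorphic_intros eval_mm_holomorphic)
  qed
  moreover have "P 0 f" using f N by (simp add: P_def)
  ultimately obtain h where h: "h 0 = f" "\<And>k. P k (h k)" "\<And>k. Q k (h k) (h (Suc k))"
    using dependent_nat_choice[of "\<lambda>k x. P k x \<and> (k = 0 \<longrightarrow> x = f)" Q] by (metis nat.distinct(1))
  obtain S where S: "\<And>k. norm (S k) \<le> 792 * (t / 2 ^ k)" "\<And>k z. h (Suc k) z = h k z - eval_mm (S k) z"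
    using h(3) unfolding Q_def by metis
  have "(\<lambda>k. 793 * t * (1 / 2) ^ k) sums (793 * t * (1 / (1 - 1 / 2)))"
    by (intro sums_mult geometric_sums) simp
  then have M: "(\<lambda>k. 793 * t * (1 / 2) ^ k) sums (1586 * t)" by simp
  \<comment> \<open>One unit is added to 792 because \<open>mm_suminf\<close> wants strict bounds;
    the geometric sum is then 2 * 793 t = 1586 t.\<close>
  have less: "norm (S k) < 793 * t * (1 / 2) ^ k" for k
  proof -
    have "0 < t / 2 ^ k" using t by simp
    then have "792 * (t / 2 ^ k) < 793 * (t / 2 ^ k)" by (rule mult_strict_right_mono[rotated]) simp
    then show ?thesis using S(1)[of k] by (simp add: power_divide)
  qed
  have lim: "(\<lambda>k. eval_mm (S k) z) sums f z" if z: "z \<in> unit_disk" for z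
  proof -
    have part: "(\<Sum>i<k. eval_mm (S i) z) = f z - h k z" for k
      by (induction k) (auto simp: h(1) S(2))
    have "norm (h k z) \<le> 4 * (t / 2 ^ k) / (1 - norm z)\<^sup>2" for k
      using h(2)[of k] holomorphic_bound_from_deriv2[of "h k" "t / 2 ^ k" z] z t by (auto simp: P_def)
    moreover have "4 * (t / 2 ^ k) / (1 - norm z)\<^sup>2 = 4 * t / (1 - norm z)\<^sup>2 * (1 / 2) ^ k" for k
      by (simp add: power_divide)
    ultimately have le: "\<forall>k. norm (h k z) \<le> 4 * t / (1 - norm z)\<^sup>2 * (1 / 2) ^ k" by simp
    have "(\<lambda>k. 4 * t / (1 - norm z)\<^sup>2 * (1 / 2) ^ k) \<longlonglongrightarrow> 4 * t / (1 - norm z)\<^sup>2 * 0"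
      by (intro tendsto_mult tendsto_const LIMSEQ_power_zero) simp
    then have "(\<lambda>k. 4 * t / (1 - norm z)\<^sup>2 * (1 / 2) ^ k) \<longlonglongrightarrow> 0" by simp
    from Lim_null_comparison[OF always_eventually[OF le] this] have "(\<lambda>k. h k z) \<longlonglongrightarrow> 0" .
    then have "(\<lambda>k. f z - h k z) \<longlonglongrightarrow> f z - 0" by (intro tendsto_diff tendsto_const)
    then show ?thesis by (simp add: sums_def part)
  qed
  obtain F where "\<And>z. z \<in> unit_disk \<Longrightarrow> eval_mm F z = f z" "norm F \<le> (\<Sum>k. 793 * t * (1 / 2) ^ k)"
    using mm_suminf[OF less sums_summable[OF M] f(1) lim] by blast
  then show thesis unfolding sums_unique[OF M, symmetric] by (rule that)
qed

text \<open>The first-order Taylor polynomial at 0 is split off and represented by the atoms with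
  parameters 1 and 0, each of norm at most 1.\<close>

lemma min_space_norm_estimate:
  assumes f: "f holomorphic_on unit_disk"
    and N: "disk_norm1 ((deriv ^^ 2) f) \<le> ennreal t" and t: "t > 0"
  obtains F where "\<And>z. z \<in> unit_disk \<Longrightarrow> eval_mm F z = f z"
    "norm F \<le> norm (f 0) + norm (deriv f 0) + 1586 * t"
proof -
  define h where "h = (\<lambda>z. f z - (f 0 + deriv f 0 * z))"
  have hol: "h holomorphic_on unit_disk" "(\<lambda>z. f 0 + deriv f 0 * z) holomorphic_on unit_disk"
    unfolding h_def using f by (auto intro!: holomorphic_intros)
  have D: "(f has_field_derivative deriv f w) (at w)" if "w \<in> unit_disk" for w
    using holomorphic_derivI[OF f open_ball that] .
  have "(h has_field_derivative deriv f 0 - (0 + deriv f 0 * 1)) (at 0)"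
    unfolding h_def by (intro DERIV_diff D DERIV_add DERIV_const DERIV_cmult DERIV_ident) simp
  then have h0: "deriv h 0 = 0" by (simp add: DERIV_imp_deriv)
  have aff: "(deriv ^^ 2) (\<lambda>z. f 0 + deriv f 0 * z) z = 0" for z
    by (rule deriv2_eqI[where S=UNIV and ?f1.0="\<lambda>_. deriv f 0"]) (auto intro!: derivative_eq_intros)
  have "disk_norm1 ((deriv ^^ 2) h) = disk_norm1 ((deriv ^^ 2) f)"
    unfolding h_def by (rule disk_norm1_cong) (simp add: higher_deriv_diff[OF f hol(2)] aff)
  then obtain G where G: "\<And>z. z \<in> unit_disk \<Longrightarrow> eval_mm G z = h z" "norm G \<le> 1586 * t"
    using min_space_norm_estimate0[OF hol(1) _ h0 _ t] N by (auto simp: h_def)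
  define F where "F = G + scaleC_mm (f 0) (mobius_mm 1) + scaleC_mm (- deriv f 0) (mobius_mm 0)"
  show thesis
  proof (rule that[of F])
    show "eval_mm F z = f z" if "z \<in> unit_disk" for z
      using that G by (simp add: F_def eval_mobius_0_1 h_def)
    have "norm F \<le> norm G + norm (f 0) * 1 + norm (deriv f 0) * 1"
      unfolding F_def
      by (intro norm_triangle_mono order_refl) (auto simp: norm_scaleC_mm norm_mobius_mm_le intro!: mult_left_le)
    then show "norm F \<le> norm (f 0) + norm (deriv f 0) + 1586 * t" using G(2) by simp
  qed
qed



section \<open>Dilations and compact operators\<close>

lemma eval_mm_eqI: "(\<And>z. z \<in> unit_disk \<Longrightarrow> eval_mm F z = eval_mm G z) \<Longrightarrow> F = G"
  by (rule min_mobius_eqI) (metis eval_mm_outside)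

lemma norm_mm_le_deriv2:
  assumes "disk_norm1 ((deriv ^^ 2) (eval_mm F)) \<le> ennreal t" "t > 0"
  shows "norm F \<le> norm (eval_mm F 0) + norm (deriv (eval_mm F) 0) + 1586 * t"
proof -
  obtain G where G: "\<And>z. z \<in> unit_disk \<Longrightarrow> eval_mm G z = eval_mm F z"
    "norm G \<le> norm (eval_mm F 0) + norm (deriv (eval_mm F) 0) + 1586 * t"
    using min_space_norm_estimate[OF eval_mm_holomorphic assms] by blast
  have "G = F" by (rule eval_mm_eqI) (rule G(1))
  then show ?thesis using G(2) by simp
qed

lemma scaled_in_disk:
  assumes "0 \<le> r" "r \<le> 1" "z \<in> unit_disk"
  shows "complex_of_real r * z \<in> unit_disk"
  using assms mult_left_le_one_le[of "norm z" r] by (simp add: norm_mult)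

text \<open>From Cauchy's estimates on discs of radius d, where 1 + d is the midpoint of 1 and 1 /
  r: the summands bound value, derivative and second derivative of a dilated function, the last with
  the factor 1586.\<close>

definition dilation_const :: "real \<Rightarrow> real" where
  "dilation_const r = (let d = (1 / r - 1) / 2 in 1 + 1 / d + 1586 * (2 / d\<^sup>2))"

text \<open>A dilated function is holomorphic up to radius 1 / r, so Cauchy's estimates apply on
  discs about all points of the disk. Only the supremum of \<open>g\<close> enters; this is what
  makes dilations smoothing.\<close>

lemma dilation_in_min_space:
  assumes g: "g holomorphic_on unit_disk" "\<And>z. z \<in> unit_disk \<Longrightarrow> norm (g z) \<le> B"
    and B: "B > 0" and r: "0 < r" "r < 1"
  obtains F where "\<And>z. z \<in> unit_disk \<Longrightarrow> eval_mm F z = g (complex_of_real r * z)"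
    "norm F \<le> dilation_const r * B"
proof -
  define h where "h = (\<lambda>z. g (complex_of_real r * z))"
  define d where "d = (1 / r - 1) / 2"
  have d: "d > 0" "1 + d < 1 / r" using r by (auto simp: d_def field_simps)
  have arg: "complex_of_real r * z \<in> unit_disk" if "z \<in> ball 0 (1 / r)" for z
    using that r by (simp add: norm_mult field_simps)
  have h: "h holomorphic_on ball 0 (1 / r)"
    unfolding h_def using arg
    by (intro holomorphic_on_compose_gen[OF _ g(1), unfolded o_def] holomorphic_intros) auto
  have sub: "cball z d \<subseteq> ball 0 (1 / r)" if "z \<in> unit_disk" for z
  proof
    fix w assume "w \<in> cball z d"
    then have "norm (w - z) \<le> d" by (simp add: dist_norm norm_minus_commute)
    then have "norm w \<le> norm z + d" using norm_triangle_sub[of w z] by simp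
    then show "w \<in> ball 0 (1 / r)" using that d by simp
  qed
  have cauchy: "norm ((deriv ^^ n) h z) \<le> fact n * B / d ^ n" if "z \<in> unit_disk" for n z
  proof (rule Cauchy_inequality)
    show "h holomorphic_on ball z d"
      by (rule holomorphic_on_subset[OF h]) (use sub[OF that] in \<open>auto simp: subset_iff\<close>)
    show "continuous_on (cball z d) h"
      by (rule continuous_on_subset[OF holomorphic_on_imp_continuous_on[OF h] sub[OF that]])
    show "norm (h x) \<le> B" if "norm (z - x) = d" for x
    proof -
      have "x \<in> cball z d" using that by (simp add: dist_norm)
      then have "x \<in> ball 0 (1 / r)" using sub \<open>z \<in> unit_disk\<close> by blast
      then show ?thesis unfolding h_def by (rule g(2)[OF arg])
    qed
  qed (rule d)
  have hD: "h holomorphic_on unit_disk"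
    using d by (intro holomorphic_on_subset[OF h]) auto
  have "disk_norm1 ((deriv ^^ 2) h) \<le> ennreal (2 * B / d\<^sup>2)"
    using cauchy[of _ 2] B d by (intro disk_norm1_bounded) (auto simp: fact_numeral)
  moreover have "2 * B / d\<^sup>2 > 0" using B d by simp
  ultimately obtain F where F: "\<And>z. z \<in> unit_disk \<Longrightarrow> eval_mm F z = h z"
    "norm F \<le> norm (h 0) + norm (deriv h 0) + 1586 * (2 * B / d\<^sup>2)"
    using min_space_norm_estimate[OF hD] by blast
  have "norm (h 0) \<le> B" "norm (deriv h 0) \<le> B / d"
    using cauchy[of 0 0] cauchy[of 0 1] by auto
  then have "norm F \<le> B + B / d + 1586 * (2 * B / d\<^sup>2)" using F(2) by linarith
  also have "\<dots> = dilation_const r * B"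
    by (simp add: dilation_const_def d_def[symmetric] Let_def algebra_simps add_divide_distrib)
  finally have "norm F \<le> dilation_const r * B" .
  from that[OF F(1)[unfolded h_def] this] show thesis .
qed

lemma norm_dilation_le:
  assumes "g holomorphic_on unit_disk" "\<And>z. z \<in> unit_disk \<Longrightarrow> norm (g z) \<le> B" "B > 0" "0 < r" "r < 1"
    and F: "\<And>z. z \<in> unit_disk \<Longrightarrow> eval_mm F z = g (complex_of_real r * z)"
  shows "norm F \<le> dilation_const r * B"
proof -
  obtain G where G: "\<And>z. z \<in> unit_disk \<Longrightarrow> eval_mm G z = g (complex_of_real r * z)"
    "norm G \<le> dilation_const r * B"
    using dilation_in_min_space[OF assms(1-5)] by blast
  have "F = G" by (rule eval_mm_eqI) (simp add: F G(1))
  then show ?thesis using G(2) by simp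
qed

definition dilation_mm :: "real \<Rightarrow> min_mobius \<Rightarrow> min_mobius" where
  "dilation_mm r f = Abs_mm (\<lambda>z. if z \<in> unit_disk then eval_mm f (complex_of_real r * z) else 0)"

lemma eval_dilation_mm:
  assumes r: "0 < r" "r < 1" and z: "z \<in> unit_disk"
  shows "eval_mm (dilation_mm r f) z = eval_mm f (complex_of_real r * z)"
proof -
  have "norm (eval_mm f w) \<le> norm f + 1" for w using norm_eval_mm_le[of f w] by simp
  moreover have "norm f + 1 > 0" using norm_ge_zero[of f] by linarith
  ultimately obtain F where F: "\<And>z. z \<in> unit_disk \<Longrightarrow> eval_mm F z = eval_mm f (complex_of_real r * z)"
    using dilation_in_min_space[OF eval_mm_holomorphic _ _ r, of f "norm f + 1"] by blast
  have "(\<lambda>z. if z \<in> unit_disk then eval_mm f (complex_of_real r * z) else 0) = eval_mm F"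
    using F by (auto simp: fun_eq_iff eval_mm_outside)
  then have "dilation_mm r f = F" by (simp add: dilation_mm_def eval_mm_inverse)
  then show ?thesis using F z by simp
qed

lemma bounded_linear_dilation_mm:
  assumes r: "0 < r" "r < 1"
  shows "bounded_linear (dilation_mm r)"
proof (rule bounded_linear_intro)
  show "dilation_mm r (f + g) = dilation_mm r f + dilation_mm r g" for f g
    by (rule eval_mm_eqI) (simp add: eval_dilation_mm[OF r])
  show "dilation_mm r (c *\<^sub>R f) = c *\<^sub>R dilation_mm r f" for c f
    by (rule eval_mm_eqI) (simp add: eval_dilation_mm[OF r])
  show "norm (dilation_mm r f) \<le> norm f * dilation_const r" for f
  proof (cases "f = 0")
    case True
    then have "dilation_mm r f = 0" by (intro eval_mm_eqI) (simp add: eval_dilation_mm[OF r])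
    then show ?thesis by (simp add: True)
  next
    case False
    then show ?thesis
      using norm_dilation_le[OF eval_mm_holomorphic norm_eval_mm_le, of f r "dilation_mm r f"] r
      by (simp add: eval_dilation_mm mult.commute)
  qed
qed

lemma dilation_mm_scaleC:
  assumes r: "0 < r" "r < 1"
  shows "dilation_mm r (scaleC_mm c f) = scaleC_mm c (dilation_mm r f)"
  by (rule eval_mm_eqI) (simp add: eval_dilation_mm[OF r])

text \<open>Montel's theorem gives a locally uniform limit, which is only known to be holomorphic
  and bounded by 1. The set therefore ranges over all such \<open>g\<close> and not over the unit
  ball of the space, so that it contains its limits.\<close>

lemma compact_dilations:
  assumes r: "0 < r" "r < 1"
  shows "compact {F. \<exists>g. g holomorphic_on unit_disk \<and> (\<forall>z\<in>unit_disk. norm (g z) \<le> 1) \<and>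
     (\<forall>z\<in>unit_disk. eval_mm F z = g (complex_of_real r * z))}" (is "compact ?A")
  unfolding compact_eq_seq_compact_metric seq_compact_def
proof (intro allI impI)
  fix F :: "nat \<Rightarrow> min_mobius" assume "\<forall>n. F n \<in> ?A"
  then have "\<forall>n. \<exists>g. g holomorphic_on unit_disk \<and> (\<forall>z\<in>unit_disk. norm (g z) \<le> 1) \<and>
     (\<forall>z\<in>unit_disk. eval_mm (F n) z = g (complex_of_real r * z))" by simp
  from choice[OF this] obtain g where g: "\<And>n. g n holomorphic_on unit_disk"
    "\<And>n z. z \<in> unit_disk \<Longrightarrow> norm (g n z) \<le> 1"
    "\<And>n z. z \<in> unit_disk \<Longrightarrow> eval_mm (F n) z = g n (complex_of_real r * z)"
    by blast
  obtain G \<sigma> where G: "G holomorphic_on unit_disk" "strict_mono (\<sigma> :: nat \<Rightarrow> nat)"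
    "\<And>x. x \<in> unit_disk \<Longrightarrow> ((\<lambda>n. g (\<sigma> n) x) \<longlongrightarrow> G x) sequentially"
    "\<And>K. compact K \<Longrightarrow> K \<subseteq> unit_disk \<Longrightarrow> uniform_limit K (g \<circ> \<sigma>) G sequentially"
  proof (rule Montel[of unit_disk "range g" g])
    show "\<exists>B. \<forall>h\<in>range g. \<forall>z\<in>K. norm (h z) \<le> B" if "compact K" "K \<subseteq> unit_disk" for K
      using g(2) subsetD[OF that(2)] by (intro exI[of _ 1]) blast
    show "h holomorphic_on unit_disk" if "h \<in> range g" for h using that g(1) by blast
  qed simp_all
  have G1: "norm (G z) \<le> 1" if "z \<in> unit_disk" for z
    using tendsto_norm[OF G(3)[OF that]] by (rule tendsto_upperbound) (use g(2)[OF that] in auto)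
  obtain L where L: "\<And>z. z \<in> unit_disk \<Longrightarrow> eval_mm L z = G (complex_of_real r * z)"
    using dilation_in_min_space[OF G(1) G1 zero_less_one r] by blast
  \<comment> \<open>The dilation by \<open>r\<close> is done in two steps by its square root. The
    first maps the disk into a compact subset, where the convergence is uniform; the second turns a
    small supremum into a small norm.\<close>
  define q where "q = sqrt r"
  have q: "0 < q" "q < 1" "q * q = r" using r by (auto simp: q_def real_sqrt_lt_1_iff)
  have "(F \<circ> \<sigma>) \<longlonglongrightarrow> L"
  proof (rule LIMSEQ_I)
    fix e :: real assume e: "e > 0"
    define D where "D = \<bar>dilation_const q\<bar> + 1"
    have D: "D > 0" "dilation_const q \<le> D" by (auto simp: D_def)
    define b where "b = e / (2 * D)"
    have b: "b > 0" using e D by (simp add: b_def)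
    have "uniform_limit (cball 0 q) (g \<circ> \<sigma>) G sequentially"
      using q by (intro G(4)) auto
    then have "\<forall>\<^sub>F n in sequentially. \<forall>z\<in>cball 0 q. dist ((g \<circ> \<sigma>) n z) (G z) < b"
      by (rule uniform_limitD[OF _ b])
    then obtain n0 where n0: "\<And>n z. n \<ge> n0 \<Longrightarrow> z \<in> cball 0 q \<Longrightarrow> dist (g (\<sigma> n) z) (G z) < b"
      unfolding eventually_sequentially o_def by blast
    show "\<exists>n0. \<forall>n\<ge>n0. norm ((F \<circ> \<sigma>) n - L) < e"
    proof (intro exI allI impI)
      fix n assume n: "n \<ge> n0"
      let ?u = "\<lambda>z. g (\<sigma> n) (complex_of_real q * z) - G (complex_of_real q * z)"
      have qz: "complex_of_real q * z \<in> unit_disk" "complex_of_real q * z \<in> cball 0 q" if "z \<in> unit_disk" for z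
        using scaled_in_disk[of q z] q that mult_left_le[of "norm z" q] by (auto simp: norm_mult)
      have "norm (F (\<sigma> n) - L) \<le> dilation_const q * b"
      proof (rule norm_dilation_le[where g = ?u])
        show "?u holomorphic_on unit_disk"
          using qz by (intro holomorphic_intros holomorphic_on_compose_gen[OF _ g(1), unfolded o_def]
            holomorphic_on_compose_gen[OF _ G(1), unfolded o_def]) auto
        show "norm (?u z) \<le> b" if "z \<in> unit_disk" for z
          using n0[OF n qz(2)[OF that]] by (simp add: dist_norm)
        show "eval_mm (F (\<sigma> n) - L) z = ?u (complex_of_real q * z)" if "z \<in> unit_disk" for z
          using that q(3) by (simp add: g(3) L mult.assoc[symmetric] of_real_mult[symmetric] del: of_real_mult)
      qed (use q b in auto)
      also have "\<dots> \<le> D * b" using b D by (intro mult_right_mono) auto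
      also have "\<dots> = e / 2" using D by (simp add: b_def)
      also have "\<dots> < e" using e by simp
      finally show "norm ((F \<circ> \<sigma>) n - L) < e" by simp
    qed
  qed
  moreover have "L \<in> ?A" using G(1) G1 L by blast
  ultimately show "\<exists>l\<in>?A. \<exists>r. strict_mono r \<and> (F \<circ> r) \<longlonglongrightarrow> l" using G(2) by blast
qed

lemma comp_op_scaleC:
  assumes "bounded_comp_op \<psi>"
  shows "comp_op \<psi> (scaleC_mm c f) = scaleC_mm c (comp_op \<psi> f)"
  by (rule eval_mm_eqI) (simp add: eval_comp_op[OF assms])

lemma bounded_linear_comp_op: "bounded_comp_op \<psi> \<Longrightarrow> bounded_linear (comp_op \<psi>)"
  by (simp add: bounded_comp_op_def)

lemma compact_op_comp_dilation:
  assumes \<psi>: "bounded_comp_op \<psi>" and r: "0 < r" "r < 1"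
  shows "compact_op (\<lambda>f. comp_op \<psi> (dilation_mm r f))"
  unfolding compact_op_def
proof
  have l: "bounded_linear (\<lambda>f. comp_op \<psi> (dilation_mm r f))"
    by (rule bounded_linear_compose[OF bounded_linear_comp_op[OF \<psi>] bounded_linear_dilation_mm[OF r]])
  show "Vector_Spaces.linear scaleC_mm scaleC_mm (\<lambda>f. comp_op \<psi> (dilation_mm r f))"
    by unfold_locales
      (simp_all add: linear_add[OF bounded_linear.linear[OF l]] dilation_mm_scaleC[OF r] comp_op_scaleC[OF \<psi>])
  let ?A = "{F. \<exists>g. g holomorphic_on unit_disk \<and> (\<forall>z\<in>unit_disk. norm (g z) \<le> 1) \<and>
     (\<forall>z\<in>unit_disk. eval_mm F z = g (complex_of_real r * z))}"
  have c: "compact (comp_op \<psi> ` ?A)"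
    by (intro compact_continuous_image compact_dilations r linear_continuous_on bounded_linear_comp_op \<psi>)
  have "(\<lambda>f. comp_op \<psi> (dilation_mm r f)) ` cball 0 1 \<subseteq> comp_op \<psi> ` ?A"
  proof (intro image_subsetI imageI CollectI exI conjI ballI)
    fix f :: min_mobius and z assume "f \<in> cball 0 1" "z \<in> unit_disk"
    then show "norm (eval_mm f z) \<le> 1" using norm_eval_mm_le[of f z] by simp
  qed (auto simp: eval_dilation_mm[OF r] eval_mm_holomorphic)
  then have "closure ((\<lambda>f. comp_op \<psi> (dilation_mm r f)) ` cball 0 1) \<subseteq> comp_op \<psi> ` ?A"
    using c by (intro closure_minimal compact_imp_closed)
  then show "compact (closure ((\<lambda>f. comp_op \<psi> (dilation_mm r f)) ` cball 0 1))"
    using closed_Int_compact[OF closed_closure c, of "(\<lambda>f. comp_op \<psi> (dilation_mm r f)) ` cball 0 1"]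
    by (simp only: Int_absorb2)
qed

lemma compact_op_bounded_linear:
  assumes "compact_op K"
  shows "bounded_linear K"
proof -
  interpret K: Vector_Spaces.linear scaleC_mm scaleC_mm K using assms by (simp add: compact_op_def)
  have "bounded (K ` cball 0 1)"
    using assms bounded_subset[OF compact_imp_bounded closure_subset] by (auto simp: compact_op_def)
  then obtain B where B0: "\<forall>x\<in>K ` cball 0 1. norm x \<le> B" by (auto simp: bounded_iff)
  have B: "norm (K f) \<le> B" if "norm f \<le> 1" for f using B0 that by simp
  have s: "K (c *\<^sub>R f) = c *\<^sub>R K f" for c f by (simp add: scaleR_min_mobius_def K.scale)
  show ?thesis
  proof (rule bounded_linear_intro[where K=B])
    show "norm (K f) \<le> norm f * B" for f
    proof (cases "f = 0")
      case False
      have "norm (K (inverse (norm f) *\<^sub>R f)) \<le> B" using False by (intro B) simp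
      then show ?thesis using False by (simp add: s field_simps)
    qed (simp add: K.zero)
  qed (simp_all add: K.add s)
qed

lemma essential_norm_le:
  assumes T: "bounded_linear T" and K: "compact_op K" and le: "\<And>f. norm (T f - K f) \<le> B * norm f" "B \<ge> 0"
  shows "essential_norm T \<le> B"
proof -
  have diff: "bounded_linear (\<lambda>f. T f - K f)" if "compact_op K" for K
    by (intro bounded_linear_sub T compact_op_bounded_linear that)
  have "essential_norm T \<le> onorm (\<lambda>f. T f - K f)"
    unfolding essential_norm_def
    by (rule cInf_lower) (use K diff in \<open>auto intro!: bdd_belowI[of _ 0] onorm_pos_le\<close>)
  also have "\<dots> \<le> B" by (rule onorm_bound[OF le(2,1)])
  finally show ?thesis .
qed



section \<open>Two-sided estimate of the essential norm\<close>

text \<open>These bounds keep the factor 1 - |\<alpha>|^2 and so vanish for fixed \<open>w\<close>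
  as |\<alpha>| tends to 1. The complementary \<open>norm_phi2_le'\<close> is uniform in
  \<open>w\<close> for parameters away from the circle.\<close>

lemma norm_phi1_phi2_le:
  assumes \<alpha>: "norm \<alpha> \<le> 1" and w: "norm w < 1"
  shows norm_phi1_le: "norm (phi1 \<alpha> w) \<le> (1 - (norm \<alpha>)\<^sup>2) / (1 - norm w)\<^sup>2"
    and norm_phi2_le: "norm (phi2 \<alpha> w) \<le> 2 * (1 - (norm \<alpha>)\<^sup>2) / (1 - norm w) ^ 3"
proof -
  have "norm (cnj \<alpha> * w) \<le> norm w" using \<alpha> by (simp add: norm_mult mult_left_le_one_le)
  then have d: "1 - norm w \<le> norm (1 - cnj \<alpha> * w)" using norm_triangle_ineq2[of 1 "cnj \<alpha> * w"] by simp
  have nz: "norm (1 - cnj \<alpha> * w) > 0" using d w by linarith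
  have a: "0 \<le> 1 - (norm \<alpha>)\<^sup>2" using \<alpha> by (simp add: power_le_one)
  have n: "norm (complex_of_real (1 - (norm \<alpha>)\<^sup>2)) = 1 - (norm \<alpha>)\<^sup>2" using a unfolding norm_of_real by simp
  have "norm (phi1 \<alpha> w) = (1 - (norm \<alpha>)\<^sup>2) / norm (1 - cnj \<alpha> * w) ^ 2"
    by (simp only: phi1_def norm_divide norm_minus_cancel n norm_power)
  also have "\<dots> \<le> (1 - (norm \<alpha>)\<^sup>2) / (1 - norm w)\<^sup>2"
    using a d w nz by (intro divide_left_mono power_mono mult_pos_pos) auto
  finally show "norm (phi1 \<alpha> w) \<le> (1 - (norm \<alpha>)\<^sup>2) / (1 - norm w)\<^sup>2" .
  have "norm (phi2 \<alpha> w) = 2 * norm \<alpha> * (1 - (norm \<alpha>)\<^sup>2) / norm (1 - cnj \<alpha> * w) ^ 3"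
    by (simp only: phi2_def norm_divide norm_minus_cancel norm_mult n norm_power complex_mod_cnj norm_numeral)
  also have "\<dots> \<le> 2 * 1 * (1 - (norm \<alpha>)\<^sup>2) / (1 - norm w) ^ 3"
    using a d w nz \<alpha> by (intro frac_le mult_mono power_mono) auto
  finally show "norm (phi2 \<alpha> w) \<le> 2 * (1 - (norm \<alpha>)\<^sup>2) / (1 - norm w) ^ 3" by simp
qed

lemma norm_phi2_le':
  assumes "norm \<alpha> \<le> s" "s < 1" "norm w < 1"
  shows "norm (phi2 \<alpha> w) \<le> 2 / (1 - s) ^ 3"
proof -
  have d: "1 - s \<le> norm (1 - cnj \<alpha> * w)" using norm_denom_ge[of \<alpha> w] assms by simp
  have "(norm \<alpha>)\<^sup>2 \<le> 1" using assms by (simp add: power_le_one)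
  then have n: "norm (complex_of_real (1 - (norm \<alpha>)\<^sup>2)) \<le> 1" unfolding norm_of_real by simp
  have "norm (phi2 \<alpha> w) = 2 * norm \<alpha> * norm (complex_of_real (1 - (norm \<alpha>)\<^sup>2)) / norm (1 - cnj \<alpha> * w) ^ 3"
    by (simp only: phi2_def norm_divide norm_minus_cancel norm_mult norm_power complex_mod_cnj norm_numeral)
  also have "\<dots> \<le> 2 * 1 * 1 / (1 - s) ^ 3"
    using n d assms by (intro frac_le mult_mono power_mono) auto
  finally show ?thesis by simp
qed

lemma phi_alt:
  assumes "norm \<alpha> \<le> 1" "norm z < 1"
  shows "phi \<alpha> z = \<alpha> - complex_of_real (1 - (norm \<alpha>)\<^sup>2) * z / (1 - cnj \<alpha> * z)"
proof -
  have nz: "1 - cnj \<alpha> * z \<noteq> 0" by (rule phi_denom_nonzero[OF assms])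
  have n: "complex_of_real (1 - (norm \<alpha>)\<^sup>2) = 1 - \<alpha> * cnj \<alpha>" by (simp only: of_real_diff of_real_1 complex_norm_square)
  show ?thesis using nz unfolding phi_def n by (simp add: divide_eq_eq eq_divide_eq diff_divide_eq_iff algebra_simps)
qed

text \<open>In the form of \<open>phi_alt\<close>, replacing z by r z produces the denominator of
  the atom with parameter r \<alpha>; only constants differ, and \<open>c\<close> is the quotient of
  the two numerators. It is at most 1 because r |\<alpha>| \<le> |\<alpha>|.\<close>

lemma phi_dilate:
  assumes \<alpha>: "norm \<alpha> < 1" and z: "norm z < 1" and r: "0 < r" "r < 1"
  defines "c \<equiv> (1 - (norm \<alpha>)\<^sup>2) / (1 - r\<^sup>2 * (norm \<alpha>)\<^sup>2)"
  shows "phi \<alpha> (complex_of_real r * z) = \<alpha> + complex_of_real (r * c) * (phi (complex_of_real r * \<alpha>) z - complex_of_real r * \<alpha>)"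
    and "0 \<le> c" "c \<le> 1"
proof -
  have "r\<^sup>2 \<le> 1" using r by (simp add: power_le_one)
  then have le: "r\<^sup>2 * (norm \<alpha>)\<^sup>2 \<le> (norm \<alpha>)\<^sup>2" by (intro mult_left_le_one_le) auto
  moreover have a: "(norm \<alpha>)\<^sup>2 < 1" using \<alpha> by (simp add: power_less_one_iff)
  ultimately have D: "1 - r\<^sup>2 * (norm \<alpha>)\<^sup>2 > 0" by linarith
  show "0 \<le> c" "c \<le> 1" using a le D by (auto simp: c_def)
  have ra: "norm (complex_of_real r * \<alpha>) < 1" "norm (complex_of_real r * z) < 1"
    using scaled_in_disk[of r \<alpha>] scaled_in_disk[of r z] r \<alpha> z by auto
  have n: "(norm (complex_of_real r * \<alpha>))\<^sup>2 = r\<^sup>2 * (norm \<alpha>)\<^sup>2" using r by (simp add: norm_mult power_mult_distrib)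
  have e: "cnj (complex_of_real r * \<alpha>) * z = cnj \<alpha> * (complex_of_real r * z)" by simp
  have "complex_of_real c * complex_of_real (1 - r\<^sup>2 * (norm \<alpha>)\<^sup>2) = complex_of_real (1 - (norm \<alpha>)\<^sup>2)"
    unfolding of_real_mult[symmetric] c_def using D by simp
  then have k: "complex_of_real (r * c) * (complex_of_real (1 - r\<^sup>2 * (norm \<alpha>)\<^sup>2) * z / W)
     = complex_of_real (1 - (norm \<alpha>)\<^sup>2) * (complex_of_real r * z) / W" for W
    by (metis (no_types, lifting) mult.assoc mult.left_commute of_real_mult times_divide_eq_right)
  let ?W = "1 - cnj \<alpha> * (complex_of_real r * z)"
  have 1: "phi \<alpha> (complex_of_real r * z) = \<alpha> - complex_of_real (1 - (norm \<alpha>)\<^sup>2) * (complex_of_real r * z) / ?W"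
    by (rule phi_alt[OF less_imp_le[OF \<alpha>] ra(2)])
  have 2: "phi (complex_of_real r * \<alpha>) z - complex_of_real r * \<alpha> = - (complex_of_real (1 - r\<^sup>2 * (norm \<alpha>)\<^sup>2) * z / ?W)"
    unfolding phi_alt[OF less_imp_le[OF ra(1)] z] n e by simp
  show "phi \<alpha> (complex_of_real r * z) = \<alpha> + complex_of_real (r * c) * (phi (complex_of_real r * \<alpha>) z - complex_of_real r * \<alpha>)"
    unfolding 1 2 mult_minus_right k by (rule diff_conv_add_uminus)
qed

section \<open>Composition of atoms with a self-map of the disk\<close>

locale disk_self_map =
  fixes \<psi> :: "complex \<Rightarrow> complex"
  assumes hol: "\<psi> holomorphic_on unit_disk" and maps: "\<psi> ` unit_disk \<subseteq> unit_disk"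
begin

lemma norm_map: "norm z < 1 \<Longrightarrow> norm (\<psi> z) < 1"
  using maps by (auto simp: image_subset_iff)

lemma map_DERIV: "norm z < 1 \<Longrightarrow> (\<psi> has_field_derivative deriv \<psi> z) (at z)"
  using holomorphic_derivI[OF hol open_ball] by simp

lemma deriv_map_DERIV: "norm z < 1 \<Longrightarrow> (deriv \<psi> has_field_derivative deriv (deriv \<psi>) z) (at z)"
  using holomorphic_derivI[OF holomorphic_deriv[OF hol open_ball] open_ball] by simp

lemma phi_comp_holomorphic:
  assumes "norm \<alpha> \<le> 1"
  shows "(phi \<alpha> \<circ> \<psi>) holomorphic_on unit_disk"
  using holomorphic_on_compose_gen[OF hol phi_holomorphic[OF assms] maps] .

lemma phi_comp_DERIV:
  assumes "norm \<alpha> \<le> 1" "norm z < 1"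
  shows "(phi \<alpha> \<circ> \<psi> has_field_derivative phi1 \<alpha> (\<psi> z) * deriv \<psi> z) (at z)"
  using DERIV_chain[OF phi_DERIV[OF assms(1) norm_map] map_DERIV] assms(2) by blast

lemma phi_comp_deriv2:
  assumes "norm \<alpha> \<le> 1" "norm z < 1"
  shows "(deriv ^^ 2) (phi \<alpha> \<circ> \<psi>) z = phi2 \<alpha> (\<psi> z) * (deriv \<psi> z)\<^sup>2 + phi1 \<alpha> (\<psi> z) * deriv (deriv \<psi>) z"
proof (rule deriv2_eqI[where S=unit_disk and ?f1.0="\<lambda>z. phi1 \<alpha> (\<psi> z) * deriv \<psi> z"])
  fix w :: complex assume "w \<in> unit_disk"
  then have w: "norm w < 1" by simp
  show "(phi \<alpha> \<circ> \<psi> has_field_derivative phi1 \<alpha> (\<psi> w) * deriv \<psi> w) (at w)"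
    by (rule phi_comp_DERIV[OF assms(1) w])
  have "((\<lambda>z. phi1 \<alpha> (\<psi> z)) has_field_derivative phi2 \<alpha> (\<psi> w) * deriv \<psi> w) (at w)"
    by (rule DERIV_chain2[OF phi1_DERIV[OF assms(1) norm_map[OF w]] map_DERIV[OF w]])
  from DERIV_mult[OF this deriv_map_DERIV[OF w]]
  show "((\<lambda>z. phi1 \<alpha> (\<psi> z) * deriv \<psi> z) has_field_derivative
     phi2 \<alpha> (\<psi> w) * (deriv \<psi> w)\<^sup>2 + phi1 \<alpha> (\<psi> w) * deriv (deriv \<psi>) w) (at w)"
    by (simp add: power2_eq_square mult_ac add.commute)
qed (use assms in auto)

lemma phi_comp_tail:
  assumes "s < norm \<alpha>" "norm \<alpha> < 1"
  shows "disk_norm1 ((deriv ^^ 2) (phi \<alpha> \<circ> \<psi>)) \<le> tail_sup \<psi> s"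
  unfolding tail_sup_def using assms by (intro SUP_upper) auto

text \<open>For parameters away from the circle. The second derivative of the difference is
  \<open>phi2 \<alpha>\<close> at z minus r^2 times its value at r z, bounded by \<eta> for the
  change of argument and \<eta> for the factor. The value at 0 cancels, and the derivative there is
  1 - r times that of the atom.\<close>

lemma norm_dilation_difference:
  assumes \<alpha>: "norm \<alpha> \<le> s" "s < 1" and r: "0 < r" "r < 1" and \<eta>: "\<eta> > 0"
    and near: "\<And>z. z \<in> unit_disk \<Longrightarrow> norm (phi2 \<alpha> z - phi2 \<alpha> (complex_of_real r * z)) \<le> \<eta>"
    and small: "2 * (1 - r) * (2 / (1 - s) ^ 3) \<le> \<eta>"
  shows "norm (mobius_mm \<alpha> - dilation_mm r (mobius_mm \<alpha>)) \<le> (1 - r) + 1586 * (2 * \<eta>)"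
proof -
  let ?F = "mobius_mm \<alpha> - dilation_mm r (mobius_mm \<alpha>)"
  have \<alpha>1: "norm \<alpha> \<le> 1" using \<alpha> by simp
  have rz: "norm (complex_of_real r * z) < 1" if "z \<in> unit_disk" for z
    using scaled_in_disk[of r z] r that by auto
  have F: "eval_mm ?F z = phi \<alpha> z - phi \<alpha> (complex_of_real r * z)" if "z \<in> unit_disk" for z
    using that rz[OF that] by (simp add: eval_dilation_mm[OF r] eval_mobius_mm[OF \<alpha>1])
  have chain: "((\<lambda>z. phi \<alpha> (complex_of_real r * z)) has_field_derivative phi1 \<alpha> (complex_of_real r * z) * complex_of_real r) (at z)"
    "((\<lambda>z. phi1 \<alpha> (complex_of_real r * z)) has_field_derivative phi2 \<alpha> (complex_of_real r * z) * complex_of_real r) (at z)"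
    if z: "z \<in> unit_disk" for z
    by (rule DERIV_chain2[where g="\<lambda>z. complex_of_real r * z", OF phi_DERIV[OF \<alpha>1 rz[OF z]] DERIV_cmult_Id]
          DERIV_chain2[where g="\<lambda>z. complex_of_real r * z", OF phi1_DERIV[OF \<alpha>1 rz[OF z]] DERIV_cmult_Id])+
  have d1: "(eval_mm ?F has_field_derivative phi1 \<alpha> z - phi1 \<alpha> (complex_of_real r * z) * complex_of_real r) (at z)"
    if z: "z \<in> unit_disk" for z
  proof (rule has_field_derivative_disk_transform[OF _ z F])
    show "((\<lambda>z. phi \<alpha> z - phi \<alpha> (complex_of_real r * z)) has_field_derivative
       phi1 \<alpha> z - phi1 \<alpha> (complex_of_real r * z) * complex_of_real r) (at z)"
      using z by (intro DERIV_diff phi_DERIV \<alpha>1 chain(1)) auto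
  qed
  have d2: "((\<lambda>z. phi1 \<alpha> z - phi1 \<alpha> (complex_of_real r * z) * complex_of_real r) has_field_derivative
       phi2 \<alpha> z - phi2 \<alpha> (complex_of_real r * z) * complex_of_real r * complex_of_real r) (at z)"
    if z: "z \<in> unit_disk" for z
    using z by (intro DERIV_diff phi1_DERIV DERIV_cmult_right \<alpha>1 chain(2)) auto
  have "norm ((deriv ^^ 2) (eval_mm ?F) z) \<le> 2 * \<eta>" if z: "z \<in> unit_disk" for z
  proof -
    let ?p = "phi2 \<alpha> (complex_of_real r * z)"
    have "(deriv ^^ 2) (eval_mm ?F) z = phi2 \<alpha> z - ?p * complex_of_real r * complex_of_real r"
      by (rule deriv2_eqI[OF d1 d2 open_ball z])
    also have "\<dots> = (phi2 \<alpha> z - ?p) + complex_of_real (1 - r * r) * ?p"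
      by (simp add: algebra_simps)
    also have "norm \<dots> \<le> norm (phi2 \<alpha> z - ?p) + norm (complex_of_real (1 - r * r) * ?p)" by (rule norm_triangle_ineq)
    also have "norm (complex_of_real (1 - r * r) * ?p) = (1 - r * r) * norm ?p"
      using r mult_le_one[of r r] unfolding norm_mult norm_of_real by simp
    also have "(1 - r * r) * norm ?p \<le> 2 * (1 - r) * (2 / (1 - s) ^ 3)"
    proof (rule mult_mono)
      have "1 - r * r = (1 + r) * (1 - r)" by (simp add: algebra_simps)
      also have "\<dots> \<le> 2 * (1 - r)" using r by (intro mult_right_mono) auto
      finally show "1 - r * r \<le> 2 * (1 - r)" .
      show "norm ?p \<le> 2 / (1 - s) ^ 3" by (rule norm_phi2_le'[OF \<alpha> rz[OF z]])
    qed (use r in auto)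
    also have "norm (phi2 \<alpha> z - ?p) + 2 * (1 - r) * (2 / (1 - s) ^ 3) \<le> \<eta> + \<eta>"
      by (rule add_mono[OF near[OF z] small])
    finally show ?thesis by (simp only: mult_2)
  qed
  then have "disk_norm1 ((deriv ^^ 2) (eval_mm ?F)) \<le> ennreal (2 * \<eta>)"
    using \<eta> by (intro disk_norm1_bounded) auto
  then have "norm ?F \<le> norm (eval_mm ?F 0) + norm (deriv (eval_mm ?F) 0) + 1586 * (2 * \<eta>)"
    using \<eta> by (intro norm_mm_le_deriv2) auto
  moreover have "eval_mm ?F 0 = 0" using F[of 0] by simp
  moreover have "norm (deriv (eval_mm ?F) 0) \<le> 1 - r"
  proof -
    have "deriv (eval_mm ?F) 0 = phi1 \<alpha> 0 * complex_of_real (1 - r)"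
      using DERIV_imp_deriv[OF d1[of 0]] by (simp add: algebra_simps)
    moreover have "norm (phi1 \<alpha> 0) \<le> 1"
    proof -
      have "norm (phi1 \<alpha> 0) \<le> 1 - (norm \<alpha>)\<^sup>2" using norm_phi1_le[OF \<alpha>1, of 0] by simp
      also have "\<dots> \<le> 1" by simp
      finally show ?thesis .
    qed
    ultimately show ?thesis using r unfolding norm_mult \<open>deriv (eval_mm ?F) 0 = _\<close> norm_of_real
      by (simp add: mult_left_le_one_le)
  qed
  ultimately show ?thesis by simp
qed

end

section \<open>Upper bound for the essential norm\<close>

locale bounded_composition = disk_self_map +
  assumes bounded: "bounded_comp_op \<psi>"
begin

lemma bounded_linear_comp: "bounded_linear (comp_op \<psi>)" by (rule bounded_linear_comp_op[OF bounded])

text \<open>For parameters near the circle. By \<open>phi_dilate\<close> the second derivative is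
  that of the composed atom for \<alpha> minus at most one times that for r \<alpha>; both
  parameters lie beyond \<open>s\<close>, whence 2 \<tau>. The dependence on \<psi>(0) and
  \<psi>'(0) is confined to terms with the factor 1 - r.\<close>

lemma norm_comp_dilation_difference:
  assumes \<alpha>: "s < r * norm \<alpha>" "0 \<le> s" "norm \<alpha> < 1" and r: "0 < r" "r < 1"
    and \<tau>: "tail_sup \<psi> s \<le> ennreal \<tau>" "\<tau> \<ge> 0" and \<epsilon>: "\<epsilon> > 0"
  defines "\<beta> \<equiv> 1 - norm (\<psi> 0)"
  shows "norm (comp_op \<psi> (mobius_mm \<alpha> - dilation_mm r (mobius_mm \<alpha>)))
    \<le> (1 - r) * (1 / \<beta>\<^sup>2 + (2 / \<beta> ^ 3 + 1 / \<beta>\<^sup>2) * norm (deriv \<psi> 0)) + 1586 * (2 * \<tau> + \<epsilon>)"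
proof -
  let ?G = "comp_op \<psi> (mobius_mm \<alpha> - dilation_mm r (mobius_mm \<alpha>))"
  define b where "b = \<psi> 0"
  have b: "norm b < 1" unfolding b_def by (rule norm_map) simp
  have \<beta>: "\<beta> > 0" using b by (simp add: \<beta>_def b_def)
  have \<alpha>1: "norm \<alpha> \<le> 1" using \<alpha> by simp
  have \<alpha>2: "1 - (norm \<alpha>)\<^sup>2 \<le> 1" "0 \<le> 1 - (norm \<alpha>)\<^sup>2" using \<alpha>1 by (auto simp: power_le_one)
  have rD: "norm (complex_of_real r * z) < 1" if "norm z < 1" for z
    using scaled_in_disk[of r z] r that by auto
  have G: "eval_mm ?G z = (phi \<alpha> \<circ> \<psi>) z - phi \<alpha> (complex_of_real r * \<psi> z)" if "z \<in> unit_disk" for z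
    using that rD[OF norm_map, of z] norm_map[of z]
    by (simp add: eval_comp_op[OF bounded] eval_dilation_mm[OF r] eval_mobius_mm[OF \<alpha>1])
  define c where "c = (1 - (norm \<alpha>)\<^sup>2) / (1 - r\<^sup>2 * (norm \<alpha>)\<^sup>2)"
  note dil = phi_dilate[OF \<alpha>(3) _ r, folded c_def]
  have c: "0 \<le> c" "c \<le> 1" using dil(2,3)[of 0] by auto
  define k where "k = \<alpha> - complex_of_real (r * c) * (complex_of_real r * \<alpha>)"
  let ?A = "phi \<alpha> \<circ> \<psi>" and ?B = "phi (complex_of_real r * \<alpha>) \<circ> \<psi>"
  have G': "eval_mm ?G z = (?A z - complex_of_real (r * c) * ?B z) - k" if "z \<in> unit_disk" for z
    unfolding G[OF that] using dil(1)[OF norm_map, of z] that by (simp add: k_def algebra_simps)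
  have A: "?A holomorphic_on unit_disk" "?B holomorphic_on unit_disk"
    using \<alpha>1 less_imp_le[OF rD[OF \<alpha>(3)]] by (intro phi_comp_holomorphic; simp)+
  have rcB: "(\<lambda>z. complex_of_real (r * c) * ?B z) holomorphic_on unit_disk"
    by (intro holomorphic_intros A)
  have G2: "(deriv ^^ 2) (eval_mm ?G) z = (deriv ^^ 2) ?A z + (- complex_of_real (r * c) * (deriv ^^ 2) ?B z)"
    if z: "z \<in> unit_disk" for z
  proof -
    have "(deriv ^^ 2) (eval_mm ?G) z = (deriv ^^ 2) (\<lambda>z. (?A z - complex_of_real (r * c) * ?B z) - k) z"
      by (rule higher_deriv_transform_within_open[OF eval_mm_holomorphic _ open_ball z G'])
         (intro holomorphic_intros A rcB)
    also have "\<dots> = (deriv ^^ 2) (\<lambda>z. ?A z - complex_of_real (r * c) * ?B z) z - (deriv ^^ 2) (\<lambda>_. k) z"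
      by (rule higher_deriv_diff[OF _ holomorphic_on_const open_ball z]) (intro holomorphic_on_diff A rcB)
    also have "\<dots> = (deriv ^^ 2) ?A z - complex_of_real (r * c) * (deriv ^^ 2) ?B z"
      using higher_deriv_diff[OF A(1) rcB open_ball z, of 2] higher_deriv_cmult[OF A(2) z open_ball, of 2 "complex_of_real (r * c)"]
      by simp
    finally show ?thesis by simp
  qed
  have A2: "(deriv ^^ 2) ?A holomorphic_on unit_disk" "(deriv ^^ 2) ?B holomorphic_on unit_disk"
    by (intro holomorphic_higher_deriv A open_ball)+
  have "disk_norm1 ((deriv ^^ 2) (eval_mm ?G))
     = disk_norm1 (\<lambda>z. (deriv ^^ 2) ?A z + (- complex_of_real (r * c) * (deriv ^^ 2) ?B z))"
    by (rule disk_norm1_cong[OF G2])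
  also have "\<dots> \<le> disk_norm1 ((deriv ^^ 2) ?A) + disk_norm1 (\<lambda>z. - complex_of_real (r * c) * (deriv ^^ 2) ?B z)"
    by (intro disk_norm1_triangle borel_measurable_disk_holomorphic holomorphic_intros A2)
  also have "\<dots> \<le> disk_norm1 ((deriv ^^ 2) ?A) + disk_norm1 ((deriv ^^ 2) ?B)"
  proof (intro add_left_mono disk_norm1_mono)
    fix z
    have "norm (- complex_of_real (r * c)) \<le> 1"
      using r c mult_le_one[of r c] unfolding norm_minus_cancel norm_of_real by simp
    then show "norm (- complex_of_real (r * c) * (deriv ^^ 2) ?B z) \<le> norm ((deriv ^^ 2) ?B z)"
      unfolding norm_mult by (intro mult_left_le_one_le) auto
  qed
  also have "\<dots> \<le> ennreal \<tau> + ennreal \<tau>"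
  proof (rule add_mono)
    have "r * norm \<alpha> \<le> norm \<alpha>" using r by (intro mult_left_le_one_le) auto
    then show "disk_norm1 ((deriv ^^ 2) ?A) \<le> ennreal \<tau>"
      using phi_comp_tail[of s \<alpha>] \<alpha> \<tau>(1) by (auto intro: order_trans)
    show "disk_norm1 ((deriv ^^ 2) ?B) \<le> ennreal \<tau>"
      using phi_comp_tail[of s "complex_of_real r * \<alpha>"] rD[OF \<alpha>(3)] \<alpha>(1) r \<tau>(1)
      by (auto simp: norm_mult intro: order_trans)
  qed
  \<comment> \<open>The norm estimate is stated for strictly positive bounds, whereas \<tau> may be
    0.\<close>
  also have "\<dots> \<le> ennreal (2 * \<tau> + \<epsilon>)" using \<tau> \<epsilon> by (simp flip: ennreal_plus add: ennreal_leI)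
  finally have "norm ?G \<le> norm (eval_mm ?G 0) + norm (deriv (eval_mm ?G) 0) + 1586 * (2 * \<tau> + \<epsilon>)"
    using \<tau> \<epsilon> by (intro norm_mm_le_deriv2) auto
  moreover
  \<comment> \<open>The segment from r \<psi>(0) to \<psi>(0) stays in this disc, at distance
    \<open>\<beta>\<close> from the circle; the derivatives of the atoms are bounded there uniformly
    in \<alpha>.\<close>
  have bw: "norm w < 1" "1 / (1 - norm w)\<^sup>2 \<le> 1 / \<beta>\<^sup>2" "2 / (1 - norm w) ^ 3 \<le> 2 / \<beta> ^ 3"
    if "w \<in> cball 0 (norm b)" for w
    using that b \<beta> by (auto simp: \<beta>_def b_def[symmetric] intro!: divide_left_mono power_mono mult_pos_pos zero_less_power)
  have p1: "norm (phi1 \<alpha> w) \<le> 1 / \<beta>\<^sup>2" if "w \<in> cball 0 (norm b)" for w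
  proof -
    have "norm (phi1 \<alpha> w) \<le> (1 - (norm \<alpha>)\<^sup>2) / (1 - norm w)\<^sup>2" by (rule norm_phi1_le[OF \<alpha>1 bw(1)[OF that]])
    also have "\<dots> \<le> 1 / (1 - norm w)\<^sup>2" using \<alpha>2 by (intro divide_right_mono) auto
    finally show ?thesis using bw(2)[OF that] by simp
  qed
  have p2: "norm (phi2 \<alpha> w) \<le> 2 / \<beta> ^ 3" if "w \<in> cball 0 (norm b)" for w
  proof -
    have "norm (phi2 \<alpha> w) \<le> 2 * (1 - (norm \<alpha>)\<^sup>2) / (1 - norm w) ^ 3" by (rule norm_phi2_le[OF \<alpha>1 bw(1)[OF that]])
    also have "\<dots> \<le> 2 / (1 - norm w) ^ 3" using \<alpha>2 bw(1)[OF that] by (intro divide_right_mono) auto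
    finally show ?thesis using bw(3)[OF that] by simp
  qed
  have rb: "complex_of_real r * b \<in> cball 0 (norm b)" "b \<in> cball 0 (norm b)"
    using r by (auto simp: norm_mult mult_left_le_one_le)
  have dist_rb: "norm (b - complex_of_real r * b) \<le> 1 - r"
  proof -
    have "b - complex_of_real r * b = complex_of_real (1 - r) * b" by (simp add: algebra_simps)
    then have "norm (b - complex_of_real r * b) = (1 - r) * norm b" using r by (simp add: norm_mult del: of_real_diff)
    then show ?thesis using r b by (simp add: mult_left_le)
  qed
  have Dw: "(phi \<alpha> has_field_derivative phi1 \<alpha> w) (at w within cball 0 (norm b))"
      "(phi1 \<alpha> has_field_derivative phi2 \<alpha> w) (at w within cball 0 (norm b))" if "w \<in> cball 0 (norm b)" for w
    by (rule has_field_derivative_at_within, rule phi_DERIV phi1_DERIV, rule \<alpha>1, rule bw(1)[OF that])+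
  have "norm (eval_mm ?G 0) \<le> (1 - r) * (1 / \<beta>\<^sup>2)"
  proof -
    have "eval_mm ?G 0 = phi \<alpha> b - phi \<alpha> (complex_of_real r * b)" using G[of 0] by (simp add: b_def)
    also have "norm \<dots> \<le> 1 / \<beta>\<^sup>2 * norm (b - complex_of_real r * b)"
      by (rule field_differentiable_bound[OF convex_cball Dw(1) p1 rb(2) rb(1)])
    also have "\<dots> \<le> 1 / \<beta>\<^sup>2 * (1 - r)" using dist_rb by (intro mult_left_mono) auto
    finally show ?thesis by (simp only: mult.commute)
  qed
  moreover have "norm (deriv (eval_mm ?G) 0) \<le> (1 - r) * ((2 / \<beta> ^ 3 + 1 / \<beta>\<^sup>2) * norm (deriv \<psi> 0))"
  proof -
    have "((\<lambda>z. (phi \<alpha> \<circ> \<psi>) z - phi \<alpha> (complex_of_real r * \<psi> z)) has_field_derivative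
      phi1 \<alpha> (\<psi> 0) * deriv \<psi> 0 - phi1 \<alpha> (complex_of_real r * \<psi> 0) * (complex_of_real r * deriv \<psi> 0)) (at 0)"
    proof (intro DERIV_diff)
      show "(phi \<alpha> \<circ> \<psi> has_field_derivative phi1 \<alpha> (\<psi> 0) * deriv \<psi> 0) (at 0)"
        by (rule phi_comp_DERIV[OF \<alpha>1]) simp
      have "((\<lambda>z. complex_of_real r * \<psi> z) has_field_derivative complex_of_real r * deriv \<psi> 0) (at 0)"
        by (rule DERIV_cmult, rule map_DERIV) simp
      then show "((\<lambda>z. phi \<alpha> (complex_of_real r * \<psi> z)) has_field_derivative
         phi1 \<alpha> (complex_of_real r * \<psi> 0) * (complex_of_real r * deriv \<psi> 0)) (at 0)"
        by (rule DERIV_chain2[where g="\<lambda>z. complex_of_real r * \<psi> z" and x=0, OF phi_DERIV[OF \<alpha>1 rD[OF norm_map]], rotated]) simp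
    qed
    then have "(eval_mm ?G has_field_derivative
      phi1 \<alpha> (\<psi> 0) * deriv \<psi> 0 - phi1 \<alpha> (complex_of_real r * \<psi> 0) * (complex_of_real r * deriv \<psi> 0)) (at 0)"
      by (rule has_field_derivative_disk_transform[OF _ _ G]) simp
    then have "deriv (eval_mm ?G) 0 = ((phi1 \<alpha> b - phi1 \<alpha> (complex_of_real r * b)) + complex_of_real (1 - r) * phi1 \<alpha> (complex_of_real r * b)) * deriv \<psi> 0"
      by (simp add: DERIV_imp_deriv b_def algebra_simps)
    moreover have "norm ((phi1 \<alpha> b - phi1 \<alpha> (complex_of_real r * b)) + complex_of_real (1 - r) * phi1 \<alpha> (complex_of_real r * b))
      \<le> (1 - r) * (2 / \<beta> ^ 3 + 1 / \<beta>\<^sup>2)"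
    proof -
      have "norm (phi1 \<alpha> b - phi1 \<alpha> (complex_of_real r * b)) \<le> 2 / \<beta> ^ 3 * norm (b - complex_of_real r * b)"
        by (rule field_differentiable_bound[OF convex_cball Dw(2) p2 rb(2) rb(1)])
      also have "\<dots> \<le> 2 / \<beta> ^ 3 * (1 - r)" using dist_rb \<beta> by (intro mult_left_mono) auto
      finally have 1: "norm (phi1 \<alpha> b - phi1 \<alpha> (complex_of_real r * b)) \<le> 2 / \<beta> ^ 3 * (1 - r)" .
      have "norm (complex_of_real (1 - r) * phi1 \<alpha> (complex_of_real r * b)) = (1 - r) * norm (phi1 \<alpha> (complex_of_real r * b))"
        using r by (simp add: norm_mult del: of_real_diff)
      also have "\<dots> \<le> (1 - r) * (1 / \<beta>\<^sup>2)" using r p1[OF rb(1)] by (intro mult_left_mono) auto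
      finally have "norm (complex_of_real (1 - r) * phi1 \<alpha> (complex_of_real r * b)) \<le> (1 - r) * (1 / \<beta>\<^sup>2)" .
      with 1 show ?thesis
        by (intro norm_triangle_le) (simp add: distrib_left mult.commute)
    qed
    ultimately show ?thesis by (simp only: norm_mult mult.assoc[symmetric] mult_right_mono norm_ge_zero)
  qed
  ultimately show ?thesis by (simp add: distrib_left)
qed

text \<open>One \<open>r\<close> must serve all parameters. On the circle the atoms are constant and
  the difference is 0; up to \<open>s1\<close> the difference is small in norm and the operator norm
  is absorbed; beyond \<open>s1\<close> both \<alpha> and r \<alpha> fall in the tail.\<close>

lemma exists_good_dilation:
  assumes s: "0 \<le> s" "s < 1" and \<tau>: "tail_sup \<psi> s \<le> ennreal \<tau>" "\<tau> \<ge> 0" and \<epsilon>: "\<epsilon> > 0"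
  obtains r where "0 < r" "r < 1"
    "\<And>\<alpha>. norm \<alpha> \<le> 1 \<Longrightarrow> norm (comp_op \<psi> (mobius_mm \<alpha> - dilation_mm r (mobius_mm \<alpha>))) \<le> \<epsilon> + 1586 * (2 * \<tau> + \<epsilon>)"
proof -
  define \<beta> where "\<beta> = 1 - norm (\<psi> 0)"
  have \<beta>: "\<beta> > 0" using norm_map[of 0] by (simp add: \<beta>_def)
  define Kb where "Kb = 1 / \<beta>\<^sup>2 + (2 / \<beta> ^ 3 + 1 / \<beta>\<^sup>2) * norm (deriv \<psi> 0)"
  have Kb: "Kb \<ge> 0" using \<beta> by (simp add: Kb_def)
  define Cn where "Cn = onorm (comp_op \<psi>) + 1"
  have Cn: "Cn \<ge> 1" using onorm_pos_le[OF bounded_linear_comp] by (simp add: Cn_def)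
  \<comment> \<open>A radius strictly above \<open>s\<close>, so that r |\<alpha>| > s can still be
    achieved for all |\<alpha>| > \<open>s1\<close>.\<close>
  define s1 where "s1 = (1 + s) / 2"
  have s1: "s < s1" "s1 < 1" "0 < s1" using s by (auto simp: s1_def)
  \<comment> \<open>Chosen so that 1586 * 2 \<eta> = \<epsilon> / (2 Cn), one half of what is
    allowed before the operator is applied.\<close>
  define \<eta> where "\<eta> = \<epsilon> / (4 * 1586 * Cn)"
  have \<eta>: "\<eta> > 0" using \<epsilon> Cn by (simp add: \<eta>_def)
  obtain \<delta> where \<delta>: "\<delta> > 0" "\<And>\<alpha> \<beta> z w. norm \<alpha> \<le> s1 \<Longrightarrow> norm \<beta> \<le> s1 \<Longrightarrow> norm z \<le> 1 \<Longrightarrow> norm w \<le> 1 \<Longrightarrow>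
    dist (\<alpha>, z) (\<beta>, w) < \<delta> \<Longrightarrow> norm (phi2 \<alpha> z - phi2 \<beta> w) < \<eta>"
    using phi2_uniformly_continuous[OF s1(2) \<eta>] by blast
  define M where "M = 2 * (2 / (1 - s1) ^ 3)"
  have M: "M > 0" using s1 by (simp add: M_def)
  \<comment> \<open>In order, the entries ensure r > 0, closeness of z and r z, the bound on the
    factor 1 - r^2, the other half of \<epsilon> / Cn, r > s / s1, and smallness of the terms at
    0.\<close>
  define d where "d = Min {1, \<delta>, \<eta> / M, \<epsilon> / (2 * Cn), 1 - s / s1, \<epsilon> / (Kb + 1)}"
  have d: "d > 0" using \<delta> \<eta> M \<epsilon> Cn s1 Kb by (simp add: d_def)
  have d_le: "d \<le> 1" "d \<le> \<delta>" "d \<le> \<eta> / M" "d \<le> \<epsilon> / (2 * Cn)" "d \<le> 1 - s / s1" "d \<le> \<epsilon> / (Kb + 1)"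
    by (auto simp: d_def)
  define r where "r = 1 - d / 2"
  have r: "0 < r" "r < 1" "1 - r < d" using d d_le(1) by (auto simp: r_def)
  show thesis
  proof (rule that[OF r(1,2)])
    fix \<alpha> :: complex assume \<alpha>: "norm \<alpha> \<le> 1"
    let ?F = "mobius_mm \<alpha> - dilation_mm r (mobius_mm \<alpha>)"
    consider "norm \<alpha> = 1" | "norm \<alpha> \<le> s1" | "s1 < norm \<alpha>" "norm \<alpha> < 1" using \<alpha> by linarith
    then show "norm (comp_op \<psi> ?F) \<le> \<epsilon> + 1586 * (2 * \<tau> + \<epsilon>)"
    proof cases
      case 1
      have "?F = 0"
      proof (rule eval_mm_eqI)
        fix z :: complex assume z: "z \<in> unit_disk"
        then have "norm (complex_of_real r * z) < 1" using scaled_in_disk[of r z] r by auto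
        then show "eval_mm ?F z = eval_mm 0 z"
          using z 1 by (simp add: eval_dilation_mm[OF r(1,2)] eval_mobius_mm phi_unimodular)
      qed
      then show ?thesis using \<tau> \<epsilon> linear_0[OF bounded_linear.linear[OF bounded_linear_comp]] by simp
    next
      case 2
      have "norm ?F \<le> (1 - r) + 1586 * (2 * \<eta>)"
      proof (rule norm_dilation_difference[OF 2 s1(2) r(1,2) \<eta>])
        fix z :: complex assume z: "z \<in> unit_disk"
        have "z - complex_of_real r * z = complex_of_real (1 - r) * z" by (simp add: algebra_simps)
        then have "dist z (complex_of_real r * z) = (1 - r) * norm z"
          using r by (simp add: dist_norm norm_mult del: of_real_diff)
        also have "\<dots> \<le> 1 - r" using z r by (simp add: mult_left_le)
        finally have "dist (\<alpha>, z) (\<alpha>, complex_of_real r * z) < \<delta>" using r d_le(2) by (simp add: dist_Pair_Pair)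
        then show "norm (phi2 \<alpha> z - phi2 \<alpha> (complex_of_real r * z)) \<le> \<eta>"
          using \<delta>(2)[of \<alpha> \<alpha> z "complex_of_real r * z"] 2 z scaled_in_disk[of r z] r by auto
      next
        have "(1 - r) * M \<le> \<eta> / M * M" using r d_le(3) M by (intro mult_right_mono) auto
        moreover have "2 * (1 - r) * (2 / (1 - s1) ^ 3) = (1 - r) * M" by (simp add: M_def)
        ultimately show "2 * (1 - r) * (2 / (1 - s1) ^ 3) \<le> \<eta>" using M by simp
      qed
      also have "\<dots> \<le> \<epsilon> / (2 * Cn) + 1586 * (2 * \<eta>)" using r d_le(4) by simp
      also have "\<dots> = \<epsilon> / Cn" using Cn by (simp add: \<eta>_def field_simps)
      finally have F: "norm ?F \<le> \<epsilon> / Cn" .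
      have "norm (comp_op \<psi> ?F) \<le> onorm (comp_op \<psi>) * norm ?F" by (rule onorm[OF bounded_linear_comp])
      also have "\<dots> \<le> Cn * (\<epsilon> / Cn)" using F Cn by (intro mult_mono) (auto simp: Cn_def)
      also have "\<dots> = \<epsilon>" using Cn by simp
      finally show ?thesis using \<tau> \<epsilon> by simp
    next
      case 3
      have "s = (s / s1) * s1" using s1 by simp
      also have "\<dots> < r * norm \<alpha>"
        using 3 r d_le(5) s s1 by (intro mult_strict_mono) auto
      finally have "norm (comp_op \<psi> ?F) \<le> (1 - r) * Kb + 1586 * (2 * \<tau> + \<epsilon>)"
        unfolding Kb_def \<beta>_def by (rule norm_comp_dilation_difference[OF _ s(1) 3(2) r(1,2) \<tau> \<epsilon>])
      also have "(1 - r) * Kb \<le> \<epsilon> / (Kb + 1) * (Kb + 1)" using r d_le(6) Kb by (intro mult_mono) auto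
      also have "\<dots> = \<epsilon>" using Kb by simp
      finally show ?thesis by simp
    qed
  qed
qed

lemma essential_norm_le_tail:
  assumes s: "0 \<le> s" "s < 1"
  shows "ennreal (essential_norm (comp_op \<psi>)) \<le> ennreal 3172 * tail_sup \<psi> s"
proof (cases "tail_sup \<psi> s")
  case (real \<tau>)
  have "essential_norm (comp_op \<psi>) \<le> 3172 * \<tau>"
  proof (rule field_le_epsilon)
    fix e :: real assume e: "e > 0"
    \<comment> \<open>The bound to come contains \<epsilon> + 1586 \<epsilon>, which is then exactly
      e.\<close>
    define \<epsilon> where "\<epsilon> = e / 1587"
    have \<epsilon>: "\<epsilon> > 0" using e by (simp add: \<epsilon>_def)
    obtain r where r: "0 < r" "r < 1"
      "\<And>\<alpha>. norm \<alpha> \<le> 1 \<Longrightarrow> norm (comp_op \<psi> (mobius_mm \<alpha> - dilation_mm r (mobius_mm \<alpha>))) \<le> \<epsilon> + 1586 * (2 * \<tau> + \<epsilon>)"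
      using exists_good_dilation[OF s _ _ \<epsilon>, of \<tau>] real by auto
    have d: "bounded_linear (dilation_mm r)" by (rule bounded_linear_dilation_mm[OF r(1,2)])
    have diff: "comp_op \<psi> f - comp_op \<psi> (dilation_mm r f) = comp_op \<psi> (f - dilation_mm r f)" for f
      by (simp add: linear_diff[OF bounded_linear.linear[OF bounded_linear_comp]])
    have "essential_norm (comp_op \<psi>) \<le> \<epsilon> + 1586 * (2 * \<tau> + \<epsilon>)"
    proof (rule essential_norm_le[OF bounded_linear_comp compact_op_comp_dilation[OF bounded r(1,2)]])
      show "norm (comp_op \<psi> f - comp_op \<psi> (dilation_mm r f)) \<le> (\<epsilon> + 1586 * (2 * \<tau> + \<epsilon>)) * norm f" for f
        unfolding diff
      proof (rule bounded_linear_mm_bound)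
        show "bounded_linear (\<lambda>f. comp_op \<psi> (f - dilation_mm r f))"
          by (intro bounded_linear_compose[OF bounded_linear_comp] bounded_linear_sub bounded_linear_ident d)
        show "comp_op \<psi> (scaleC_mm c f - dilation_mm r (scaleC_mm c f)) = scaleC_mm c (comp_op \<psi> (f - dilation_mm r f))" for c f
          unfolding comp_op_scaleC[OF bounded, symmetric] dilation_mm_scaleC[OF r(1,2)]
          by (rule arg_cong[where f="comp_op \<psi>"], rule eval_mm_eqI) (simp add: algebra_simps)
      qed (rule r(3))
      show "0 \<le> \<epsilon> + 1586 * (2 * \<tau> + \<epsilon>)" using \<epsilon> real by simp
    qed
    also have "\<dots> = 3172 * \<tau> + e" by (simp add: \<epsilon>_def field_simps)
    finally show "essential_norm (comp_op \<psi>) \<le> 3172 * \<tau> + e" .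
  qed
  then have "ennreal (essential_norm (comp_op \<psi>)) \<le> ennreal (3172 * \<tau>)" by (rule ennreal_leI)
  also have "\<dots> = ennreal 3172 * tail_sup \<psi> s" unfolding real(2) by (rule ennreal_mult) (use real in auto)
  finally show ?thesis .
next
  case top
  then show ?thesis by (simp add: ennreal_mult_top)
qed

lemma essential_norm_le_limsup:
  "ennreal (essential_norm (comp_op \<psi>)) \<le> ennreal 3172 * limsup_second_deriv \<psi>"
proof (rule tendsto_lowerbound)
  show "((\<lambda>s. ennreal 3172 * tail_sup \<psi> s) \<longlongrightarrow> ennreal 3172 * limsup_second_deriv \<psi>) (at_left 1)"
    by (intro ennreal_tendsto_cmult tail_sup_tendsto) simp
  show "\<forall>\<^sub>F s in at_left 1. ennreal (essential_norm (comp_op \<psi>)) \<le> ennreal 3172 * tail_sup \<psi> s"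
  proof (rule eventually_at_leftI[of 0])
    fix s :: real assume "s \<in> {0<..<1}"
    then show "ennreal (essential_norm (comp_op \<psi>)) \<le> ennreal 3172 * tail_sup \<psi> s"
      by (intro essential_norm_le_tail) auto
  qed simp
qed simp

section \<open>Lower bound for the essential norm\<close>

lemma limsup_le_tail:
  assumes "s < 1"
  shows "limsup_second_deriv \<psi> \<le> tail_sup \<psi> s"
proof (rule tendsto_upperbound[OF tail_sup_tendsto])
  show "\<forall>\<^sub>F t in at_left 1. tail_sup \<psi> t \<le> tail_sup \<psi> s"
    using assms by (intro eventually_at_leftI[of s]) (auto simp: tail_sup_def intro!: SUP_subset_mono)
qed simp

lemma phi_comp_deriv2_tendsto_0:
  assumes \<alpha>: "\<And>n. norm (\<alpha> n) < 1" "(\<lambda>n. norm (\<alpha> n)) \<longlonglongrightarrow> 1" and z: "z \<in> unit_disk"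
  shows "(\<lambda>n. (deriv ^^ 2) (phi (\<alpha> n) \<circ> \<psi>) z) \<longlonglongrightarrow> 0"
proof -
  have b: "norm (\<psi> z) < 1" using norm_map z by simp
  have l: "(\<lambda>n. 1 - (norm (\<alpha> n))\<^sup>2) \<longlonglongrightarrow> 1 - 1\<^sup>2" by (intro tendsto_intros \<alpha>)
  have "(\<lambda>n. (1 - (norm (\<alpha> n))\<^sup>2) / (1 - norm (\<psi> z))\<^sup>2) \<longlonglongrightarrow> (1 - 1\<^sup>2) / (1 - norm (\<psi> z))\<^sup>2"
    "(\<lambda>n. 2 * (1 - (norm (\<alpha> n))\<^sup>2) / (1 - norm (\<psi> z)) ^ 3) \<longlonglongrightarrow> 2 * (1 - 1\<^sup>2) / (1 - norm (\<psi> z)) ^ 3"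
    using b by (intro tendsto_divide tendsto_mult tendsto_const l; simp)+
  then have l1: "(\<lambda>n. (1 - (norm (\<alpha> n))\<^sup>2) / (1 - norm (\<psi> z))\<^sup>2) \<longlonglongrightarrow> 0"
    and l2: "(\<lambda>n. 2 * (1 - (norm (\<alpha> n))\<^sup>2) / (1 - norm (\<psi> z)) ^ 3) \<longlonglongrightarrow> 0" by simp_all
  have p1: "(\<lambda>n. phi1 (\<alpha> n) (\<psi> z)) \<longlonglongrightarrow> 0"
    by (rule Lim_null_comparison[OF always_eventually l1]) (use norm_phi1_le[OF less_imp_le[OF \<alpha>(1)] b] in blast)
  have p2: "(\<lambda>n. phi2 (\<alpha> n) (\<psi> z)) \<longlonglongrightarrow> 0"
    by (rule Lim_null_comparison[OF always_eventually l2]) (use norm_phi2_le[OF less_imp_le[OF \<alpha>(1)] b] in blast)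
  have "(\<lambda>n. phi2 (\<alpha> n) (\<psi> z) * (deriv \<psi> z)\<^sup>2 + phi1 (\<alpha> n) (\<psi> z) * deriv (deriv \<psi>) z) \<longlonglongrightarrow> 0 * (deriv \<psi> z)\<^sup>2 + 0 * deriv (deriv \<psi>) z"
    by (intro tendsto_intros p1 p2)
  then show ?thesis using z by (simp add: phi_comp_deriv2[OF less_imp_le[OF \<alpha>(1)]])
qed

lemma limsup_le_compact_perturbation:
  assumes K: "compact_op K"
  shows "limsup_second_deriv \<psi> \<le> ennreal (256 * onorm (\<lambda>f. comp_op \<psi> f - K f))"
proof (rule ccontr)
  define M where "M = onorm (\<lambda>f. comp_op \<psi> f - K f)"
  have blK: "bounded_linear (\<lambda>f. comp_op \<psi> f - K f)"
    by (intro bounded_linear_sub bounded_linear_comp compact_op_bounded_linear K)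
  have M: "M \<ge> 0" unfolding M_def by (rule onorm_pos_le[OF blK])
  assume "\<not> limsup_second_deriv \<psi> \<le> ennreal (256 * onorm (\<lambda>f. comp_op \<psi> f - K f))"
  then have "ennreal (256 * M) < limsup_second_deriv \<psi>" by (simp add: M_def)
  then obtain B' where B': "ennreal (256 * M) < B'" "B' < limsup_second_deriv \<psi>" using dense by blast
  define B where "B = enn2real B'"
  have "B' < top" using B'(2) by (auto intro: less_le_trans)
  then have BB: "B' = ennreal B" by (simp add: B_def)
  have B0: "B \<ge> 0" by (simp add: B_def)
  have B: "256 * M < B" "ennreal B < limsup_second_deriv \<psi>"
    using B' B0 M unfolding BB by (auto simp: ennreal_less_iff)
  \<comment> \<open>Chosen so that 128 (2 M + \<epsilon>) = B: 2 M from the operator on a difference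
    of two atoms, \<epsilon> from \<open>K\<close>, and 128 from passing to second
    derivatives.\<close>
  define \<epsilon> where "\<epsilon> = (B - 256 * M) / 128"
  have \<epsilon>: "\<epsilon> > 0" using B by (simp add: \<epsilon>_def)
  have "\<exists>\<alpha>. 1 - inverse (real (Suc n)) < norm \<alpha> \<and> norm \<alpha> < 1 \<and> ennreal B < disk_norm1 ((deriv ^^ 2) (phi \<alpha> \<circ> \<psi>))" for n
  proof -
    have "ennreal B < tail_sup \<psi> (1 - inverse (real (Suc n)))"
      using B(2) limsup_le_tail[of "1 - inverse (real (Suc n))"] by (auto intro: less_le_trans)
    then show ?thesis unfolding tail_sup_def less_SUP_iff by auto
  qed
  then obtain a where a: "\<And>n. 1 - inverse (real (Suc n)) < norm (a n)" "\<And>n. norm (a n) < 1"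
    "\<And>n. ennreal B < disk_norm1 ((deriv ^^ 2) (phi (a n) \<circ> \<psi>))" by metis
  have a_lim: "(\<lambda>n. norm (a n)) \<longlonglongrightarrow> 1"
  proof (rule tendsto_sandwich)
    show "(\<lambda>n. 1 - inverse (real (Suc n))) \<longlonglongrightarrow> 1"
      using tendsto_diff[OF tendsto_const LIMSEQ_inverse_real_of_nat, of 1] by simp
  qed (use a(1,2) in \<open>auto intro!: always_eventually less_imp_le\<close>)
  have "\<forall>n. K (mobius_mm (a n)) \<in> closure (K ` cball 0 1)"
    using norm_mobius_mm_le[OF less_imp_le[OF a(2)]] by (intro allI subsetD[OF closure_subset] imageI) simp
  moreover have "seq_compact (closure (K ` cball 0 1))"
    using K by (simp add: compact_op_def compact_imp_seq_compact)
  ultimately obtain l \<sigma> where \<sigma>: "strict_mono (\<sigma> :: nat \<Rightarrow> nat)" "((\<lambda>n. K (mobius_mm (a n))) \<circ> \<sigma>) \<longlonglongrightarrow> l"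
    using seq_compactE[of "closure (K ` cball 0 1)" "\<lambda>n. K (mobius_mm (a n))"] by blast
  define \<alpha> where "\<alpha> = (\<lambda>n. a (\<sigma> n))"
  have \<alpha>: "norm (\<alpha> n) < 1" "ennreal B < disk_norm1 ((deriv ^^ 2) (phi (\<alpha> n) \<circ> \<psi>))" for n
    using a by (auto simp: \<alpha>_def)
  have \<alpha>_lim: "(\<lambda>n. norm (\<alpha> n)) \<longlonglongrightarrow> 1"
    using LIMSEQ_subseq_LIMSEQ[OF a_lim \<sigma>(1)] by (simp add: o_def \<alpha>_def)
  have "Cauchy (\<lambda>n. K (mobius_mm (\<alpha> n)))"
    using LIMSEQ_imp_Cauchy[OF \<sigma>(2)] by (simp add: o_def \<alpha>_def)
  \<comment> \<open>The atom with index \<open>j\<close> is kept fixed from here on; only its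
    differences with later atoms are tested.\<close>
  then obtain j where j: "\<And>m n. m \<ge> j \<Longrightarrow> n \<ge> j \<Longrightarrow> norm (K (mobius_mm (\<alpha> m)) - K (mobius_mm (\<alpha> n))) < \<epsilon>"
    using CauchyD[OF _ \<epsilon>] by blast
  let ?g = "\<lambda>n. (deriv ^^ 2) (phi (\<alpha> n) \<circ> \<psi>)"
  have g_hol: "?g n holomorphic_on unit_disk" for n
    by (intro holomorphic_higher_deriv phi_comp_holomorphic open_ball less_imp_le \<alpha>)
  have bound: "disk_norm1 (\<lambda>z. ?g k z - ?g j z) \<le> ennreal B" if k: "k \<ge> j" for k
  proof -
    let ?f = "mobius_mm (\<alpha> k) - mobius_mm (\<alpha> j)"
    interpret K: bounded_linear K by (rule compact_op_bounded_linear[OF K])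
    have "norm ?f \<le> norm (mobius_mm (\<alpha> k)) + norm (mobius_mm (\<alpha> j))" by (rule norm_triangle_ineq4)
    also have "\<dots> \<le> 1 + 1" using \<alpha>(1) by (intro add_mono norm_mobius_mm_le less_imp_le)
    finally have f2: "norm ?f \<le> 2" by simp
    have "comp_op \<psi> ?f = (comp_op \<psi> ?f - K ?f) + (K (mobius_mm (\<alpha> k)) - K (mobius_mm (\<alpha> j)))"
      by (simp add: K.diff)
    then have "norm (comp_op \<psi> ?f) \<le> norm (comp_op \<psi> ?f - K ?f) + norm (K (mobius_mm (\<alpha> k)) - K (mobius_mm (\<alpha> j)))"
      using norm_triangle_ineq by metis
    also have "norm (comp_op \<psi> ?f - K ?f) \<le> M * norm ?f" unfolding M_def by (rule onorm[OF blK])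
    also have "M * norm ?f \<le> M * 2" using f2 M by (intro mult_left_mono)
    also have "norm (K (mobius_mm (\<alpha> k)) - K (mobius_mm (\<alpha> j))) \<le> \<epsilon>" using j[OF k order_refl] by simp
    finally have "128 * norm (comp_op \<psi> ?f) \<le> B" by (simp add: \<epsilon>_def field_simps)
    then have "disk_norm1 ((deriv ^^ 2) (eval_mm (comp_op \<psi> ?f))) \<le> ennreal B"
      using disk_norm1_deriv2_le_norm[of "comp_op \<psi> ?f"] by (meson ennreal_leI order_trans)
    moreover have "disk_norm1 ((deriv ^^ 2) (eval_mm (comp_op \<psi> ?f))) = disk_norm1 (\<lambda>z. ?g k z - ?g j z)"
    proof (rule disk_norm1_cong)
      fix z assume z: "z \<in> unit_disk"
      have h: "phi (\<alpha> n) \<circ> \<psi> holomorphic_on unit_disk" for n by (intro phi_comp_holomorphic less_imp_le \<alpha>)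
      have "(deriv ^^ 2) (eval_mm (comp_op \<psi> ?f)) z = (deriv ^^ 2) (\<lambda>z. (phi (\<alpha> k) \<circ> \<psi>) z - (phi (\<alpha> j) \<circ> \<psi>) z) z"
        by (rule higher_deriv_transform_within_open[OF eval_mm_holomorphic holomorphic_on_diff[OF h h] open_ball z])
           (simp add: eval_comp_op[OF bounded] eval_mobius_mm[OF less_imp_le[OF \<alpha>(1)]] norm_map)
      then show "(deriv ^^ 2) (eval_mm (comp_op \<psi> ?f)) z = ?g k z - ?g j z"
        by (simp only: higher_deriv_diff[OF h h open_ball z])
    qed
    ultimately show ?thesis by simp
  qed
  have "(\<integral>\<^sup>+z. ennreal (norm (?g j z)) \<partial>disk_measure)
     = (\<integral>\<^sup>+z. liminf (\<lambda>k. ennreal (norm (?g k z - ?g j z))) \<partial>disk_measure)"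
  proof (rule nn_integral_cong)
    fix z assume "z \<in> space disk_measure"
    then have z: "z \<in> unit_disk" by simp
    have "(\<lambda>k. ennreal (norm (?g k z - ?g j z))) \<longlonglongrightarrow> ennreal (norm (0 - ?g j z))"
      by (intro tendsto_ennrealI tendsto_norm tendsto_diff tendsto_const phi_comp_deriv2_tendsto_0[OF \<alpha>(1) \<alpha>_lim z])
    from lim_imp_Liminf[OF sequentially_bot this]
    show "ennreal (norm (?g j z)) = liminf (\<lambda>k. ennreal (norm (?g k z - ?g j z)))"
      by (simp only: diff_0 norm_minus_cancel)
  qed
  also have "\<dots> \<le> liminf (\<lambda>k. \<integral>\<^sup>+z. ennreal (norm (?g k z - ?g j z)) \<partial>disk_measure)"
    by (intro nn_integral_liminf borel_measurable_ennreal_norm borel_measurable_disk_holomorphic holomorphic_on_diff g_hol)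
  also have "\<dots> \<le> limsup (\<lambda>k. \<integral>\<^sup>+z. ennreal (norm (?g k z - ?g j z)) \<partial>disk_measure)"
    by (rule Liminf_le_Limsup) simp
  also have "\<dots> \<le> ennreal (pi * B)"
  proof (rule Limsup_bounded)
    show "\<forall>\<^sub>F k in sequentially. (\<integral>\<^sup>+z. ennreal (norm (?g k z - ?g j z)) \<partial>disk_measure) \<le> ennreal (pi * B)"
      using eventually_ge_at_top[of j]
      by eventually_elim (rule iffD1[OF disk_norm1_le_iff[OF B0] bound])
  qed
  finally have "disk_norm1 (?g j) \<le> ennreal B" by (rule iffD2[OF disk_norm1_le_iff[OF B0]])
  with \<alpha>(2)[of j] show False by simp
qed

text \<open>Ensures that the infimum in \<open>essential_norm\<close> is over a nonempty set, and
  yields finiteness of the limit superior.\<close>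

lemma compact_op_zero: "compact_op (\<lambda>_. 0)"
proof -
  have "Vector_Spaces.linear scaleC_mm scaleC_mm (\<lambda>_. 0)" by unfold_locales simp_all
  moreover have "compact (closure ((\<lambda>_::min_mobius. 0 :: min_mobius) ` cball 0 1))"
    by (simp add: image_constant_conv)
  ultimately show ?thesis by (simp add: compact_op_def)
qed

lemma limsup_le_essential_norm:
  "limsup_second_deriv \<psi> \<le> ennreal (256 * essential_norm (comp_op \<psi>))"
proof -
  define L where "L = enn2real (limsup_second_deriv \<psi>)"
  have "limsup_second_deriv \<psi> < top"
    using limsup_le_compact_perturbation[OF compact_op_zero] by (auto intro: le_less_trans)
  then have L: "limsup_second_deriv \<psi> = ennreal L" "L \<ge> 0" by (simp_all add: L_def)
  have "L / 256 \<le> essential_norm (comp_op \<psi>)"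
    unfolding essential_norm_def
  proof (rule cInf_greatest)
    show "{onorm (\<lambda>f. comp_op \<psi> f - K f) |K. compact_op K} \<noteq> {}" using compact_op_zero by blast
    fix x assume "x \<in> {onorm (\<lambda>f. comp_op \<psi> f - K f) |K. compact_op K}"
    then obtain K where K: "compact_op K" "x = onorm (\<lambda>f. comp_op \<psi> f - K f)" by blast
    have "x \<ge> 0" unfolding K(2) by (intro onorm_pos_le bounded_linear_sub bounded_linear_comp compact_op_bounded_linear K)
    then have "L \<le> 256 * x" using limsup_le_compact_perturbation[OF K(1)] unfolding L(1) K(2) by (subst (asm) ennreal_le_iff) auto
    then show "L / 256 \<le> x" by simp
  qed
  then show ?thesis unfolding L(1) by (intro ennreal_leI) simp
qed

end

theorem theorem1:
  shows "\<exists>C::real. C > 0 \<and>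
    (\<forall>\<psi>::complex \<Rightarrow> complex.
       \<psi> holomorphic_on unit_disk \<longrightarrow> \<psi> ` unit_disk \<subseteq> unit_disk \<longrightarrow> bounded_comp_op \<psi> \<longrightarrow>
       ennreal (inverse C) * limsup_second_deriv \<psi> \<le> ennreal (essential_norm (comp_op \<psi>)) \<and>
       ennreal (essential_norm (comp_op \<psi>)) \<le> ennreal C * limsup_second_deriv \<psi>)"
proof (intro exI[of _ 3172] conjI allI impI)
  fix \<psi> :: "complex \<Rightarrow> complex"
  assume "\<psi> holomorphic_on unit_disk" "\<psi> ` unit_disk \<subseteq> unit_disk" "bounded_comp_op \<psi>"
  then interpret bounded_composition \<psi> by unfold_locales
  show "ennreal (essential_norm (comp_op \<psi>)) \<le> ennreal 3172 * limsup_second_deriv \<psi>"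
    by (rule essential_norm_le_limsup)
  let ?E = "essential_norm (comp_op \<psi>)"
  \<comment> \<open>Since 256 is below 3172, the constant of the upper bound serves on both
    sides.\<close>
  have "ennreal (inverse 3172) * limsup_second_deriv \<psi> \<le> ennreal (inverse 3172) * ennreal (256 * ?E)"
    by (intro mult_left_mono limsup_le_essential_norm) simp
  also have "\<dots> = ennreal (inverse 3172 * (256 * ?E))" by (rule ennreal_mult'[symmetric]) simp
  also have "\<dots> \<le> ennreal ?E"
  \<comment> \<open>\<open>ennreal\<close> sends negative reals to 0, so in the negative case the
    left side is 0.\<close>
  proof (cases "?E \<ge> 0")
    case False
    then have "inverse 3172 * (256 * ?E) \<le> 0" by (simp add: mult_le_0_iff)
    then show ?thesis by (simp add: ennreal_neg)
  qed (intro ennreal_leI, simp)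
  finally show "ennreal (inverse 3172) * limsup_second_deriv \<psi> \<le> ennreal ?E" .
qed simp

end
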